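(* Let $d, k \in \mathbb{N}$ with $1<k<d$. Let $\Omega$ be a bounded Lipschitz domain in $\mathbb{R}^{d}$, and let $K \subset \Omega$ be a smooth compact set of class $C^{0,1}$ of codimension $k$ (in the sense defined in the context). Let $p>1$ and $s \in (0,1)$ be such that $sp=d$. Then for any $\tau \geq p$ there exists a constant $C = C(d,s,k,\Omega,K)>0$ (depending only on $d,s,k,\Omega,K$, and in particular not on $\tau$) such that $$\left( \int_{\Omega} \frac{|u(x)|^{\tau}}{\delta^{d}_{K}(x)}\,dx \right)^{\frac{1}{\tau}} \leq C\, \tau^{\frac{d-s}{d}} \left( \int_{\Omega}\int_{\Omega} \frac{|u(x)-u(y)|^{p}}{|x-y|^{d+sp}}\,dx\,dy \right)^{\frac{1}{p}}, \qquad \forall\ u \in W^{s,p}_{0}(\Omega \setminus K).$$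
   Context: Distance: for $K \subset \Omega$ compact and $x \in \Omega$, $\delta_{K}(x) := \inf_{y \in K}|x-y|$. Smooth compact set of class $C^{0,1}$ of codimension $k$: let $k \in \mathbb{N}$, $1<k<d$, and let $Q = B^{k}_{1}(0) \times (0,1)^{d-k}$, where $B^{k}_{1}(0) \subset \mathbb{R}^{k}$ is the unit ball centred at $0$; write $\xi = (\xi_{k},\xi_{d-k}) \in Q$ with $\xi_{k} \in B^{k}_{1}(0)$, $\xi_{d-k} \in (0,1)^{d-k}$. A compact surface $K \subset \Omega$ of codimension $k$ in $\mathbb{R}^{d}$ is of class $C^{0,1}$ if there exists $C>0$ such that for every $x \in K$ there exist a ball $B = B_{r}(x) \subset \mathbb{R}^{d}$, $r>0$, and an isomorphism (bijection) $T: Q \to B$ such that $T \in C^{0,1}(\overline{Q})$, $T^{-1} \in C^{0,1}(\overline{B})$, $\|T\|_{C^{0,1}(\overline{Q})} + \|T^{-1}\|_{C^{0,1}(\overline{B})} \leq C$, and $T^{-1}(B \cap K) = \{(\xi_{k},\xi_{d-k}) \in Q : \xi_{k}=0\}$; moreover, for any $y \in (\Omega \setminus K) \cap B$ with $y = T((\xi_{k},\xi_{d-k}))$ one has $\delta_{K}(y) \sim |\xi_{k}|$, i.e. $C_{1}|\xi_{k}| \leq \delta_{K}(y) \leq C_{2}|\xi_{k}|$ for some $C_{1},C_{2}>0$ very close to $1$. Function spaces: $[u]_{W^{s,p}(\Omega)} = \left( \int_{\Omega}\int_{\Omega} \frac{|u(x)-u(y)|^{p}}{|x-y|^{d+sp}}\,dx\,dy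 \right)^{1/p}$ and $\|u\|_{W^{s,p}(\Omega)} = \left([u]^{p}_{W^{s,p}(\Omega)} + \|u\|^{p}_{L^{p}(\Omega)}\right)^{1/p}$. $W^{s,p}_{0}(\Omega \setminus K)$ is the closure of $C^{\infty}_{c}(\Omega \setminus K)$ with respect to $\|\cdot\|_{W^{s,p}(\Omega)}$. *)

theory Defs
  imports "HOL-Analysis.Analysis"
begin

section \<open>Bounded Lipschitz domains\<close>

text \<open>
  Near each boundary point the domain is the strict epigraph, in some direction \<open>e\<close>, of a Lipschitz
  function on the hyperplane orthogonal to \<open>e\<close>.  The argument \<open>y - (e \<bullet> y) *\<^sub>R e\<close> below is the
  projection of \<open>y\<close> to that hyperplane; values of \<open>g\<close> off the hyperplane are irrelevant.
\<close>

definition bounded_lipschitz_domain :: "'a::euclidean_space set \<Rightarrow> bool" where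
  "bounded_lipschitz_domain \<Omega> \<longleftrightarrow>
     open \<Omega> \<and> connected \<Omega> \<and> \<Omega> \<noteq> {} \<and> bounded \<Omega> \<and>
     (\<forall>x\<in>frontier \<Omega>. \<exists>r>0. \<exists>e. \<exists>g :: 'a \<Rightarrow> real. \<exists>L.
        norm e = 1 \<and> L-lipschitz_on {z. e \<bullet> z = 0} g \<and>
        \<Omega> \<inter> ball x r = {y \<in> ball x r. g (y - (e \<bullet> y) *\<^sub>R e) < e \<bullet> y})"

section \<open>Compact surfaces of class \<open>C\<^sup>0\<^sup>,\<^sup>1\<close> and codimension \<open>k\<close>\<close>

definition C01_on :: "'a::real_normed_vector set \<Rightarrow> ('a \<Rightarrow> 'b::real_normed_vector) \<Rightarrow> bool" where
  "C01_on S f \<longleftrightarrow> bounded (f ` S) \<and> (\<exists>L. L-lipschitz_on S f)"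

text \<open>The suprema are over bounded sets of reals as soon as \<open>C01_on S f\<close> holds.\<close>

definition C01_norm :: "'a::real_normed_vector set \<Rightarrow> ('a \<Rightarrow> 'b::real_normed_vector) \<Rightarrow> real" where
  "C01_norm S f =
     (SUP x\<in>S. norm (f x)) +
     (SUP (x, y)\<in>{(x, y). x \<in> S \<and> y \<in> S \<and> x \<noteq> y}. norm (f x - f y) / norm (x - y))"

text \<open>
  \<open>\<real>\<^sup>d = \<real>\<^sup>k \<times> \<real>\<^sup>d\<^sup>-\<^sup>k\<close> is encoded by a set \<open>I\<close> of \<open>k\<close> coordinates: the component \<open>\<xi>\<^sub>k\<close> of \<open>\<xi>\<close> consists of the
  coordinates in \<open>I\<close>, so \<open>|\<xi>\<^sub>k| = L2_set (($) \<xi>) I\<close>.  The choice of \<open>I\<close> is immaterial, because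
  permuting coordinates is an isometry.
\<close>

definition model_cylinder :: "'d::finite set \<Rightarrow> (real^'d) set" where
  "model_cylinder I = {\<xi>. L2_set (($) \<xi>) I < 1 \<and> (\<forall>i\<in>-I. 0 < \<xi> $ i \<and> \<xi> $ i < 1)}"

text \<open>
  \<open>T\<close> and \<open>S\<close> are total functions; on the closures of \<open>Q = model_cylinder I\<close> and of the ball they
  are the Lipschitz extensions of the chart and of its inverse.
  Nonemptiness of \<open>K\<close> is what makes \<open>infdist\<close> the infimum of distances (\<open>infdist x {} = 0\<close>).
\<close>

definition C01_compact_surface :: "nat \<Rightarrow> (real^'d::finite) set \<Rightarrow> (real^'d) set \<Rightarrow> bool" where
  "C01_compact_surface k \<Omega> K \<longleftrightarrow>
     compact K \<and> K \<noteq> {} \<and> K \<subseteq> \<Omega> \<and>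
     (\<exists>I :: 'd set. card I = k \<and>
       (\<exists>C>0. \<forall>x\<in>K. \<exists>r>0. \<exists>T S.
          bij_betw T (model_cylinder I) (ball x r) \<and>
          (\<forall>\<xi>\<in>model_cylinder I. S (T \<xi>) = \<xi>) \<and>
          C01_on (closure (model_cylinder I)) T \<and>
          C01_on (closure (ball x r)) S \<and>
          C01_norm (closure (model_cylinder I)) T + C01_norm (closure (ball x r)) S \<le> C \<and>
          S ` (ball x r \<inter> K) = {\<xi> \<in> model_cylinder I. \<forall>i\<in>I. \<xi> $ i = 0} \<and>
          (\<exists>C1>0. \<exists>C2>0. \<forall>\<xi>\<in>model_cylinder I. T \<xi> \<in> \<Omega> - K \<longrightarrow>
             C1 * L2_set (($) \<xi>) I \<le> infdist (T \<xi>) K \<and>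
             infdist (T \<xi>) K \<le> C2 * L2_set (($) \<xi>) I)))"

section \<open>Fractional Sobolev spaces\<close>

text \<open>Powers of extended nonnegative reals, for exponents \<open>a > 0\<close>.\<close>

definition ennreal_powr :: "ennreal \<Rightarrow> real \<Rightarrow> ennreal" where
  "ennreal_powr x a = (if x = top then top else ennreal (enn2real x powr a))"

text \<open>
  The integrand on the diagonal \<open>x = y\<close> is \<open>0\<close> by the convention \<open>0 / 0 = 0\<close>; the diagonal is a null set.
\<close>

definition Wsp_seminorm :: "real \<Rightarrow> real \<Rightarrow> 'a::euclidean_space set \<Rightarrow> ('a \<Rightarrow> real) \<Rightarrow> ennreal" where
  "Wsp_seminorm s p \<Omega> u =
     ennreal_powr
       (\<integral>\<^sup>+x\<in>\<Omega>. (\<integral>\<^sup>+y\<in>\<Omega>.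
           ennreal (\<bar>u x - u y\<bar> powr p / norm (x - y) powr (real DIM('a) + s * p))
         \<partial>lebesgue) \<partial>lebesgue)
       (1 / p)"

definition Lp_norm_on :: "real \<Rightarrow> 'a::euclidean_space set \<Rightarrow> ('a \<Rightarrow> real) \<Rightarrow> ennreal" where
  "Lp_norm_on p \<Omega> u = ennreal_powr (\<integral>\<^sup>+x\<in>\<Omega>. ennreal (\<bar>u x\<bar> powr p) \<partial>lebesgue) (1 / p)"

definition Wsp_norm :: "real \<Rightarrow> real \<Rightarrow> 'a::euclidean_space set \<Rightarrow> ('a \<Rightarrow> real) \<Rightarrow> ennreal" where
  "Wsp_norm s p \<Omega> u =
     ennreal_powr (ennreal_powr (Wsp_seminorm s p \<Omega> u) p + ennreal_powr (Lp_norm_on p \<Omega> u) p) (1 / p)"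

definition Wsp :: "real \<Rightarrow> real \<Rightarrow> 'a::euclidean_space set \<Rightarrow> ('a \<Rightarrow> real) set" where
  "Wsp s p \<Omega> = {u. u \<in> borel_measurable (lebesgue_on \<Omega>) \<and> Wsp_norm s p \<Omega> u < top}"

primrec Ck :: "nat \<Rightarrow> ('a::euclidean_space \<Rightarrow> real) \<Rightarrow> bool" where
  "Ck 0 f \<longleftrightarrow> continuous_on UNIV f"
| "Ck (Suc n) f \<longleftrightarrow>
     (\<forall>x. f differentiable (at x)) \<and> (\<forall>b\<in>Basis. Ck n (\<lambda>x. frechet_derivative f (at x) b))"

text \<open>Test functions on \<open>U\<close>, extended by zero to the whole space.\<close>

definition Cc_infinity :: "'a::euclidean_space set \<Rightarrow> ('a \<Rightarrow> real) set" where
  "Cc_infinity U =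
     {f. (\<forall>n. Ck n f) \<and> compact (closure {x. f x \<noteq> 0}) \<and> closure {x. f x \<noteq> 0} \<subseteq> U}"

text \<open>
  \<open>Wsp_zero s p \<Omega> K\<close> is \<open>W\<^sub>0\<^sup>s\<^sup>,\<^sup>p(\<Omega> - K)\<close>: the closure of the test functions on \<open>\<Omega> - K\<close> in the norm
  over all of \<open>\<Omega>\<close>.
\<close>

definition Wsp_zero ::
    "real \<Rightarrow> real \<Rightarrow> 'a::euclidean_space set \<Rightarrow> 'a set \<Rightarrow> ('a \<Rightarrow> real) set" where
  "Wsp_zero s p \<Omega> K =
     {u \<in> Wsp s p \<Omega>. \<forall>\<epsilon>>0. \<exists>\<phi>\<in>Cc_infinity (\<Omega> - K). Wsp_norm s p \<Omega> (\<lambda>x. u x - \<phi> x) < \<epsilon>}"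

end

theory Submission
  imports Defs
begin

text \<open>
  Write \<open>\<delta>\<close> for the distance to \<open>K\<close>, \<open>d\<close> for the dimension and \<open>E\<close> for the double integral on the right-hand side.
  For \<open>s p = d\<close> its kernel is \<open>|x - y|\<^sup>-\<^sup>2\<^sup>d\<close> and \<open>E\<close> is invariant under scaling, like the measure \<open>\<delta>\<^sup>-\<^sup>d dx\<close>.  The theorem
  combines the case \<open>\<tau> = p\<close>, a Hardy inequality, with a local estimate of Trudinger type in balls that have a
  radius comparable with \<open>\<delta>\<close>.

  Hardy's inequality (\<open>hardy_inequality\<close>).  Close to \<open>K\<close>, the value of \<open>u\<close> at \<open>x\<close> is compared with its values on the set
  of points at distance at most \<open>3 \<delta>(x)\<close> from \<open>x\<close> that are \<open>N\<close> times closer to \<open>K\<close>.  The differences are bounded by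
  the energy \<open>E\<close>.  The values themselves reproduce the Hardy integral, with the small factor \<open>1/N\<close> up to constants:
  a change of the order of integration gives \<open>N\<^sup>-\<^sup>d\<close>, while the set has measure at least of the order
  \<open>N\<^sup>1\<^sup>-\<^sup>d \<delta>(x)\<^sup>d\<close> (\<open>emeasure_collar_ge\<close>), as \<open>K\<close> contains curves.  For large \<open>N\<close> the term is absorbed.
  The part of the domain far from \<open>K\<close> is reached in one step because the domain is bounded.

  The local estimate.  A Lipschitz domain contains, near each of its points \<open>x\<close> and at each small scale \<open>r\<close>, a ball of
  comparable radius in the annulus \<open>r/4 \<le> |x - y| < r\<close>.  The means of \<open>u\<close> over such balls at the radii
  \<open>4\<^sup>-\<^sup>j \<sigma> \<delta>(x)\<close> converge to \<open>u(x)\<close> (\<open>mean_chain\<close>), and the \<open>p\<close>-th power of the \<open>j\<close>-th difference is bounded by the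
  energy density integrated over the \<open>j\<close>-th annulus, \<open>b\<^sub>j(x)\<close>.  These numbers satisfy \<open>\<Sum>\<^sub>j b\<^sub>j(x) \<le> E\<close>, because the
  annuli are disjoint, and \<open>\<integral> b\<^sub>j \<delta>\<^sup>-\<^sup>d \<le> C 4\<^sup>-\<^sup>j E\<close>, because the annuli are small.  The first mean fits into the same
  pattern by Hardy's inequality.  Hoelder's inequality for sums (\<open>sum_root_powr_le\<close>) converts the first fact into
  \<open>|u(x)|\<^sup>\<tau> \<le> (\<Sum>\<^sub>j b\<^sub>j(x)\<^sup>1\<^sup>/\<^sup>p)\<^sup>\<tau> \<le> (2 \<tau>)\<^sup>\<tau>\<^sup>(\<^sup>1\<^sup>-\<^sup>1\<^sup>/\<^sup>p\<^sup>) E\<^sup>\<tau>\<^sup>/\<^sup>p\<^sup>-\<^sup>1 \<Sum>\<^sub>j 2\<^sup>j b\<^sub>j(x)\<close>,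
  up to the \<open>\<tau>\<close>-th power of a constant, and integration against \<open>\<delta>\<^sup>-\<^sup>d\<close> gives the theorem for test functions
  (\<open>weighted_trudinger_inequality\<close>), with the factor \<open>\<tau>\<^sup>1\<^sup>-\<^sup>1\<^sup>/\<^sup>p\<close> and \<open>1 - 1/p = (d - s)/d\<close>.  Fatou's lemma extends it
  to the closure.
\<close>

section \<open>Geometry of the domain and of the surface\<close>

lemma corkscrew_ball_in_annulus:
  fixes e x :: "'a::euclidean_space"
  assumes "norm e = 1" "0 < r" "\<kappa> \<le> 1/4"
  shows "ball (x + (r/2) *\<^sub>R e) (\<kappa> * r) \<subseteq> ball x r - ball x (r/4)"
proof
  fix w assume w: "w \<in> ball (x + (r/2) *\<^sub>R e) (\<kappa> * r)"
  have "dist x (x + (r/2) *\<^sub>R e) = r/2" using assms by (simp add: dist_norm)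
  moreover have "\<kappa> * r \<le> r/4" using assms mult_right_mono[of \<kappa> "1/4" r] by simp
  moreover have "dist (x + (r/2) *\<^sub>R e) w < \<kappa> * r" using w by simp
  moreover note dist_triangle[of x w "x + (r/2) *\<^sub>R e"] dist_triangle[of x "x + (r/2) *\<^sub>R e" w]
  ultimately show "w \<in> ball x r - ball x (r/4)" by (auto simp: dist_commute)
qed

text \<open>
  The interior corkscrew condition, with a ball that also stays away from \<open>x\<close>: the balls chosen at the
  radii \<open>r\<close>, \<open>r/4\<close>, \<open>r/16\<close>, \<open>\<dots>\<close> then lie in disjoint annuli around \<open>x\<close>.
\<close>

definition corkscrew :: "'a::euclidean_space set \<Rightarrow> real \<Rightarrow> 'a \<Rightarrow> real \<Rightarrow> bool" where
  "corkscrew \<Omega> \<kappa> x r \<longleftrightarrow> (\<exists>z. ball z (\<kappa> * r) \<subseteq> \<Omega> \<inter> (ball x r - ball x (r/4)))"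

text \<open>
  Near a boundary point the domain lies above a graph of slope at most \<open>L\<close> in the direction \<open>e\<close>, so it
  contains, with a point \<open>x\<close>, a piece of a cone with vertex \<open>x\<close> and axis \<open>e\<close>.  The ball of radius
  \<open>r / (4 (L + 1))\<close> around \<open>x + (r/2) e\<close> fits into that cone.  Around an interior point any direction will do.
\<close>

lemma corkscrew_near_point:
  fixes \<Omega> :: "'a::euclidean_space set"
  assumes dom: "bounded_lipschitz_domain \<Omega>" and y: "y \<in> closure \<Omega>"
  shows "\<exists>R>0. \<exists>\<kappa>>0. \<forall>x\<in>\<Omega> \<inter> ball y R. \<forall>r. 0 < r \<and> r < R \<longrightarrow> corkscrew \<Omega> \<kappa> x r"
proof (cases "y \<in> \<Omega>")
  case True
  have "open \<Omega>" using dom by (simp add: bounded_lipschitz_domain_def)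
  then obtain R where R: "R > 0" "ball y R \<subseteq> \<Omega>"
    using True by (metis open_contains_ball)
  obtain e :: 'a where e: "norm e = 1" using vector_choose_size[of 1] by auto
  have "corkscrew \<Omega> (1/4) x r"
    if "x \<in> \<Omega> \<inter> ball y (R/2)" "0 < r" "r < R/2" for x r
  proof -
    have "ball x r \<subseteq> ball y R" using that by (simp add: ball_subset_ball_iff dist_commute)
    then show ?thesis
      using corkscrew_ball_in_annulus[OF e that(2), of "1/4" x] R(2)
      unfolding corkscrew_def by (intro exI[of _ "x + (r/2) *\<^sub>R e"]) blast
  qed
  then show ?thesis using R(1) by (intro exI[of _ "R/2"] conjI exI[of _ "1/4"]) auto
next
  case False
  have op: "open \<Omega>" using dom by (simp add: bounded_lipschitz_domain_def)
  then have "y \<in> frontier \<Omega>" using False y by (simp add: frontier_def interior_open)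
  then obtain R e g L where R: "R > 0" and e: "norm e = 1"
    and lip: "L-lipschitz_on {z. e \<bullet> z = 0} g"
    and eq: "\<Omega> \<inter> ball y R = {w \<in> ball y R. g (w - (e \<bullet> w) *\<^sub>R e) < e \<bullet> w}"
    using dom unfolding bounded_lipschitz_domain_def by meson
  have L: "L \<ge> 0" using lip by (rule lipschitz_on_nonneg)
  define \<kappa> where "\<kappa> = 1 / (4 * (L + 1))"
  have \<kappa>: "0 < \<kappa>" "\<kappa> \<le> 1/4" "(2 * L + 1) * \<kappa> \<le> 1/2"
    using L by (auto simp: \<kappa>_def field_simps)
  have ee: "e \<bullet> e = 1" using e by (simp add: norm_eq_1)
  have proj: "e \<bullet> (w - (e \<bullet> w) *\<^sub>R e) = 0" for w
    by (simp add: inner_diff_right ee)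
  have "corkscrew \<Omega> \<kappa> x r"
    if x: "x \<in> \<Omega> \<inter> ball y (R/2)" and r: "0 < r" "r < R/2" for x r
  proof -
    define z where "z = x + (r/2) *\<^sub>R e"
    have sub: "ball z (\<kappa> * r) \<subseteq> ball x r - ball x (r/4)"
      unfolding z_def using corkscrew_ball_in_annulus[OF e r(1) \<kappa>(2)] .
    have sub': "ball x r \<subseteq> ball y R" using x r by (simp add: ball_subset_ball_iff dist_commute)
    have xg: "g (x - (e \<bullet> x) *\<^sub>R e) < e \<bullet> x" using eq x sub' r by auto
    have "w \<in> \<Omega>" if w: "w \<in> ball z (\<kappa> * r)" for w
    proof -
      define v where "v = w - z"
      have v: "norm v < \<kappa> * r" using w by (simp add: v_def dist_norm norm_minus_commute)
      have wv: "w = x + (r/2) *\<^sub>R e + v" by (simp add: v_def z_def)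
      have ev: "\<bar>e \<bullet> v\<bar> \<le> norm v" using Cauchy_Schwarz_ineq2[of e v] e by simp
      have diff: "(w - (e \<bullet> w) *\<^sub>R e) - (x - (e \<bullet> x) *\<^sub>R e) = v - (e \<bullet> v) *\<^sub>R e"
        by (simp add: wv inner_add_right ee algebra_simps)
      have "norm (v - (e \<bullet> v) *\<^sub>R e) \<le> norm v + norm ((e \<bullet> v) *\<^sub>R e)" by (rule norm_triangle_ineq4)
      also have "\<dots> \<le> 2 * norm v" using ev e by simp
      finally have "norm (v - (e \<bullet> v) *\<^sub>R e) \<le> 2 * norm v" .
      moreover have "dist (g (w - (e \<bullet> w) *\<^sub>R e)) (g (x - (e \<bullet> x) *\<^sub>R e))
          \<le> L * dist (w - (e \<bullet> w) *\<^sub>R e) (x - (e \<bullet> x) *\<^sub>R e)"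
        by (rule lipschitz_onD[OF lip]) (simp_all add: proj)
      ultimately have "g (w - (e \<bullet> w) *\<^sub>R e) \<le> g (x - (e \<bullet> x) *\<^sub>R e) + L * (2 * norm v)"
        using L mult_left_mono[of "norm (v - (e \<bullet> v) *\<^sub>R e)" "2 * norm v" L]
        by (simp add: dist_norm diff)
      also have "\<dots> < e \<bullet> x + (r/2 - norm v)"
      proof -
        have "(2 * L + 1) * norm v \<le> (2 * L + 1) * (\<kappa> * r)"
          using v L by (intro mult_left_mono) auto
        also have "\<dots> \<le> r/2" using mult_right_mono[OF \<kappa>(3), of r] r(1) by simp
        finally show ?thesis using xg by (simp add: algebra_simps)
      qed
      also have "\<dots> \<le> e \<bullet> w" using ev by (simp add: wv inner_add_right ee)
      finally have "g (w - (e \<bullet> w) *\<^sub>R e) < e \<bullet> w" .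
      moreover have "w \<in> ball y R" using w sub sub' by blast
      ultimately show ?thesis using eq by blast
    qed
    then show ?thesis using sub unfolding corkscrew_def by blast
  qed
  then show ?thesis using R \<kappa>(1) by (intro exI[of _ "R/2"] conjI exI[of _ \<kappa>]) auto
qed

lemma corkscrew_mono:
  assumes "corkscrew \<Omega> \<kappa> x r" "\<kappa>' \<le> \<kappa>" "0 < r"
  shows "corkscrew \<Omega> \<kappa>' x r"
proof -
  obtain z where "ball z (\<kappa> * r) \<subseteq> \<Omega> \<inter> (ball x r - ball x (r/4))"
    using assms(1) by (auto simp: corkscrew_def)
  moreover have "ball z (\<kappa>' * r) \<subseteq> ball z (\<kappa> * r)"
    using assms by (intro subset_ball mult_right_mono) auto
  ultimately show ?thesis unfolding corkscrew_def by blast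
qed

text \<open>
  The constants of the local statement are uniform because finitely many of the neighbourhoods cover the
  compact closure of the domain.
\<close>

lemma lipschitz_domain_corkscrew:
  fixes \<Omega> :: "'a::euclidean_space set"
  assumes dom: "bounded_lipschitz_domain \<Omega>"
  obtains \<kappa> \<rho> where "0 < \<kappa>" "0 < \<rho>" "\<And>x r. x \<in> \<Omega> \<Longrightarrow> 0 < r \<Longrightarrow> r < \<rho> \<Longrightarrow> corkscrew \<Omega> \<kappa> x r"
proof -
  have comp: "compact (closure \<Omega>)" and ne: "\<Omega> \<noteq> {}"
    using dom by (auto simp: bounded_lipschitz_domain_def)
  obtain R \<kappa> where R: "\<And>y. y \<in> closure \<Omega> \<Longrightarrow> R y > 0" and \<kappa>: "\<And>y. y \<in> closure \<Omega> \<Longrightarrow> \<kappa> y > 0"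
    and ck: "\<And>y x r. y \<in> closure \<Omega> \<Longrightarrow> x \<in> \<Omega> \<inter> ball y (R y) \<Longrightarrow> 0 < r \<Longrightarrow> r < R y
        \<Longrightarrow> corkscrew \<Omega> (\<kappa> y) x r"
    using corkscrew_near_point[OF dom] by metis
  have "closure \<Omega> \<subseteq> (\<Union>y\<in>closure \<Omega>. ball y (R y))" using R by auto
  then obtain F where F: "F \<subseteq> closure \<Omega>" "finite F" "closure \<Omega> \<subseteq> (\<Union>y\<in>F. ball y (R y))"
    using compactE_image[OF comp, of "closure \<Omega>" "\<lambda>y. ball y (R y)"] by auto
  have "F \<noteq> {}" using F(3) ne closure_subset by auto
  define \<rho> where "\<rho> = Min (R ` F)"
  define \<kappa>0 where "\<kappa>0 = Min (\<kappa> ` F)"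
  show ?thesis
  proof
    show "0 < \<kappa>0" "0 < \<rho>" using F \<open>F \<noteq> {}\<close> R \<kappa> by (auto simp: \<rho>_def \<kappa>0_def subset_iff)
    fix x r assume x: "x \<in> \<Omega>" and r: "0 < r" "r < \<rho>"
    obtain y where y: "y \<in> F" "x \<in> ball y (R y)" using F(3) x closure_subset by blast
    have "\<rho> \<le> R y" "\<kappa>0 \<le> \<kappa> y" using y F by (auto simp: \<rho>_def \<kappa>0_def)
    then have "r < R y" using r by simp
    then show "corkscrew \<Omega> \<kappa>0 x r"
      using corkscrew_mono[OF ck[of y x r]] x y r F \<open>\<kappa>0 \<le> \<kappa> y\<close> by blast
  qed
qed

text \<open>
  A quantitative form of having positive dimension at each point: small spheres centred on \<open>K\<close> meet \<open>K\<close>.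
\<close>

definition spheres_meet :: "'a::metric_space set \<Rightarrow> real \<Rightarrow> bool" where
  "spheres_meet K \<rho> \<longleftrightarrow> (\<forall>z\<in>K. \<forall>t. 0 < t \<and> t \<le> \<rho> \<longrightarrow> (\<exists>z'\<in>K. dist z z' = t))"

lemma C01_norm_upper:
  assumes f: "C01_on S f" and ab: "a \<in> S" "b \<in> S" "a \<noteq> b"
  shows "norm (f a - f b) \<le> C01_norm S f * norm (a - b)" "0 \<le> C01_norm S f"
proof -
  obtain B where B: "\<And>x. x \<in> S \<Longrightarrow> norm (f x) \<le> B"
    using f by (auto simp: C01_on_def bounded_iff)
  obtain L where L: "L-lipschitz_on S f" using f by (auto simp: C01_on_def)
  let ?P = "{(x, y). x \<in> S \<and> y \<in> S \<and> x \<noteq> y}"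
  have n: "0 \<le> norm (f a)" by simp
  also have "norm (f a) \<le> (SUP x\<in>S. norm (f x))"
    by (rule cSUP_upper) (use ab B in \<open>auto simp: bdd_above_def\<close>)
  finally have 1: "0 \<le> (SUP x\<in>S. norm (f x))" .
  have "bdd_above ((\<lambda>(x, y). norm (f x - f y) / norm (x - y)) ` ?P)"
  proof (rule bdd_aboveI2[where M = L], clarify)
    fix x y assume xy: "x \<in> S" "y \<in> S" "x \<noteq> y"
    then have "norm (f x - f y) \<le> L * norm (x - y)"
      using lipschitz_onD[OF L, of x y] by (simp add: dist_norm)
    then show "norm (f x - f y) / norm (x - y) \<le> L" using xy by (simp add: field_simps)
  qed
  then have 2: "norm (f a - f b) / norm (a - b)
      \<le> (SUP (x, y)\<in>?P. norm (f x - f y) / norm (x - y))"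
    using cSUP_upper[of "(a, b)" ?P "\<lambda>(x, y). norm (f x - f y) / norm (x - y)"] ab by simp
  have "0 \<le> norm (f a - f b) / norm (a - b)" by simp
  then show "0 \<le> C01_norm S f" unfolding C01_norm_def using 1 2 by linarith
  have "norm (f a - f b) / norm (a - b) \<le> C01_norm S f" using 1 2 by (simp add: C01_norm_def)
  then show "norm (f a - f b) \<le> C01_norm S f * norm (a - b)" using ab by (simp add: field_simps)
qed

text \<open>
  As \<open>k < d\<close>, the flat piece of the model cylinder contains a segment through the preimage of \<open>x\<close> in a
  coordinate direction outside \<open>I\<close>.  The chart maps it to a curve in \<open>K\<close> that starts at \<open>x\<close> and whose end
  has distance at least \<open>1 / (4 C)\<close> from \<open>x\<close>, because the inverse chart is \<open>C\<close>-Lipschitz; all smaller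
  distances are attained in between.  That \<open>C\<close> does not depend on \<open>x\<close> makes the radius uniform.
\<close>

lemma C01_surface_spheres_meet:
  fixes \<Omega> K :: "(real^'d::finite) set"
  assumes K: "C01_compact_surface k \<Omega> K" and k: "k < CARD('d)"
  obtains \<rho> where "0 < \<rho>" "spheres_meet K \<rho>"
proof -
  obtain I :: "'d set" and C where I: "card I = k" and C: "C > 0" and chart: "\<forall>x\<in>K. \<exists>r>0. \<exists>T S.
          bij_betw T (model_cylinder I) (ball x r) \<and>
          (\<forall>\<xi>\<in>model_cylinder I. S (T \<xi>) = \<xi>) \<and>
          C01_on (closure (model_cylinder I)) T \<and>
          C01_on (closure (ball x r)) S \<and>
          C01_norm (closure (model_cylinder I)) T + C01_norm (closure (ball x r)) S \<le> C \<and>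
          S ` (ball x r \<inter> K) = {\<xi> \<in> model_cylinder I. \<forall>i\<in>I. \<xi> $ i = 0}"
    using K unfolding C01_compact_surface_def by (elim conjE exE) (rule that, assumption+, meson)
  obtain i where i: "i \<notin> I" using I k by (metis UNIV_I less_irrefl subsetI top.extremum_uniqueI)
  have "\<exists>z'\<in>K. dist x z' = t" if x: "x \<in> K" and t: "0 < t" "t \<le> 1 / (4 * C)" for x t
  proof -
    obtain r T S where r: "r > 0" and bij: "bij_betw T (model_cylinder I) (ball x r)"
      and ST: "\<And>\<xi>. \<xi> \<in> model_cylinder I \<Longrightarrow> S (T \<xi>) = \<xi>"
      and T: "C01_on (closure (model_cylinder I)) T" and S: "C01_on (closure (ball x r)) S"
      and le: "C01_norm (closure (model_cylinder I)) T + C01_norm (closure (ball x r)) S \<le> C"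
      and im: "S ` (ball x r \<inter> K) = {\<xi> \<in> model_cylinder I. \<forall>i\<in>I. \<xi> $ i = 0}"
      using chart x by meson
    have "\<exists>\<xi>\<in>model_cylinder I. T \<xi> = w" if "w \<in> ball x r" for w
      using that bij by (metis bij_betw_imp_surj_on imageE)
    then have TS: "T (S w) = w" and Scyl: "S w \<in> model_cylinder I" if "w \<in> ball x r" for w
      using that ST by metis+
    define \<xi>0 where "\<xi>0 = S x"
    have \<xi>0: "\<xi>0 \<in> model_cylinder I" "\<And>j. j \<in> I \<Longrightarrow> \<xi>0 $ j = 0" "T \<xi>0 = x"
      using im x r TS[of x] by (auto simp: \<xi>0_def)
    \<comment> \<open>the direction in which the segment of length \<open>1/4\<close> does not leave the cylinder\<close>
    define \<sigma> :: real where "\<sigma> = (if \<xi>0 $ i \<le> 1/2 then 1 else -1)"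
    define c where "c = (\<lambda>a. \<xi>0 + (a * \<sigma>) *\<^sub>R axis i (1::real))"
    have c_in: "c a \<in> {\<xi> \<in> model_cylinder I. \<forall>i\<in>I. \<xi> $ i = 0}" if "0 \<le> a" "a \<le> 1/4" for a
    proof -
      have z: "c a $ j = 0" if "j \<in> I" for j
        using \<xi>0(2)[OF that] i that by (auto simp: c_def axis_def)
      have "L2_set (($) (c a)) I = 0" using z by (simp add: L2_set_def)
      moreover have "0 < c a $ j \<and> c a $ j < 1" if "j \<notin> I" for j
      proof -
        have "0 < \<xi>0 $ j" "\<xi>0 $ j < 1" using \<xi>0(1) that by (auto simp: model_cylinder_def)
        then show ?thesis using \<open>0 \<le> a\<close> \<open>a \<le> 1/4\<close>
          by (cases "j = i") (auto simp: c_def axis_def \<sigma>_def)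
      qed
      ultimately show ?thesis using z by (simp add: model_cylinder_def)
    qed
    have Tc: "T (c a) \<in> K" "T (c a) \<in> ball x r" "c a \<in> model_cylinder I"
      if "0 \<le> a" "a \<le> 1/4" for a
    proof -
      have "c a \<in> S ` (ball x r \<inter> K)" using c_in[OF that] im by simp
      then obtain w where "w \<in> ball x r \<inter> K" "c a = S w" by blast
      then show "T (c a) \<in> K" "T (c a) \<in> ball x r" "c a \<in> model_cylinder I" using TS Scyl by auto
    qed
    have nc: "norm (c (1/4) - \<xi>0) = 1/4" by (simp add: c_def \<sigma>_def norm_axis_1)
    then have ne: "c (1/4) \<noteq> \<xi>0" by auto
    have ne': "T (c (1/4)) \<noteq> x" using ST[OF Tc(3), of "1/4"] ne by (auto simp: \<xi>0_def)
    have "C01_norm (closure (ball x r)) S \<le> C"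
      using C01_norm_upper(2)[OF T, of "c (1/4)" \<xi>0] le Tc(3)[of "1/4"] \<xi>0(1) ne closure_subset
      by fastforce
    moreover have "norm (S (T (c (1/4))) - S x) \<le> C01_norm (closure (ball x r)) S * norm (T (c (1/4)) - x)"
      using Tc(2)[of "1/4"] ne' r by (intro C01_norm_upper(1)[OF S] subsetD[OF closure_subset]) auto
    ultimately have "norm (S (T (c (1/4))) - S x) \<le> C * norm (T (c (1/4)) - x)"
      by (meson mult_right_mono norm_ge_zero order_trans)
    then have "1/4 \<le> C * dist x (T (c (1/4)))"
      using nc ST[OF Tc(3), of "1/4"] by (simp add: \<xi>0_def dist_norm norm_minus_commute)
    then have "1 / (4 * C) \<le> dist x (T (c (1/4)))" using C by (simp add: field_simps)
    then have far: "t \<le> dist x (T (c (1/4)))" using t by simp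
    obtain L where "L-lipschitz_on (closure (model_cylinder I)) T" using T by (auto simp: C01_on_def)
    then have "continuous_on (closure (model_cylinder I)) T" by (rule lipschitz_on_continuous_on)
    then have contT: "continuous_on (c ` {0..1/4}) T"
      by (rule continuous_on_subset) (use Tc(3) closure_subset in fastforce)
    have "continuous_on {0..1/4} (\<lambda>a. dist x (T (c a)))"
      by (intro continuous_on_dist continuous_on_const continuous_on_compose2[OF contT])
        (auto simp: c_def intro!: continuous_intros)
    moreover have "dist x (T (c 0)) \<le> t" using \<xi>0(3) t by (simp add: c_def)
    ultimately obtain a where "0 \<le> a" "a \<le> 1/4" "dist x (T (c a)) = t"
      using IVT'[of "\<lambda>a. dist x (T (c a))" 0 t "1/4"] far by auto
    then show ?thesis using Tc(1) by blast
  qed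
  then show ?thesis using C by (intro that[of "1 / (4 * C)"]) (auto simp: spheres_meet_def)
qed

section \<open>The energy and elementary estimates\<close>

text \<open>
  For \<open>s p = d\<close> the exponent \<open>d + s p\<close> of the Gagliardo kernel is \<open>2 d\<close>.
\<close>

definition gagliardo :: "real \<Rightarrow> ('a::euclidean_space \<Rightarrow> real) \<Rightarrow> 'a \<Rightarrow> 'a \<Rightarrow> real" where
  "gagliardo p u x y = \<bar>u x - u y\<bar> powr p / dist x y ^ (2 * DIM('a))"

definition energy_density :: "'a::euclidean_space set \<Rightarrow> real \<Rightarrow> ('a \<Rightarrow> real) \<Rightarrow> 'a \<Rightarrow> ennreal" where
  "energy_density \<Omega> p u x = (\<integral>\<^sup>+y\<in>\<Omega>. ennreal (gagliardo p u x y) \<partial>lborel)"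

definition energy :: "'a::euclidean_space set \<Rightarrow> real \<Rightarrow> ('a \<Rightarrow> real) \<Rightarrow> ennreal" where
  "energy \<Omega> p u = (\<integral>\<^sup>+x\<in>\<Omega>. energy_density \<Omega> p u x \<partial>lborel)"

text \<open>
  On \<open>K\<close> the integrand is \<open>0\<close>, as division by zero gives zero.
\<close>

definition hardy_integral :: "'a::euclidean_space set \<Rightarrow> real \<Rightarrow> 'a set \<Rightarrow> ('a \<Rightarrow> real) \<Rightarrow> ennreal" where
  "hardy_integral K p A u = (\<integral>\<^sup>+x\<in>A. ennreal (\<bar>u x\<bar> powr p / infdist x K ^ DIM('a)) \<partial>lborel)"

lemma borel_measurable_infdist [measurable]:
  "(\<lambda>x. infdist x (K :: 'a::metric_space set)) \<in> borel_measurable borel"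
  by (intro borel_measurable_continuous_onI continuous_intros)

lemma borel_measurable_gagliardo [measurable]:
  fixes u :: "'a::euclidean_space \<Rightarrow> real"
  assumes [measurable]: "u \<in> borel_measurable borel"
  shows "(\<lambda>(x, y). gagliardo p u x y) \<in> borel_measurable (borel \<Otimes>\<^sub>M borel)"
  unfolding gagliardo_def by measurable

lemma borel_measurable_energy_density [measurable]:
  fixes u :: "'a::euclidean_space \<Rightarrow> real"
  assumes [measurable]: "u \<in> borel_measurable borel" "\<Omega> \<in> sets borel"
  shows "energy_density \<Omega> p u \<in> borel_measurable borel"
  unfolding energy_density_def by measurable

lemma gagliardo_nonneg: "0 \<le> gagliardo p u x y"
  by (simp add: gagliardo_def)

lemma abs_powr_triangle:
  fixes a b :: real
  assumes "p \<ge> 0"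
  shows "\<bar>a\<bar> powr p \<le> 2 powr p * \<bar>a - b\<bar> powr p + 2 powr p * \<bar>b\<bar> powr p"
proof -
  let ?m = "max \<bar>a - b\<bar> \<bar>b\<bar>"
  have "\<bar>a\<bar> \<le> 2 * ?m" by (cases "\<bar>a - b\<bar> \<le> \<bar>b\<bar>") (simp_all add: max_def abs_real_def split: if_splits)
  then have "\<bar>a\<bar> powr p \<le> (2 * ?m) powr p" using assms by (intro powr_mono2) auto
  also have "\<dots> = 2 powr p * ?m powr p" by (simp add: powr_mult)
  also have "\<dots> \<le> 2 powr p * (\<bar>a - b\<bar> powr p + \<bar>b\<bar> powr p)"
    by (intro mult_left_mono) (auto simp: max_def)
  finally show ?thesis by (simp add: algebra_simps)
qed

text \<open>
  This is \<open>abs_powr_triangle\<close> integrated over \<open>S\<close>: a value \<open>a\<close> is compared with the values of \<open>u\<close> on \<open>S\<close>.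
\<close>

lemma emeasure_le_average:
  fixes u :: "'a::euclidean_space \<Rightarrow> real"
  assumes [measurable]: "u \<in> borel_measurable borel" "S \<in> sets borel" and "p \<ge> 0"
  shows "ennreal (\<bar>a\<bar> powr p) * emeasure lborel S
    \<le> ennreal (2 powr p) * (\<integral>\<^sup>+y\<in>S. ennreal (\<bar>a - u y\<bar> powr p) \<partial>lborel)
      + ennreal (2 powr p) * (\<integral>\<^sup>+y\<in>S. ennreal (\<bar>u y\<bar> powr p) \<partial>lborel)"
proof -
  have "ennreal (\<bar>a\<bar> powr p) * emeasure lborel S = (\<integral>\<^sup>+y\<in>S. ennreal (\<bar>a\<bar> powr p) \<partial>lborel)"
    by (simp add: nn_integral_cmult_indicator)
  also have "\<dots> \<le> (\<integral>\<^sup>+y\<in>S. ennreal (2 powr p) * ennreal (\<bar>a - u y\<bar> powr p)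
      + ennreal (2 powr p) * ennreal (\<bar>u y\<bar> powr p) \<partial>lborel)"
    by (intro nn_integral_mono mult_right_mono)
      (auto simp flip: ennreal_mult ennreal_plus intro!: ennreal_leI abs_powr_triangle assms)
  also have "\<dots> = ennreal (2 powr p) * (\<integral>\<^sup>+y\<in>S. ennreal (\<bar>a - u y\<bar> powr p) \<partial>lborel)
      + ennreal (2 powr p) * (\<integral>\<^sup>+y\<in>S. ennreal (\<bar>u y\<bar> powr p) \<partial>lborel)"
    by (simp add: distrib_right nn_integral_add nn_integral_cmult mult.assoc)
  finally show ?thesis .
qed

lemma difference_le_energy_density:
  fixes u :: "'a::euclidean_space \<Rightarrow> real"
  assumes [measurable]: "u \<in> borel_measurable borel" "\<Omega> \<in> sets borel"
    and "S \<subseteq> \<Omega>" and dist: "\<And>y. y \<in> S \<Longrightarrow> dist x y \<le> t"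
  shows "(\<integral>\<^sup>+y\<in>S. ennreal (\<bar>u x - u y\<bar> powr p) \<partial>lborel)
    \<le> ennreal (t ^ (2 * DIM('a))) * energy_density \<Omega> p u x"
proof -
  have "\<bar>u x - u y\<bar> powr p \<le> t ^ (2 * DIM('a)) * gagliardo p u x y" if "y \<in> S" for y
  proof (cases "x = y")
    case False
    then have "\<bar>u x - u y\<bar> powr p = dist x y ^ (2 * DIM('a)) * gagliardo p u x y"
      by (simp add: gagliardo_def)
    also have "\<dots> \<le> t ^ (2 * DIM('a)) * gagliardo p u x y"
      by (intro mult_right_mono power_mono dist that gagliardo_nonneg) auto
    finally show ?thesis .
  qed (simp add: gagliardo_def)
  then have "(\<integral>\<^sup>+y\<in>S. ennreal (\<bar>u x - u y\<bar> powr p) \<partial>lborel)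
      \<le> (\<integral>\<^sup>+y. ennreal (t ^ (2 * DIM('a))) * (ennreal (gagliardo p u x y) * indicator \<Omega> y) \<partial>lborel)"
    using \<open>S \<subseteq> \<Omega>\<close>
    by (intro nn_integral_mono)
      (auto simp: indicator_def gagliardo_nonneg simp flip: ennreal_mult'' intro!: ennreal_leI)
  also have "\<dots> = ennreal (t ^ (2 * DIM('a))) * energy_density \<Omega> p u x"
    unfolding energy_density_def by (subst nn_integral_cmult) measurable
  finally show ?thesis .
qed

section \<open>Hardy's inequality\<close>

text \<open>
  The collar is the part of a ball of radius \<open>3 t\<close> around \<open>x\<close> that is \<open>N\<close> times closer to \<open>K\<close> than \<open>x\<close>.
  Let \<open>z\<close> be a point of \<open>K\<close> nearest to \<open>x\<close>, and choose points of \<open>K\<close> at the distances \<open>j t / N\<close> from \<open>z\<close>,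
  \<open>j = 1, \<dots>, N\<close>.  They are pairwise \<open>t / N\<close> apart, so the balls of radius \<open>t / (2 N)\<close> around them are
  disjoint; they all lie in the collar.  The resulting bound of order \<open>N\<^sup>1\<^sup>-\<^sup>d t\<^sup>d\<close> beats that of a single
  ball by the factor \<open>N\<close>, and this factor is what makes Hardy's inequality work.
\<close>

lemma emeasure_collar_ge:
  fixes K :: "'a::euclidean_space set"
  assumes K: "compact K" "K \<noteq> {}" "spheres_meet K \<rho>" and N: "N \<ge> 1"
    and t: "t = infdist x K" "0 < t" "t \<le> \<rho>"
  shows "ennreal (real N * (unit_ball_vol DIM('a) * (t / (2 * real N)) ^ DIM('a)))
    \<le> emeasure lborel {y. dist x y < 3 * t \<and> real N * infdist y K < t}"
proof -
  obtain z where z: "z \<in> K" "dist x z = t"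
    using infdist_attains_inf[of K x] K t compact_imp_closed by metis
  have "\<exists>z'\<in>K. dist z z' = real j * t / real N" if "j \<in> {1..N}" for j
  proof -
    have "real j * t \<le> real N * t" using that t by (intro mult_right_mono) auto
    then have "real j * t / real N \<le> t" using N by (simp add: field_simps)
    moreover have "0 < real j * t / real N" using that t N by simp
    ultimately show ?thesis using K(3) z(1) t(3) unfolding spheres_meet_def by (meson order_trans)
  qed
  then obtain w where w: "\<And>j. j \<in> {1..N} \<Longrightarrow> w j \<in> K"
      "\<And>j. j \<in> {1..N} \<Longrightarrow> dist z (w j) = real j * t / real N"
    by metis
  define B where "B = (\<lambda>j. ball (w j) (t / (2 * real N)))"
  have far: "t / real N \<le> dist (w i) (w j)" if "i \<in> {1..N}" "j \<in> {1..N}" "i < j" for i j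
  proof -
    have "real j * t / real N \<le> real i * t / real N + dist (w i) (w j)"
      using dist_triangle[of z "w j" "w i"] w(2) that by simp
    moreover have "(real i + 1) * t / real N \<le> real j * t / real N"
      using that t by (intro divide_right_mono mult_right_mono) auto
    ultimately show ?thesis by (simp add: add_divide_distrib distrib_right)
  qed
  have disj: "disjoint_family_on B {1..N}"
  proof (unfold disjoint_family_on_def, intro ballI impI)
    fix i j assume ij: "i \<in> {1..N}" "j \<in> {1..N}" "i \<noteq> j"
    then have "t / real N \<le> dist (w i) (w j)"
      using far[of i j] far[of j i] by (cases "i < j") (auto simp: dist_commute)
    moreover have False if "y \<in> B i" "y \<in> B j" "t / real N \<le> dist (w i) (w j)" for y
    proof -
      have "dist (w i) (w j) < t / (2 * real N) + t / (2 * real N)"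
        using that(1,2) dist_triangle[of "w i" "w j" y] by (simp add: B_def dist_commute)
      then show False using that(3) by simp
    qed
    ultimately show "B i \<inter> B j = {}" by blast
  qed
  have tN: "t / (2 * real N) \<le> t / 2" "0 < t / (2 * real N)" using N t by (auto simp: field_simps)
  have sub: "(\<Union>j\<in>{1..N}. B j) \<subseteq> {y. dist x y < 3 * t \<and> real N * infdist y K < t}"
  proof safe
    fix j y assume j: "j \<in> {1..N}" and y: "y \<in> B j"
    have dw: "dist (w j) y < t / (2 * real N)" using y by (simp add: B_def)
    have "real j * t / real N \<le> t" using j t N by (simp add: field_simps)
    then show "dist x y < 3 * t"
      using dist_triangle[of x y z] dist_triangle[of z y "w j"] z w(2)[OF j] dw tN t by linarith
    have "infdist y K \<le> dist y (w j)" by (rule infdist_le[OF w(1)[OF j]])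
    then have "real N * infdist y K \<le> real N * (t / (2 * real N))"
      using dw by (intro mult_left_mono) (auto simp: dist_commute)
    also have "\<dots> < t" using N t by simp
    finally show "real N * infdist y K < t" .
  qed
  have "ennreal (real N * (unit_ball_vol DIM('a) * (t / (2 * real N)) ^ DIM('a)))
      = (\<Sum>j\<in>{1..N}. emeasure lborel (B j))"
    using tN unfolding B_def
    by (simp add: emeasure_ball ennreal_of_nat_eq_real_of_nat flip: ennreal_mult)
  also have "\<dots> = emeasure lborel (\<Union>j\<in>{1..N}. B j)"
    by (rule sum_emeasure) (use disj in \<open>auto simp: B_def\<close>)
  also have "\<dots> \<le> emeasure lborel {y. dist x y < 3 * t \<and> real N * infdist y K < t}"
    by (rule emeasure_mono[OF sub]) measurable
  finally show ?thesis .
qed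

lemma ex_dyadic_scale:
  fixes w :: real
  assumes "1 \<le> w"
  shows "\<exists>i. 2 ^ i \<le> w \<and> w < 2 * 2 ^ i"
proof -
  have ex: "\<exists>n. w < 2 ^ n" using real_arch_pow[of 2 w] by simp
  define n where "n = (LEAST n. w < 2 ^ n)"
  have n: "w < 2 ^ n" unfolding n_def using LeastI_ex[OF ex] .
  then obtain i where i: "n = Suc i" using assms by (cases n) auto
  have "\<not> w < 2 ^ i" using not_less_Least[of i "\<lambda>n. w < 2 ^ n"] i n_def by simp
  then show ?thesis using n i by (intro exI[of _ i]) auto
qed

text \<open>
  The domain of integration is covered by the shells \<open>2\<^sup>i a \<le> v x < 2\<^sup>i\<^sup>+\<^sup>1 a\<close>, each contained in a ball of
  radius \<open>6 \<cdot> 2\<^sup>i a\<close>; their contributions form a convergent geometric series.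
\<close>

lemma reciprocal_square_tail:
  fixes v :: "'a::euclidean_space \<Rightarrow> real"
  assumes [measurable]: "v \<in> borel_measurable borel" and a: "0 < a"
  shows "(\<integral>\<^sup>+x\<in>{x. a < v x \<and> dist x y < 3 * v x}. ennreal (1 / v x ^ (2 * DIM('a))) \<partial>lborel)
    \<le> ennreal (2 * unit_ball_vol DIM('a) * 6 ^ DIM('a) / a ^ DIM('a))"
proof -
  let ?d = "DIM('a)"
  let ?\<omega> = "unit_ball_vol (real DIM('a))"
  define f where "f = (\<lambda>i x. ennreal (1 / (2 ^ i * a) ^ (2 * ?d)) * indicator (ball y (6 * (2 ^ i * a))) x)"
  have [measurable]: "f i \<in> borel_measurable lborel" for i
    unfolding f_def by (intro borel_measurable_times_ennreal borel_measurable_indicator) auto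
  have pw: "ennreal (1 / v x ^ (2 * ?d)) * indicator {x. a < v x \<and> dist x y < 3 * v x} x \<le> (\<Sum>i. f i x)" for x
  proof (cases "a < v x \<and> dist x y < 3 * v x")
    case True
    then obtain i where i: "2 ^ i \<le> v x / a" "v x / a < 2 * 2 ^ i"
      using ex_dyadic_scale[of "v x / a"] a by auto
    then have i': "2 ^ i * a \<le> v x" "v x < 2 * (2 ^ i * a)" using a by (auto simp: field_simps)
    have "1 / v x ^ (2 * ?d) \<le> 1 / (2 ^ i * a) ^ (2 * ?d)"
      using i' a by (intro divide_left_mono power_mono mult_pos_pos zero_less_power) auto
    moreover have "x \<in> ball y (6 * (2 ^ i * a))" using True i' by (simp add: dist_commute)
    ultimately have "ennreal (1 / v x ^ (2 * ?d)) * indicator {x. a < v x \<and> dist x y < 3 * v x} x \<le> f i x"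
      using True by (simp add: f_def ennreal_leI)
    also have "\<dots> \<le> (\<Sum>i. f i x)" using sum_le_suminf[of "\<lambda>i. f i x" "{i}"] by (simp add: summableI)
    finally show ?thesis .
  qed simp
  have summand: "(\<integral>\<^sup>+x. f i x \<partial>lborel) \<le> ennreal (?\<omega> * 6 ^ ?d / a ^ ?d * (1/2) ^ i)" for i
  proof -
    have "(\<integral>\<^sup>+x. f i x \<partial>lborel) = ennreal (1 / (2 ^ i * a) ^ (2 * ?d)) * emeasure lborel (ball y (6 * (2 ^ i * a)))"
      unfolding f_def by (simp add: nn_integral_cmult_indicator)
    also have "\<dots> = ennreal (1 / (2 ^ i * a) ^ (2 * ?d) * (?\<omega> * (6 * (2 ^ i * a)) ^ ?d))"
      using a by (simp add: emeasure_ball flip: ennreal_mult)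
    also have "1 / (2 ^ i * a) ^ (2 * ?d) * (?\<omega> * (6 * (2 ^ i * a)) ^ ?d) = ?\<omega> * 6 ^ ?d / a ^ ?d * (1 / (2 ^ i) ^ ?d)"
      unfolding mult_2[of "DIM('a)"] power_add using a by (simp add: power_mult_distrib field_simps)
    also have "\<dots> \<le> ?\<omega> * 6 ^ ?d / a ^ ?d * (1/2) ^ i"
    proof (rule mult_left_mono)
      have "(2::real) ^ i \<le> (2 ^ i) ^ ?d" using self_le_power[of "(2::real) ^ i" ?d] by simp
      then show "1 / (2 ^ i) ^ ?d \<le> (1/2::real) ^ i" by (simp add: power_one_over field_simps)
    qed (use a in simp)
    finally show ?thesis by (simp add: ennreal_leI)
  qed
  have "(\<integral>\<^sup>+x\<in>{x. a < v x \<and> dist x y < 3 * v x}. ennreal (1 / v x ^ (2 * ?d)) \<partial>lborel) \<le> (\<integral>\<^sup>+x. (\<Sum>i. f i x) \<partial>lborel)"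
    by (intro nn_integral_mono pw)
  also have "\<dots> = (\<Sum>i. \<integral>\<^sup>+x. f i x \<partial>lborel)" by (rule nn_integral_suminf) measurable
  also have "\<dots> \<le> (\<Sum>i. ennreal (?\<omega> * 6 ^ ?d / a ^ ?d * (1/2) ^ i))"
    by (intro suminf_le summand summableI)
  also have "\<dots> = ennreal (\<Sum>i. ?\<omega> * 6 ^ ?d / a ^ ?d * (1/2) ^ i)"
    using a by (intro suminf_ennreal2 summable_mult summable_geometric) auto
  also have "(\<Sum>i. ?\<omega> * 6 ^ ?d / a ^ ?d * (1/2) ^ i) = 2 * ?\<omega> * 6 ^ ?d / a ^ ?d"
    by (subst suminf_mult) (auto simp: suminf_geometric)
  finally show ?thesis .
qed

text \<open>
  Tonelli's theorem, in the form in which an average over points \<open>y\<close> near \<open>x\<close> is turned into a weight at \<open>y\<close>.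
\<close>

lemma swap_set_nn_integral:
  fixes f :: "'a::euclidean_space \<Rightarrow> ennreal" and g :: "'a \<Rightarrow> ennreal"
  assumes [measurable]: "f \<in> borel_measurable borel" "g \<in> borel_measurable borel"
    "Measurable.pred (borel \<Otimes>\<^sub>M borel) (\<lambda>(x, y). R x y)"
  shows "(\<integral>\<^sup>+x. f x * (\<integral>\<^sup>+y\<in>{y. R x y}. g y \<partial>lborel) \<partial>lborel)
    = (\<integral>\<^sup>+y. g y * (\<integral>\<^sup>+x\<in>{x. R x y}. f x \<partial>lborel) \<partial>lborel)"
proof -
  let ?h = "\<lambda>x y. f x * g y * indicator {z. R (fst z) (snd z)} (x, y)"
  have 1: "f x * (\<integral>\<^sup>+y\<in>{y. R x y}. g y \<partial>lborel) = (\<integral>\<^sup>+y. ?h x y \<partial>lborel)" for x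
  proof -
    have "f x * (\<integral>\<^sup>+y\<in>{y. R x y}. g y \<partial>lborel) = (\<integral>\<^sup>+y. f x * (g y * indicator {y. R x y} y) \<partial>lborel)"
      by (rule nn_integral_cmult[symmetric]) measurable
    then show ?thesis by (simp add: indicator_def mult.assoc)
  qed
  have 2: "g y * (\<integral>\<^sup>+x\<in>{x. R x y}. f x \<partial>lborel) = (\<integral>\<^sup>+x. ?h x y \<partial>lborel)" for y
  proof -
    have "g y * (\<integral>\<^sup>+x\<in>{x. R x y}. f x \<partial>lborel) = (\<integral>\<^sup>+x. g y * (f x * indicator {x. R x y} x) \<partial>lborel)"
      by (rule nn_integral_cmult[symmetric]) measurable
    then show ?thesis by (simp add: indicator_def mult_ac)
  qed
  have "(\<integral>\<^sup>+x. (\<integral>\<^sup>+y. ?h x y \<partial>lborel) \<partial>lborel) = (\<integral>\<^sup>+y. (\<integral>\<^sup>+x. ?h x y \<partial>lborel) \<partial>lborel)"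
    by (rule lborel_pair.Fubini'[symmetric]) measurable
  then show ?thesis by (simp only: 1 2)
qed

lemma ennreal_mult_assoc: "0 \<le> a \<Longrightarrow> 0 \<le> b \<Longrightarrow> ennreal a * (ennreal b * X) = ennreal (a * b) * X"
  by (simp add: ennreal_mult mult.assoc)

lemma ennreal_absorb_half:
  assumes "H < top" "0 \<le> c" "ennreal (2 * c) * H \<le> A + ennreal c * H"
  shows "ennreal c * H \<le> A"
proof -
  have "ennreal c * H < top" using assms(1) by (simp add: ennreal_mult_less_top)
  have two: "ennreal (2 * c) = ennreal c + ennreal c" using assms(2) by (simp flip: ennreal_plus)
  have "ennreal c * H + ennreal c * H \<le> ennreal c * H + A"
    using assms(3) unfolding two distrib_right by (subst (2) add.commute)
  then show ?thesis using \<open>ennreal c * H < top\<close> by (auto simp: ennreal_add_left_cancel_le)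
qed

text \<open>
  The value of \<open>u\<close> at \<open>x\<close> is compared with its values on the collar.  There \<open>dist x y < 3 t\<close>, so the
  differences cost at most \<open>(3 t)\<^sup>2\<^sup>d\<close> times the energy density; dividing by \<open>t\<^sup>2\<^sup>d\<close> makes this scale invariant.
\<close>

lemma hardy_near_pointwise:
  fixes K \<Omega> :: "'a::euclidean_space set"
  assumes K: "compact K" "K \<noteq> {}" "spheres_meet K \<rho>" and N: "N \<ge> 1" and p: "p \<ge> 0"
    and R: "R \<le> \<rho>" "\<And>x. infdist x K < R \<Longrightarrow> x \<in> \<Omega>"
    and [measurable]: "\<Omega> \<in> sets borel" "u \<in> borel_measurable borel"
    and x: "0 < infdist x K" "infdist x K < R"
  shows "ennreal (real N * unit_ball_vol DIM('a) / (2 * real N) ^ DIM('a)) *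
        ennreal (\<bar>u x\<bar> powr p / infdist x K ^ DIM('a))
      \<le> ennreal (2 powr p * 9 ^ DIM('a)) * energy_density \<Omega> p u x
        + ennreal (2 powr p) * (ennreal (1 / infdist x K ^ (2 * DIM('a))) *
          (\<integral>\<^sup>+y\<in>{y. dist x y < 3 * infdist x K \<and> real N * infdist y K < infdist x K}.
             ennreal (\<bar>u y\<bar> powr p) \<partial>lborel))"
proof -
  define t where "t = infdist x K"
  let ?d = "DIM('a)"
  define E where "E = {y. dist x y < 3 * t \<and> real N * infdist y K < t}"
  have [measurable]: "E \<in> sets borel" unfolding E_def by measurable
  have t: "0 < t" "t < R" using x by (auto simp: t_def)
  have E_sub: "E \<subseteq> \<Omega>"
  proof
    fix y assume "y \<in> E"
    then have "real N * infdist y K < t" by (simp add: E_def)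
    moreover have "infdist y K \<le> real N * infdist y K" using N mult_right_mono[of 1 "real N" "infdist y K"] by (simp add: infdist_nonneg)
    ultimately show "y \<in> \<Omega>" using t R(2) by force
  qed
  have "ennreal (\<bar>u x\<bar> powr p) * ennreal (real N * (unit_ball_vol ?d * (t / (2 * real N)) ^ ?d))
      \<le> ennreal (\<bar>u x\<bar> powr p) * emeasure lborel E"
    unfolding E_def using emeasure_collar_ge[OF K N t_def] t R(1) by (intro mult_left_mono) auto
  also have "\<dots> \<le> ennreal (2 powr p) * (\<integral>\<^sup>+y\<in>E. ennreal (\<bar>u x - u y\<bar> powr p) \<partial>lborel)
      + ennreal (2 powr p) * (\<integral>\<^sup>+y\<in>E. ennreal (\<bar>u y\<bar> powr p) \<partial>lborel)"
    by (intro emeasure_le_average p) measurable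
  also have "\<dots> \<le> ennreal (2 powr p) * (ennreal ((3 * t) ^ (2 * ?d)) * energy_density \<Omega> p u x)
      + ennreal (2 powr p) * (\<integral>\<^sup>+y\<in>E. ennreal (\<bar>u y\<bar> powr p) \<partial>lborel)"
    using E_sub by (intro add_mono mult_left_mono difference_le_energy_density) (auto simp: E_def)
  finally have main: "ennreal (1 / t ^ (2 * ?d)) * (ennreal (\<bar>u x\<bar> powr p) *
        ennreal (real N * (unit_ball_vol ?d * (t / (2 * real N)) ^ ?d)))
      \<le> ennreal (1 / t ^ (2 * ?d)) * (ennreal (2 powr p) * (ennreal ((3 * t) ^ (2 * ?d)) * energy_density \<Omega> p u x)
      + ennreal (2 powr p) * (\<integral>\<^sup>+y\<in>E. ennreal (\<bar>u y\<bar> powr p) \<partial>lborel))"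
    by (rule mult_left_mono) simp
  have "ennreal (1 / t ^ (2 * ?d)) * (ennreal (\<bar>u x\<bar> powr p) *
        ennreal (real N * (unit_ball_vol ?d * (t / (2 * real N)) ^ ?d)))
      = ennreal (1 / t ^ (2 * ?d) * (\<bar>u x\<bar> powr p * (real N * (unit_ball_vol ?d * (t / (2 * real N)) ^ ?d))))"
    using t by (simp flip: ennreal_mult)
  also have "1 / t ^ (2 * ?d) * (\<bar>u x\<bar> powr p * (real N * (unit_ball_vol ?d * (t / (2 * real N)) ^ ?d)))
      = real N * unit_ball_vol ?d / (2 * real N) ^ ?d * (\<bar>u x\<bar> powr p / t ^ ?d)"
    unfolding mult_2[of "DIM('a)"] power_add using t N by (simp add: power_divide field_simps)
  finally have 1: "ennreal (1 / t ^ (2 * ?d)) * (ennreal (\<bar>u x\<bar> powr p) *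
        ennreal (real N * (unit_ball_vol ?d * (t / (2 * real N)) ^ ?d)))
      = ennreal (real N * unit_ball_vol ?d / (2 * real N) ^ ?d) * ennreal (\<bar>u x\<bar> powr p / t ^ ?d)"
    using t by (subst ennreal_mult[symmetric]) auto
  have "1 / t ^ (2 * ?d) * (2 powr p * (3 * t) ^ (2 * ?d)) = 2 powr p * 3 ^ (2 * ?d)"
    using t by (simp add: power_mult_distrib)
  also have "(3::real) ^ (2 * ?d) = 9 ^ ?d" by (simp add: power_mult)
  finally have 2: "ennreal (1 / t ^ (2 * ?d)) * (ennreal (2 powr p) * (ennreal ((3 * t) ^ (2 * ?d)) * X))
      = ennreal (2 powr p * 9 ^ ?d) * X" for X
    using t by (simp only: ennreal_mult_assoc zero_le_divide_1_iff zero_le_power powr_ge_zero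
        mult_nonneg_nonneg less_imp_le zero_le_numeral)
  show ?thesis using main
    unfolding 1 distrib_left 2 t_def[symmetric] E_def[symmetric]
    unfolding mult.left_commute[of "ennreal (1 / t ^ (2 * DIM('a)))" "ennreal (2 powr p)"] .
qed

text \<open>
  When the pointwise estimate is integrated over \<open>x\<close>, its last term becomes, after a change of the order of
  integration, at most a constant times \<open>N\<^sup>-\<^sup>d\<close> times the Hardy integral itself, since \<open>y\<close> is only reached from
  points \<open>x\<close> with \<open>N \<delta>(y) < \<delta>(x)\<close>.  The left-hand side carries the factor \<open>N\<^sup>1\<^sup>-\<^sup>d\<close>, which is larger by \<open>N\<close>.
  For large \<open>N\<close> the last term is therefore absorbed, which is legitimate because the Hardy integral is finite.
\<close>

lemma hardy_near:
  fixes K \<Omega> :: "'a::euclidean_space set"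
  assumes K: "compact K" "K \<noteq> {}" "spheres_meet K \<rho>" and p: "p \<ge> 0"
    and R: "R \<le> \<rho>" "\<And>x. infdist x K < R \<Longrightarrow> x \<in> \<Omega>"
    and [measurable]: "\<Omega> \<in> sets borel"
  obtains C where "C > 0" "\<And>u. u \<in> borel_measurable borel \<Longrightarrow> (\<And>x. x \<in> K \<Longrightarrow> u x = 0) \<Longrightarrow>
    hardy_integral K p {x. infdist x K < R} u < top \<Longrightarrow>
    hardy_integral K p {x. infdist x K < R} u \<le> ennreal C * energy \<Omega> p u"
proof -
  let ?d = "DIM('a)"
  let ?\<omega> = "unit_ball_vol (real DIM('a))"
  have \<omega>: "?\<omega> > 0" by simp
  define T where "T = 2 * ?\<omega> * 6 ^ ?d"
  have T: "T > 0" using \<omega> by (simp add: T_def)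
  \<comment> \<open>\<open>T\<close> is the constant of \<open>reciprocal_square_tail\<close>; \<open>N\<close> is so large that the term to be absorbed is at most half the left-hand side\<close>
  obtain N0 where N0: "2 * (2 powr p * T) * 2 ^ ?d / ?\<omega> < real N0" using reals_Archimedean2 by blast
  define N where "N = max 1 N0"
  have N: "N \<ge> 1" "2 * (2 powr p * T) * 2 ^ ?d / ?\<omega> \<le> real N" using N0 by (auto simp: N_def)
  define c where "c = real N * ?\<omega> / (2 * real N) ^ ?d / 2"
  have c: "c > 0" using N \<omega> by (simp add: c_def)
  have cN: "2 powr p * (T / real N ^ ?d) \<le> c"
    using N \<omega> by (simp add: c_def power_mult_distrib field_simps)
  define C where "C = 2 powr p * 9 ^ ?d / c"
  have C: "C > 0" using c by (simp add: C_def)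
  show ?thesis
  proof (rule that[OF C])
    fix u :: "'a \<Rightarrow> real"
    assume [measurable]: "u \<in> borel_measurable borel" and u0: "\<And>x. x \<in> K \<Longrightarrow> u x = 0"
      and fin: "hardy_integral K p {x. infdist x K < R} u < top"
    let ?H = "hardy_integral K p {x. infdist x K < R} u"
    define f where "f = (\<lambda>x. ennreal (1 / infdist x K ^ (2 * ?d)) * indicator {x. 0 < infdist x K \<and> infdist x K < R} x)"
    have [measurable]: "f \<in> borel_measurable borel" unfolding f_def by measurable
    let ?rel = "\<lambda>x y. dist x y < 3 * infdist x K \<and> real N * infdist y K < infdist x K"
    define J where "J = (\<lambda>x. f x * (\<integral>\<^sup>+y\<in>{y. ?rel x y}. ennreal (\<bar>u y\<bar> powr p) \<partial>lborel))"
    have [measurable]: "J \<in> borel_measurable borel" unfolding J_def by measurable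
    have "ennreal (2 * c) * ?H
        = (\<integral>\<^sup>+x\<in>{x. infdist x K < R}. ennreal (2 * c) * ennreal (\<bar>u x\<bar> powr p / infdist x K ^ ?d) \<partial>lborel)"
      unfolding hardy_integral_def by (subst nn_integral_cmult[symmetric]) (auto simp: mult.assoc)
    also have "\<dots> \<le> (\<integral>\<^sup>+x. ennreal (2 powr p * 9 ^ ?d) * (energy_density \<Omega> p u x * indicator \<Omega> x)
        + ennreal (2 powr p) * J x \<partial>lborel)"
    proof (intro nn_integral_mono)
      fix x :: 'a
      show "ennreal (2 * c) * ennreal (\<bar>u x\<bar> powr p / infdist x K ^ ?d) * indicator {x. infdist x K < R} x
        \<le> ennreal (2 powr p * 9 ^ ?d) * (energy_density \<Omega> p u x * indicator \<Omega> x) + ennreal (2 powr p) * J x"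
      proof (cases "0 < infdist x K \<and> infdist x K < R")
        case True
        have "2 * c = real N * ?\<omega> / (2 * real N) ^ ?d" by (simp add: c_def)
        then show ?thesis
          using hardy_near_pointwise[OF K N(1) p R, of u x] True R(2)[of x]
          by (simp add: J_def f_def)
      next
        case False
        then have "infdist x K = 0 \<or> \<not> infdist x K < R" using infdist_nonneg[of x K] by linarith
        then show ?thesis by (auto simp: zero_power)
      qed
    qed
    also have "\<dots> = ennreal (2 powr p * 9 ^ ?d) * energy \<Omega> p u
        + ennreal (2 powr p) * (\<integral>\<^sup>+x. J x \<partial>lborel)"
      unfolding energy_def
      by (subst nn_integral_add, measurable) (subst nn_integral_cmult, measurable)+
    also have "(\<integral>\<^sup>+x. J x \<partial>lborel) = (\<integral>\<^sup>+y. ennreal (\<bar>u y\<bar> powr p) * (\<integral>\<^sup>+x\<in>{x. ?rel x y}. f x \<partial>lborel) \<partial>lborel)"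
      unfolding J_def by (rule swap_set_nn_integral) measurable
    also have "\<dots> \<le> (\<integral>\<^sup>+y. ennreal (T / real N ^ ?d) *
        (ennreal (\<bar>u y\<bar> powr p / infdist y K ^ ?d) * indicator {x. infdist x K < R} y) \<partial>lborel)"
    proof (intro nn_integral_mono)
      fix y :: 'a
      show "ennreal (\<bar>u y\<bar> powr p) * (\<integral>\<^sup>+x\<in>{x. ?rel x y}. f x \<partial>lborel)
        \<le> ennreal (T / real N ^ ?d) * (ennreal (\<bar>u y\<bar> powr p / infdist y K ^ ?d) * indicator {x. infdist x K < R} y)"
      proof (cases "y \<in> K")
        case True
        then show ?thesis by (simp add: u0)
      next
        case False
        then have "infdist y K \<noteq> 0"
          using in_closed_iff_infdist_zero[of K y] K compact_imp_closed by blast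
        then have y: "0 < infdist y K" using infdist_nonneg[of y K] by linarith
        then have a: "0 < real N * infdist y K" using N by simp
        have Ny: "infdist y K \<le> real N * infdist y K"
          using N y mult_right_mono[of 1 "real N" "infdist y K"] by simp
        have "(\<integral>\<^sup>+x\<in>{x. ?rel x y}. f x \<partial>lborel)
          \<le> (\<integral>\<^sup>+x\<in>{x. real N * infdist y K < infdist x K \<and> dist x y < 3 * infdist x K}.
              ennreal (1 / infdist x K ^ (2 * ?d)) \<partial>lborel) * indicator {x. infdist x K < R} y"
        proof (cases "infdist y K < R")
          case True
          then show ?thesis
            by (auto intro!: nn_integral_mono simp: f_def indicator_def)
        next
          case False
          then have "f x * indicator {x. ?rel x y} x = 0" for x
            using Ny by (auto simp: f_def indicator_def)
          then have "(\<integral>\<^sup>+x\<in>{x. ?rel x y}. f x \<partial>lborel) = (\<integral>\<^sup>+x. 0 \<partial>(lborel :: 'a measure))"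
            by (intro nn_integral_cong)
          then show ?thesis by simp
        qed
        also have "\<dots> \<le> ennreal (T / (real N * infdist y K) ^ ?d) * indicator {x. infdist x K < R} y"
          unfolding T_def by (intro mult_right_mono reciprocal_square_tail a) auto
        finally have "ennreal (\<bar>u y\<bar> powr p) * (\<integral>\<^sup>+x\<in>{x. ?rel x y}. f x \<partial>lborel)
          \<le> ennreal (\<bar>u y\<bar> powr p) * (ennreal (T / (real N * infdist y K) ^ ?d) * indicator {x. infdist x K < R} y)"
          by (rule mult_left_mono) simp
        also have "\<dots> = ennreal (T / real N ^ ?d) * (ennreal (\<bar>u y\<bar> powr p / infdist y K ^ ?d) * indicator {x. infdist x K < R} y)"
        proof -
          have "ennreal (\<bar>u y\<bar> powr p) * ennreal (T / (real N * infdist y K) ^ ?d)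
              = ennreal (\<bar>u y\<bar> powr p * (T / (real N * infdist y K) ^ ?d))"
            using T y by (intro ennreal_mult[symmetric]) auto
          also have "\<bar>u y\<bar> powr p * (T / (real N * infdist y K) ^ ?d)
              = T / real N ^ ?d * (\<bar>u y\<bar> powr p / infdist y K ^ ?d)"
            by (simp add: power_mult_distrib)
          also have "ennreal \<dots> = ennreal (T / real N ^ ?d) * ennreal (\<bar>u y\<bar> powr p / infdist y K ^ ?d)"
            using T y by (intro ennreal_mult) auto
          finally show ?thesis by (simp add: mult.assoc[symmetric])
        qed
        finally show ?thesis .
      qed
    qed
    also have "\<dots> = ennreal (T / real N ^ ?d) * ?H"
      unfolding hardy_integral_def by (rule nn_integral_cmult) measurable
    finally have "ennreal (2 * c) * ?H \<le> ennreal (2 powr p * 9 ^ ?d) * energy \<Omega> p u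
        + ennreal (2 powr p) * (ennreal (T / real N ^ ?d) * ?H)"
      by (meson add_left_mono mult_left_mono order_trans zero_le)
    also have "ennreal (2 powr p) * (ennreal (T / real N ^ ?d) * ?H) = ennreal (2 powr p * (T / real N ^ ?d)) * ?H"
      using T by (intro ennreal_mult_assoc) auto
    also have "\<dots> \<le> ennreal c * ?H" using cN by (intro mult_right_mono ennreal_leI) auto
    finally have "ennreal (2 * c) * ?H \<le> ennreal (2 powr p * 9 ^ ?d) * energy \<Omega> p u + ennreal c * ?H"
      by (metis add_left_mono order_trans)
    then have "ennreal c * ?H \<le> ennreal (2 powr p * 9 ^ ?d) * energy \<Omega> p u"
      by (rule ennreal_absorb_half[OF fin less_imp_le[OF c]])
    then have "ennreal (1 / c) * (ennreal c * ?H) \<le> ennreal (1 / c) * (ennreal (2 powr p * 9 ^ ?d) * energy \<Omega> p u)"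
      by (rule mult_left_mono) simp
    moreover have "ennreal (1 / c) * (ennreal c * ?H) = ?H"
      using c by (subst ennreal_mult_assoc) auto
    moreover have "ennreal (1 / c) * (ennreal (2 powr p * 9 ^ ?d) * energy \<Omega> p u) = ennreal C * energy \<Omega> p u"
      using c by (subst ennreal_mult_assoc) (auto simp: C_def)
    ultimately show "?H \<le> ennreal C * energy \<Omega> p u" by simp
  qed
qed

lemma hardy_integral_mono:
  "A \<subseteq> B \<Longrightarrow> hardy_integral K p A u \<le> hardy_integral K p B u"
  unfolding hardy_integral_def by (intro nn_integral_mono mult_left_mono) (auto simp: indicator_def)

lemma Lp_le_hardy_integral:
  fixes K A :: "'a::euclidean_space set"
  assumes [measurable]: "u \<in> borel_measurable borel" "A \<in> sets borel"
    and K: "closed K" "K \<noteq> {}" "\<And>x. x \<in> K \<Longrightarrow> u x = 0"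
    and R: "\<And>x. x \<in> A \<Longrightarrow> infdist x K \<le> R"
  shows "(\<integral>\<^sup>+x\<in>A. ennreal (\<bar>u x\<bar> powr p) \<partial>lborel) \<le> ennreal (R ^ DIM('a)) * hardy_integral K p A u"
proof -
  have "(\<integral>\<^sup>+x\<in>A. ennreal (\<bar>u x\<bar> powr p) \<partial>lborel)
    \<le> (\<integral>\<^sup>+x. ennreal (R ^ DIM('a)) * (ennreal (\<bar>u x\<bar> powr p / infdist x K ^ DIM('a)) * indicator A x) \<partial>lborel)"
  proof (intro nn_integral_mono)
    fix x :: 'a
    show "ennreal (\<bar>u x\<bar> powr p) * indicator A x
      \<le> ennreal (R ^ DIM('a)) * (ennreal (\<bar>u x\<bar> powr p / infdist x K ^ DIM('a)) * indicator A x)"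
    proof (cases "x \<in> A \<and> x \<notin> K")
      case True
      then have pos: "0 < infdist x K"
        using in_closed_iff_infdist_zero[OF K(1,2), of x] infdist_nonneg[of x K] by auto
      then have "infdist x K ^ DIM('a) \<le> R ^ DIM('a)" using R[of x] True by (intro power_mono) auto
      then have "\<bar>u x\<bar> powr p \<le> R ^ DIM('a) * (\<bar>u x\<bar> powr p / infdist x K ^ DIM('a))"
        using pos mult_right_mono[of "infdist x K ^ DIM('a)" "R ^ DIM('a)" "\<bar>u x\<bar> powr p"]
        by (simp add: field_simps)
      moreover have "0 \<le> R" using R[of x] True pos by linarith
      ultimately have "ennreal (\<bar>u x\<bar> powr p)
          \<le> ennreal (R ^ DIM('a)) * ennreal (\<bar>u x\<bar> powr p / infdist x K ^ DIM('a))"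
        by (subst ennreal_mult[symmetric]) (auto intro: ennreal_leI simp: infdist_nonneg)
      then show ?thesis using True by simp
    qed (auto simp: K)
  qed
  also have "\<dots> = ennreal (R ^ DIM('a)) * hardy_integral K p A u"
    unfolding hardy_integral_def by (rule nn_integral_cmult) measurable
  finally show ?thesis .
qed

text \<open>
  On a bounded domain the distance of two points is bounded, so the energy controls the differences of \<open>u\<close>
  directly, and the \<open>L\<^sup>p\<close> norm on a single set of positive measure controls that on the whole domain.
\<close>

lemma Lp_le_ball_plus_energy:
  fixes \<Omega> :: "'a::euclidean_space set"
  assumes [measurable]: "u \<in> borel_measurable borel" "\<Omega> \<in> sets borel" "B \<in> sets borel"
    and p: "p \<ge> 0" and B: "B \<subseteq> \<Omega>" and D: "\<And>x y. x \<in> \<Omega> \<Longrightarrow> y \<in> \<Omega> \<Longrightarrow> dist x y \<le> D"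
  shows "emeasure lborel B * (\<integral>\<^sup>+x\<in>\<Omega>. ennreal (\<bar>u x\<bar> powr p) \<partial>lborel)
    \<le> ennreal (2 powr p) * (ennreal (D ^ (2 * DIM('a))) * energy \<Omega> p u)
      + ennreal (2 powr p) * (\<integral>\<^sup>+y\<in>B. ennreal (\<bar>u y\<bar> powr p) \<partial>lborel) * emeasure lborel \<Omega>"
proof -
  let ?I = "\<integral>\<^sup>+y\<in>B. ennreal (\<bar>u y\<bar> powr p) \<partial>lborel"
  have "emeasure lborel B * (\<integral>\<^sup>+x\<in>\<Omega>. ennreal (\<bar>u x\<bar> powr p) \<partial>lborel)
      = (\<integral>\<^sup>+x. emeasure lborel B * (ennreal (\<bar>u x\<bar> powr p) * indicator \<Omega> x) \<partial>lborel)"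
    by (rule nn_integral_cmult[symmetric]) measurable
  also have "\<dots> \<le> (\<integral>\<^sup>+x. ennreal (2 powr p) * (ennreal (D ^ (2 * DIM('a))) * (energy_density \<Omega> p u x * indicator \<Omega> x))
      + ennreal (2 powr p) * ?I * indicator \<Omega> x \<partial>lborel)"
  proof (intro nn_integral_mono)
    fix x :: 'a
    show "emeasure lborel B * (ennreal (\<bar>u x\<bar> powr p) * indicator \<Omega> x)
      \<le> ennreal (2 powr p) * (ennreal (D ^ (2 * DIM('a))) * (energy_density \<Omega> p u x * indicator \<Omega> x))
      + ennreal (2 powr p) * ?I * indicator \<Omega> x"
    proof (cases "x \<in> \<Omega>")
      case True
      have "ennreal (\<bar>u x\<bar> powr p) * emeasure lborel B
        \<le> ennreal (2 powr p) * (\<integral>\<^sup>+y\<in>B. ennreal (\<bar>u x - u y\<bar> powr p) \<partial>lborel) + ennreal (2 powr p) * ?I"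
        by (intro emeasure_le_average p) measurable
      also have "\<dots> \<le> ennreal (2 powr p) * (ennreal (D ^ (2 * DIM('a))) * energy_density \<Omega> p u x)
          + ennreal (2 powr p) * ?I"
        using True B D by (intro add_mono mult_left_mono difference_le_energy_density order_refl) auto
      finally show ?thesis using True by (simp add: mult.commute)
    qed simp
  qed
  also have "\<dots> = ennreal (2 powr p) * (ennreal (D ^ (2 * DIM('a))) * energy \<Omega> p u)
      + ennreal (2 powr p) * ?I * emeasure lborel \<Omega>"
    unfolding energy_def
    by (subst nn_integral_add, measurable) (simp add: nn_integral_cmult nn_integral_cmult_indicator)
  finally show ?thesis .
qed

text \<open>
  Close to \<open>K\<close> this is \<open>hardy_near\<close>.  At distance at least \<open>R\<close> from \<open>K\<close> the weight is bounded by \<open>R\<^sup>-\<^sup>d\<close>, and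
  the \<open>L\<^sup>p\<close> norm is controlled by the energy and the \<open>L\<^sup>p\<close> norm on a ball \<open>B\<close> centred on \<open>K\<close>, where the first
  part of the argument applies.
\<close>

lemma hardy_inequality:
  fixes K \<Omega> :: "'a::euclidean_space set"
  assumes K: "compact K" "K \<noteq> {}" "spheres_meet K \<rho>" "0 < \<rho>" "K \<subseteq> \<Omega>"
    and \<Omega>: "open \<Omega>" "bounded \<Omega>" and p: "p \<ge> 0"
  obtains C where "C > 0" "\<And>u. u \<in> borel_measurable borel \<Longrightarrow> (\<And>x. x \<in> K \<Longrightarrow> u x = 0) \<Longrightarrow>
    hardy_integral K p \<Omega> u < top \<Longrightarrow> hardy_integral K p \<Omega> u \<le> ennreal C * energy \<Omega> p u"
proof -
  let ?d = "DIM('a)"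
  have [measurable]: "\<Omega> \<in> sets borel" using \<Omega> by simp
  obtain e where e: "e > 0" "(\<Union>x\<in>K. ball x e) \<subseteq> \<Omega>"
    using compact_subset_open_imp_ball_epsilon_subset[OF K(1) \<Omega>(1) K(5)] by blast
  define R where "R = min e \<rho>"
  have R: "R > 0" "R \<le> \<rho>" using e K by (auto simp: R_def)
  have near: "x \<in> \<Omega>" if "infdist x K < R" for x
  proof -
    obtain z where "z \<in> K" "infdist x K = dist x z"
      using infdist_attains_inf[OF compact_imp_closed[OF K(1)] K(2)] by blast
    then have "x \<in> ball z e" using that by (simp add: R_def dist_commute)
    then show ?thesis using e(2) \<open>z \<in> K\<close> by blast
  qed
  obtain C1 where C1: "C1 > 0" "\<And>u. u \<in> borel_measurable borel \<Longrightarrow> (\<And>x. x \<in> K \<Longrightarrow> u x = 0) \<Longrightarrow>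
    hardy_integral K p {x. infdist x K < R} u < top \<Longrightarrow>
    hardy_integral K p {x. infdist x K < R} u \<le> ennreal C1 * energy \<Omega> p u"
    by (rule hardy_near[OF K(1,2,3) p R(2), of \<Omega>]) (use near in auto)
  obtain D where D: "\<And>x y. x \<in> \<Omega> \<Longrightarrow> y \<in> \<Omega> \<Longrightarrow> dist x y \<le> D" "D > 0"
  proof -
    have "dist x y \<le> max 1 (diameter \<Omega>)" if "x \<in> \<Omega>" "y \<in> \<Omega>" for x y
      using diameter_bounded_bound[OF \<Omega>(2) that] by simp
    then show ?thesis using that[of "max 1 (diameter \<Omega>)"] by simp
  qed
  obtain z0 where z0: "z0 \<in> K" using K(2) by blast
  define B where "B = ball z0 R"
  have [measurable]: "B \<in> sets borel" by (simp add: B_def)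
  have B_near: "B \<subseteq> {x. infdist x K < R}"
  proof
    fix x assume "x \<in> B"
    then have "dist x z0 < R" by (simp add: B_def dist_commute)
    then show "x \<in> {x. infdist x K < R}" using infdist_le[OF z0, of x] by simp
  qed
  define b where "b = unit_ball_vol ?d * R ^ ?d"
  have b: "b > 0" "emeasure lborel B = ennreal b" using R by (auto simp: b_def B_def emeasure_ball)
  obtain w where w: "w \<ge> 0" "emeasure lborel \<Omega> = ennreal w"
    using emeasure_bounded_finite[OF \<Omega>(2)] by (metis ennreal_cases less_irrefl top.extremum_strict infinity_ennreal_def)
  define C where "C = C1 + 1 / R ^ ?d * (1 / b * (2 powr p * D ^ (2 * ?d) + 2 powr p * (R ^ ?d * C1) * w))"
  have C: "C > 0" unfolding C_def using C1(1) R b w D by (intro add_pos_nonneg) auto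
  show ?thesis
  proof (rule that[OF C])
    fix u :: "'a \<Rightarrow> real"
    assume u [measurable]: "u \<in> borel_measurable borel" and u0: "\<And>x. x \<in> K \<Longrightarrow> u x = 0"
      and fin: "hardy_integral K p \<Omega> u < top"
    let ?E = "energy \<Omega> p u"
    let ?Hn = "hardy_integral K p {x. infdist x K < R} u"
    let ?L = "\<integral>\<^sup>+x\<in>\<Omega>. ennreal (\<bar>u x\<bar> powr p) \<partial>lborel"
    have "?Hn \<le> hardy_integral K p \<Omega> u" by (rule hardy_integral_mono) (use near in auto)
    then have "?Hn < top" using fin by (rule order.strict_trans1)
    then have Hn: "?Hn \<le> ennreal C1 * ?E" by (intro C1(2) u u0)
    have "(\<integral>\<^sup>+y\<in>B. ennreal (\<bar>u y\<bar> powr p) \<partial>lborel) \<le> ennreal (R ^ ?d) * hardy_integral K p B u"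
      using B_near by (intro Lp_le_hardy_integral u0 K compact_imp_closed) auto
    also have "\<dots> \<le> ennreal (R ^ ?d) * (ennreal C1 * ?E)"
      using Hn by (intro mult_left_mono order_trans[OF hardy_integral_mono[OF B_near]]) auto
    also have "\<dots> = ennreal (R ^ ?d * C1) * ?E" using R C1(1) by (intro ennreal_mult_assoc) auto
    finally have IB: "(\<integral>\<^sup>+y\<in>B. ennreal (\<bar>u y\<bar> powr p) \<partial>lborel) \<le> ennreal (R ^ ?d * C1) * ?E" .
    have "ennreal b * ?L \<le> ennreal (2 powr p) * (ennreal (D ^ (2 * ?d)) * ?E)
      + ennreal (2 powr p) * (\<integral>\<^sup>+y\<in>B. ennreal (\<bar>u y\<bar> powr p) \<partial>lborel) * ennreal w"
      unfolding b(2)[symmetric] w(2)[symmetric]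
      by (rule Lp_le_ball_plus_energy) (use p D near B_near in auto)
    also have "\<dots> \<le> ennreal (2 powr p) * (ennreal (D ^ (2 * ?d)) * ?E)
      + ennreal (2 powr p) * (ennreal (R ^ ?d * C1) * ?E) * ennreal w"
      by (intro add_left_mono mult_right_mono mult_left_mono IB) auto
    also have "\<dots> = ennreal (2 powr p * D ^ (2 * ?d) + 2 powr p * (R ^ ?d * C1) * w) * ?E"
    proof -
      have "ennreal (2 powr p) * (ennreal (D ^ (2 * ?d)) * ?E) = ennreal (2 powr p * D ^ (2 * ?d)) * ?E"
        using D by (intro ennreal_mult_assoc) auto
      moreover have "ennreal (2 powr p) * (ennreal (R ^ ?d * C1) * ?E) * ennreal w
          = ennreal (2 powr p * (R ^ ?d * C1) * w) * ?E"
      proof -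
        have "ennreal (2 powr p) * (ennreal (R ^ ?d * C1) * ?E) * ennreal w
          = ennreal w * (ennreal (2 powr p) * (ennreal (R ^ ?d * C1) * ?E))" by (rule mult.commute)
        also have "\<dots> = ennreal w * (ennreal (2 powr p * (R ^ ?d * C1)) * ?E)"
          using R C1(1) by (subst ennreal_mult_assoc) auto
        also have "\<dots> = ennreal (w * (2 powr p * (R ^ ?d * C1))) * ?E"
          using R C1(1) w by (intro ennreal_mult_assoc) auto
        finally show ?thesis by (simp only: mult.commute[of w])
      qed
      moreover have "ennreal (2 powr p * D ^ (2 * ?d) + 2 powr p * (R ^ ?d * C1) * w)
          = ennreal (2 powr p * D ^ (2 * ?d)) + ennreal (2 powr p * (R ^ ?d * C1) * w)"
        using D R C1(1) w by (intro ennreal_plus) auto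
      ultimately show ?thesis by (simp only: distrib_right)
    qed
    finally have bL: "ennreal b * ?L \<le> ennreal (2 powr p * D ^ (2 * ?d) + 2 powr p * (R ^ ?d * C1) * w) * ?E" .
    have nn: "0 \<le> 2 powr p * D ^ (2 * ?d) + 2 powr p * (R ^ ?d * C1) * w" using D R C1(1) w by auto
    have "?L = ennreal (1 / b) * (ennreal b * ?L)" using b by (subst ennreal_mult_assoc) auto
    also have "\<dots> \<le> ennreal (1 / b) * (ennreal (2 powr p * D ^ (2 * ?d) + 2 powr p * (R ^ ?d * C1) * w) * ?E)"
      by (intro mult_left_mono bL) simp
    also have "\<dots> = ennreal (1 / b * (2 powr p * D ^ (2 * ?d) + 2 powr p * (R ^ ?d * C1) * w)) * ?E"
      using b nn by (intro ennreal_mult_assoc) auto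
    finally have L: "?L \<le> ennreal (1 / b * (2 powr p * D ^ (2 * ?d) + 2 powr p * (R ^ ?d * C1) * w)) * ?E" .
    have "hardy_integral K p \<Omega> u
      \<le> (\<integral>\<^sup>+x. ennreal (\<bar>u x\<bar> powr p / infdist x K ^ ?d) * indicator {x. infdist x K < R} x
          + ennreal (1 / R ^ ?d) * (ennreal (\<bar>u x\<bar> powr p) * indicator \<Omega> x) \<partial>lborel)"
      unfolding hardy_integral_def
    proof (intro nn_integral_mono)
      fix x :: 'a
      show "ennreal (\<bar>u x\<bar> powr p / infdist x K ^ ?d) * indicator \<Omega> x
        \<le> ennreal (\<bar>u x\<bar> powr p / infdist x K ^ ?d) * indicator {x. infdist x K < R} x
          + ennreal (1 / R ^ ?d) * (ennreal (\<bar>u x\<bar> powr p) * indicator \<Omega> x)"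
      proof (cases "infdist x K < R")
        case False
        then have "\<bar>u x\<bar> powr p / infdist x K ^ ?d \<le> \<bar>u x\<bar> powr p / R ^ ?d"
          using R by (intro divide_left_mono power_mono mult_pos_pos zero_less_power) auto
        also have "\<dots> = 1 / R ^ ?d * \<bar>u x\<bar> powr p" by simp
        finally have "ennreal (\<bar>u x\<bar> powr p / infdist x K ^ ?d) \<le> ennreal (1 / R ^ ?d) * ennreal (\<bar>u x\<bar> powr p)"
          using R by (subst ennreal_mult[symmetric]) (auto intro: ennreal_leI)
        then show ?thesis using False by (auto simp: indicator_def)
      next
        case True
        then show ?thesis using near[of x] by (simp add: indicator_def)
      qed
    qed
    also have "\<dots> = ?Hn + ennreal (1 / R ^ ?d) * ?L"
      unfolding hardy_integral_def
      by (subst nn_integral_add, measurable) (simp add: nn_integral_cmult)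
    also have "\<dots> \<le> ennreal C1 * ?E + ennreal (1 / R ^ ?d) *
        (ennreal (1 / b * (2 powr p * D ^ (2 * ?d) + 2 powr p * (R ^ ?d * C1) * w)) * ?E)"
      by (intro add_mono mult_left_mono L Hn) simp
    also have "\<dots> = ennreal C * ?E"
    proof -
      have "ennreal (1 / R ^ ?d) * (ennreal (1 / b * (2 powr p * D ^ (2 * ?d) + 2 powr p * (R ^ ?d * C1) * w)) * ?E)
        = ennreal (1 / R ^ ?d * (1 / b * (2 powr p * D ^ (2 * ?d) + 2 powr p * (R ^ ?d * C1) * w))) * ?E"
        using R b nn by (intro ennreal_mult_assoc) auto
      moreover have "ennreal C = ennreal C1 + ennreal (1 / R ^ ?d * (1 / b * (2 powr p * D ^ (2 * ?d) + 2 powr p * (R ^ ?d * C1) * w)))"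
        unfolding C_def using C1(1) R b nn by (intro ennreal_plus) auto
      ultimately show ?thesis by (simp only: distrib_right)
    qed
    finally show "hardy_integral K p \<Omega> u \<le> ennreal C * ?E" .
  qed
qed

section \<open>Chains of mean values\<close>

definition mean :: "'a::euclidean_space set \<Rightarrow> ('a \<Rightarrow> real) \<Rightarrow> real" where
  "mean S u = (LINT y:S|lborel. u y) / measure lborel S"

text \<open>
  If \<open>t > D/2\<close>, then \<open>t = t\<^sup>p t\<^sup>1\<^sup>-\<^sup>p \<le> t\<^sup>p (D/2)\<^sup>1\<^sup>-\<^sup>p\<close>.  Integrated, with \<open>D\<close> the deviation of a mean, this
  replaces Jensen's inequality at the price of a factor \<open>2\<^sup>p\<close>.
\<close>

lemma abs_le_half_plus_powr:
  fixes t D :: real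
  assumes "0 < D" "1 \<le> p" "0 \<le> t"
  shows "t \<le> D / 2 + (D / 2) powr (1 - p) * t powr p"
proof (cases "t \<le> D / 2")
  case False
  then have "t powr (p - 1) \<ge> (D / 2) powr (p - 1)" using assms by (intro powr_mono2) auto
  then have "1 \<le> (D / 2) powr (1 - p) * t powr (p - 1)"
    using assms False powr_gt_zero[of "D / 2" "p - 1"]
    by (simp add: powr_minus_divide[of "D / 2" "p - 1", simplified] pos_le_divide_eq)
  then have "t * 1 \<le> t * ((D / 2) powr (1 - p) * t powr (p - 1))"
    using assms(3) by (intro mult_left_mono)
  also have "\<dots> = (D / 2) powr (1 - p) * t powr p"
    using False assms by (simp add: powr_diff)
  finally show ?thesis using assms by simp
qed (use assms in \<open>simp add: add_increasing2\<close>)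

lemma mean_deviation:
  fixes u :: "'a::euclidean_space \<Rightarrow> real"
  assumes u: "set_integrable lborel S u" and [measurable]: "S \<in> sets borel" "u \<in> borel_measurable borel"
    and m: "0 < m" "emeasure lborel S = ennreal m" and p: "1 \<le> p"
  shows "ennreal (\<bar>mean S u - v\<bar> powr p * m) \<le> ennreal (2 powr p) * (\<integral>\<^sup>+y\<in>S. ennreal (\<bar>u y - v\<bar> powr p) \<partial>lborel)"
proof -
  let ?I = "\<integral>\<^sup>+y\<in>S. ennreal (\<bar>u y - v\<bar> powr p) \<partial>lborel"
  define D where "D = \<bar>mean S u - v\<bar>"
  have ms: "measure lborel S = m" using m by (simp add: measure_def)
  show ?thesis
  proof (cases "?I = top \<or> D = 0")
    case True
    then show ?thesis
      using p by (auto simp: D_def ennreal_mult_top)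
  next
    case False
    then obtain i where i: "i \<ge> 0" "?I = ennreal i" by (cases ?I) auto
    have D: "D > 0" using False by (simp add: D_def)
    have cst: "set_integrable lborel S (\<lambda>y. v)"
      using m by (simp add: set_integrable_def)
    have "m * D = \<bar>LINT y:S|lborel. u y - v\<bar>"
    proof -
      have "(LINT y:S|lborel. u y - v) = (LINT y:S|lborel. u y) - m * v"
        by (subst set_integral_diff(2)[OF u cst]) (simp add: set_lebesgue_integral_def ms)
      also have "\<dots> = m * (mean S u - v)" using m by (simp add: mean_def ms field_simps)
      finally show ?thesis using m by (simp add: D_def abs_mult)
    qed
    then have "ennreal (m * D) \<le> (\<integral>\<^sup>+y. ennreal \<bar>indicator S y * (u y - v)\<bar> \<partial>lborel)"
      using integral_norm_bound_ennreal[OF set_integral_diff(1)[OF u cst, unfolded set_integrable_def]]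
      by (simp add: set_lebesgue_integral_def)
    also have "\<dots> \<le> (\<integral>\<^sup>+y. ennreal (D / 2) * indicator S y
        + ennreal ((D / 2) powr (1 - p)) * (ennreal (\<bar>u y - v\<bar> powr p) * indicator S y) \<partial>lborel)"
      using D abs_le_half_plus_powr[OF D p, of "\<bar>u _ - v\<bar>"]
      by (intro nn_integral_mono)
        (auto simp: indicator_def simp flip: ennreal_mult ennreal_plus intro!: ennreal_leI)
    also have "\<dots> = ennreal (D / 2) * ennreal m + ennreal ((D / 2) powr (1 - p)) * ennreal i"
      by (subst nn_integral_add, measurable) (simp add: nn_integral_cmult nn_integral_cmult_indicator m i)
    also have "\<dots> = ennreal (D / 2 * m + (D / 2) powr (1 - p) * i)"
      using D m i by (simp flip: ennreal_mult ennreal_plus)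
    finally have "m * D \<le> D / 2 * m + (D / 2) powr (1 - p) * i"
      using D m i by (subst (asm) ennreal_le_iff) auto
    then have "(D / 2) * m \<le> (D / 2) powr (1 - p) * i" by (simp add: field_simps)
    then have "(D / 2) powr (p - 1) * ((D / 2) * m) \<le> (D / 2) powr (p - 1) * ((D / 2) powr (1 - p) * i)"
      by (rule mult_left_mono) simp
    moreover have "(D / 2) powr (p - 1) * (D / 2) = (D / 2) powr p" using D by (simp add: powr_diff)
    moreover have "(D / 2) powr (p - 1) * (D / 2) powr (1 - p) = 1"
      using D by (simp flip: powr_add)
    ultimately have "(D / 2) powr p * m \<le> i" by (simp flip: mult.assoc)
    then have "2 powr p * ((D / 2) powr p * m) \<le> 2 powr p * i" by (intro mult_left_mono) auto
    moreover have "2 powr p * (D / 2) powr p = D powr p" using D by (simp flip: powr_mult)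
    ultimately have "D powr p * m \<le> 2 powr p * i" by (simp flip: mult.assoc)
    then have "ennreal (D powr p * m) \<le> ennreal (2 powr p) * ennreal i"
      using i by (simp add: ennreal_leI flip: ennreal_mult)
    then show ?thesis by (simp add: D_def i)
  qed
qed

text \<open>
  Both means are replaced by integrals, one after the other; the double integral over \<open>S \<times> S'\<close> is then part of
  the energy because \<open>dist y z \<le> t\<close>.
\<close>

lemma mean_difference:
  fixes u :: "'a::euclidean_space \<Rightarrow> real"
  assumes u: "set_integrable lborel S u" "set_integrable lborel S' u"
    and [measurable]: "S \<in> sets borel" "S' \<in> sets borel" "\<Omega> \<in> sets borel" "u \<in> borel_measurable borel"
    and m: "0 < m" "emeasure lborel S = ennreal m" "0 < m'" "emeasure lborel S' = ennreal m'"
    and p: "1 \<le> p" and sub: "S \<subseteq> \<Omega>" "S' \<subseteq> \<Omega>"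
    and t: "0 \<le> t" "\<And>y z. y \<in> S \<Longrightarrow> z \<in> S' \<Longrightarrow> dist y z \<le> t"
  shows "ennreal (\<bar>mean S u - mean S' u\<bar> powr p)
    \<le> ennreal (4 powr p * t ^ (2 * DIM('a)) / (m * m')) * (\<integral>\<^sup>+y\<in>S. energy_density \<Omega> p u y \<partial>lborel)"
proof -
  let ?v = "mean S' u"
  let ?J = "\<integral>\<^sup>+y\<in>S. energy_density \<Omega> p u y \<partial>lborel"
  have inner: "ennreal (\<bar>u y - ?v\<bar> powr p)
      \<le> ennreal (1 / m' * (2 powr p * t ^ (2 * DIM('a)))) * energy_density \<Omega> p u y" if y: "y \<in> S" for y
  proof -
    have "ennreal (\<bar>?v - u y\<bar> powr p * m') \<le> ennreal (2 powr p) * (\<integral>\<^sup>+z\<in>S'. ennreal (\<bar>u z - u y\<bar> powr p) \<partial>lborel)"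
      by (rule mean_deviation[OF u(2) _ _ m(3,4) p]) measurable
    also have "\<dots> = ennreal (2 powr p) * (\<integral>\<^sup>+z\<in>S'. ennreal (\<bar>u y - u z\<bar> powr p) \<partial>lborel)"
      by (simp add: abs_minus_commute)
    also have "\<dots> \<le> ennreal (2 powr p) * (ennreal (t ^ (2 * DIM('a))) * energy_density \<Omega> p u y)"
      using sub t y by (intro mult_left_mono difference_le_energy_density) auto
    also have "\<dots> = ennreal (2 powr p * t ^ (2 * DIM('a))) * energy_density \<Omega> p u y"
      using t by (intro ennreal_mult_assoc) auto
    finally have "ennreal (1 / m') * ennreal (\<bar>?v - u y\<bar> powr p * m')
        \<le> ennreal (1 / m') * (ennreal (2 powr p * t ^ (2 * DIM('a))) * energy_density \<Omega> p u y)"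
      by (rule mult_left_mono) simp
    also have "ennreal (1 / m') * ennreal (\<bar>?v - u y\<bar> powr p * m') = ennreal (\<bar>u y - ?v\<bar> powr p)"
      using m(3) by (subst ennreal_mult[symmetric]) (auto simp: abs_minus_commute)
    also have "ennreal (1 / m') * (ennreal (2 powr p * t ^ (2 * DIM('a))) * energy_density \<Omega> p u y)
        = ennreal (1 / m' * (2 powr p * t ^ (2 * DIM('a)))) * energy_density \<Omega> p u y"
      using m(3) t by (intro ennreal_mult_assoc) auto
    finally show ?thesis .
  qed
  have "ennreal (\<bar>mean S u - ?v\<bar> powr p * m) \<le> ennreal (2 powr p) * (\<integral>\<^sup>+y\<in>S. ennreal (\<bar>u y - ?v\<bar> powr p) \<partial>lborel)"
    by (rule mean_deviation[OF u(1) _ _ m(1,2) p]) measurable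
  also have "(\<integral>\<^sup>+y\<in>S. ennreal (\<bar>u y - ?v\<bar> powr p) \<partial>lborel)
    \<le> (\<integral>\<^sup>+y. ennreal (1 / m' * (2 powr p * t ^ (2 * DIM('a)))) * (energy_density \<Omega> p u y * indicator S y) \<partial>lborel)"
    using inner by (intro nn_integral_mono) (auto simp: indicator_def)
  also have "\<dots> = ennreal (1 / m' * (2 powr p * t ^ (2 * DIM('a)))) * ?J"
    by (rule nn_integral_cmult) measurable
  finally have "ennreal (\<bar>mean S u - ?v\<bar> powr p * m)
      \<le> ennreal (2 powr p) * (ennreal (1 / m' * (2 powr p * t ^ (2 * DIM('a)))) * ?J)"
    by (simp add: mult_left_mono)
  then have "ennreal (1 / m) * ennreal (\<bar>mean S u - ?v\<bar> powr p * m)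
      \<le> ennreal (1 / m) * (ennreal (2 powr p) * (ennreal (1 / m' * (2 powr p * t ^ (2 * DIM('a)))) * ?J))"
    by (rule mult_left_mono) simp
  also have "ennreal (1 / m) * ennreal (\<bar>mean S u - ?v\<bar> powr p * m) = ennreal (\<bar>mean S u - ?v\<bar> powr p)"
    using m(1) by (subst ennreal_mult[symmetric]) auto
  also have "ennreal (1 / m) * (ennreal (2 powr p) * (ennreal (1 / m' * (2 powr p * t ^ (2 * DIM('a)))) * ?J))
      = ennreal (1 / m * (2 powr p * (1 / m' * (2 powr p * t ^ (2 * DIM('a)))))) * ?J"
    using m t by (subst ennreal_mult_assoc, simp, simp)+ simp
  also have "1 / m * (2 powr p * (1 / m' * (2 powr p * t ^ (2 * DIM('a)))))
      = 4 powr p * t ^ (2 * DIM('a)) / (m * m')"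
    using powr_mult[of 2 2 p] by simp
  finally show ?thesis .
qed

definition annulus :: "'a::euclidean_space set \<Rightarrow> 'a \<Rightarrow> real \<Rightarrow> 'a set" where
  "annulus \<Omega> x r = {y \<in> \<Omega>. r / 4 \<le> dist x y \<and> dist x y < r}"

lemma continuous_set_integrable_ball:
  fixes u :: "'a::euclidean_space \<Rightarrow> real"
  assumes "continuous_on UNIV u"
  shows "set_integrable lborel (ball z r) u"
proof (rule set_integrable_subset)
  show "set_integrable lborel (cball z r) u"
    unfolding set_integrable_def
    by (rule borel_integrable_compact) (auto intro: continuous_on_subset[OF assms])
qed auto

text \<open>
  The means of \<open>u\<close> over corkscrew balls at the radii \<open>r / 4\<^sup>j\<close> tend to \<open>u x\<close>.  Consecutive balls have comparable
  radii and distance, hence the constant in the last estimate does not depend on the scale.  What bounds the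
  \<open>j\<close>-th difference is the energy density on the \<open>j\<close>-th annulus only, and the annuli are disjoint.
\<close>

lemma mean_chain:
  fixes u :: "'a::euclidean_space \<Rightarrow> real"
  assumes u: "continuous_on UNIV u" and [measurable]: "\<Omega> \<in> sets borel"
    and p: "1 \<le> p" and \<kappa>: "0 < \<kappa>" and r: "0 < r"
    and ck: "\<And>t. 0 < t \<Longrightarrow> t \<le> r \<Longrightarrow> corkscrew \<Omega> \<kappa> x t"
  obtains a where "a \<longlonglongrightarrow> u x"
    "ennreal (\<bar>a 0\<bar> powr p)
      \<le> ennreal (2 powr p / (unit_ball_vol DIM('a) * (\<kappa> * r) ^ DIM('a))) * (\<integral>\<^sup>+y\<in>{y\<in>\<Omega>. dist x y < r}. ennreal (\<bar>u y\<bar> powr p) \<partial>lborel)"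
    "\<And>j. ennreal (\<bar>a j - a (Suc j)\<bar> powr p)
      \<le> ennreal (4 powr p * 16 ^ DIM('a) / (unit_ball_vol DIM('a) * \<kappa> ^ DIM('a))\<^sup>2)
        * (\<integral>\<^sup>+y\<in>annulus \<Omega> x (r / 4 ^ j). energy_density \<Omega> p u y \<partial>lborel)"
proof -
  let ?d = "DIM('a)"
  let ?\<omega> = "unit_ball_vol (real DIM('a))"
  have [measurable]: "u \<in> borel_measurable borel" using u by (rule borel_measurable_continuous_onI)
  define R where "R = (\<lambda>j. r / 4 ^ j)"
  have R: "0 < R j" "R j \<le> r" "R (Suc j) = R j / 4" for j
    using r by (auto simp: R_def field_simps self_le_power)
  have "\<forall>j. \<exists>z. ball z (\<kappa> * R j) \<subseteq> \<Omega> \<inter> (ball x (R j) - ball x (R j / 4))"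
    using ck R unfolding corkscrew_def by blast
  then obtain z where z: "\<And>j. ball (z j) (\<kappa> * R j) \<subseteq> \<Omega> \<inter> (ball x (R j) - ball x (R j / 4))"
    by metis
  define S where "S = (\<lambda>j. ball (z j) (\<kappa> * R j))"
  have [measurable]: "S j \<in> sets borel" for j by (simp add: S_def)
  define m where "m = (\<lambda>j. ?\<omega> * (\<kappa> * R j) ^ ?d)"
  have m: "0 < m j" "emeasure lborel (S j) = ennreal (m j)" for j
    using \<kappa> R(1)[of j] by (auto simp: m_def S_def emeasure_ball)
  have int: "set_integrable lborel (S j) u" for j
    unfolding S_def by (rule continuous_set_integrable_ball[OF u])
  have S_sub: "S j \<subseteq> annulus \<Omega> x (R j)" for j
    using z[of j] unfolding S_def annulus_def by auto
  define a where "a = (\<lambda>j. mean (S j) u)"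
  show ?thesis
  proof
    show "a \<longlonglongrightarrow> u x"
    proof (rule LIMSEQ_I)
      fix e :: real assume e: "0 < e"
      then have "0 < e / 4" by simp
      then obtain \<eta> where \<eta>: "\<eta> > 0" "\<And>y. dist y x < \<eta> \<Longrightarrow> dist (u y) (u x) < e / 4"
        using u unfolding continuous_on_iff by (metis UNIV_I)
      have "R \<longlonglongrightarrow> 0"
        unfolding R_def using LIMSEQ_inverse_realpow_zero[of 4] tendsto_mult_right_zero[of "\<lambda>j. inverse (4 ^ j)" sequentially r]
        by (simp add: divide_inverse)
      then obtain n where n: "\<And>j. n \<le> j \<Longrightarrow> R j < \<eta>"
        using \<eta>(1) order_tendstoD(2)[of R 0 sequentially \<eta>] by (auto simp: eventually_sequentially)
      have "norm (a j - u x) < e" if j: "n \<le> j" for j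
      proof -
        have close: "\<bar>u y - u x\<bar> \<le> e / 4" if "y \<in> S j" for y
          using \<eta>(2)[of y] that S_sub[of j] n[OF j] by (force simp: annulus_def dist_real_def dist_commute)
        have "ennreal (\<bar>mean (S j) u - u x\<bar> powr 1 * m j)
          \<le> ennreal (2 powr 1) * (\<integral>\<^sup>+y\<in>S j. ennreal (\<bar>u y - u x\<bar> powr 1) \<partial>lborel)"
          by (rule mean_deviation[OF int _ _ m]) measurable
        also have "\<dots> \<le> ennreal (2 powr 1) * (\<integral>\<^sup>+y\<in>S j. ennreal (e / 4) \<partial>lborel)"
          using close by (intro mult_left_mono nn_integral_mono) (auto simp: indicator_def ennreal_leI)
        also have "\<dots> = ennreal (2 * (e / 4 * m j))"
        proof -
          have "(\<integral>\<^sup>+y\<in>S j. ennreal (e / 4) \<partial>lborel) = ennreal (e / 4) * ennreal (m j)"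
            by (simp add: nn_integral_cmult_indicator m)
          also have "\<dots> = ennreal (e / 4 * m j)" using e m(1)[of j] by (intro ennreal_mult[symmetric]) auto
          finally show ?thesis using e m(1)[of j] by (simp only: powr_one) (subst ennreal_mult, auto)
        qed
        finally have "\<bar>a j - u x\<bar> * m j \<le> e / 2 * m j"
          using e m(1)[of j] by (subst (asm) ennreal_le_iff) (auto simp: a_def)
        then show ?thesis using m(1)[of j] e by simp
      qed
      then show "\<exists>n. \<forall>j\<ge>n. norm (a j - u x) < e" by blast
    qed
    have "ennreal (\<bar>a 0 - 0\<bar> powr p * m 0) \<le> ennreal (2 powr p) * (\<integral>\<^sup>+y\<in>S 0. ennreal (\<bar>u y - 0\<bar> powr p) \<partial>lborel)"
      unfolding a_def by (rule mean_deviation[OF int _ _ m p]) measurable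
    also have "\<dots> \<le> ennreal (2 powr p) * (\<integral>\<^sup>+y\<in>{y\<in>\<Omega>. dist x y < r}. ennreal (\<bar>u y\<bar> powr p) \<partial>lborel)"
      using S_sub[of 0] by (intro mult_left_mono nn_integral_mono) (auto simp: indicator_def annulus_def R_def)
    finally have "ennreal (1 / m 0) * ennreal (\<bar>a 0\<bar> powr p * m 0)
      \<le> ennreal (1 / m 0) * (ennreal (2 powr p) * (\<integral>\<^sup>+y\<in>{y\<in>\<Omega>. dist x y < r}. ennreal (\<bar>u y\<bar> powr p) \<partial>lborel))"
      by (intro mult_left_mono) auto
    also have "\<dots> = ennreal (1 / m 0 * 2 powr p) * (\<integral>\<^sup>+y\<in>{y\<in>\<Omega>. dist x y < r}. ennreal (\<bar>u y\<bar> powr p) \<partial>lborel)"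
      using m(1)[of 0] by (intro ennreal_mult_assoc) auto
    also have "ennreal (1 / m 0) * ennreal (\<bar>a 0\<bar> powr p * m 0) = ennreal (\<bar>a 0\<bar> powr p)"
      using m(1)[of 0] by (subst ennreal_mult[symmetric]) auto
    finally show "ennreal (\<bar>a 0\<bar> powr p)
      \<le> ennreal (2 powr p / (?\<omega> * (\<kappa> * r) ^ ?d)) * (\<integral>\<^sup>+y\<in>{y\<in>\<Omega>. dist x y < r}. ennreal (\<bar>u y\<bar> powr p) \<partial>lborel)"
      by (simp add: m_def R_def)
    fix j
    have dist: "dist y w \<le> 2 * R j" if "y \<in> S j" "w \<in> S (Suc j)" for y w
      using that S_sub[of j] S_sub[of "Suc j"] R[of j] dist_triangle3[of y w x]
      by (force simp: annulus_def)
    have const: "4 powr p * (2 * R j) ^ (2 * ?d) / (m j * m (Suc j)) = 4 powr p * 16 ^ ?d / (?\<omega> * \<kappa> ^ ?d)\<^sup>2"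
    proof -
      have "(2 * R j) ^ (2 * ?d) = 4 ^ ?d * (R j ^ ?d * R j ^ ?d)"
      proof -
        have "(2 * R j) ^ (2 * ?d) = (2 ^ 2) ^ ?d * R j ^ (?d + ?d)"
          unfolding power_mult_distrib power_mult by (simp flip: power_add power_mult mult_2)
        then show ?thesis by (simp only: power_add) simp
      qed
      moreover have "m j * m (Suc j) = (?\<omega> * \<kappa> ^ ?d)\<^sup>2 * (R j ^ ?d * R j ^ ?d) / 4 ^ ?d"
        by (simp add: m_def R(3) power_mult_distrib power_divide power2_eq_square)
      moreover have "(16::real) ^ ?d = 4 ^ ?d * 4 ^ ?d" by (simp flip: power_mult_distrib)
      ultimately show ?thesis using R(1)[of j] by simp
    qed
    have "ennreal (\<bar>a j - a (Suc j)\<bar> powr p)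
      \<le> ennreal (4 powr p * (2 * R j) ^ (2 * ?d) / (m j * m (Suc j))) * (\<integral>\<^sup>+y\<in>S j. energy_density \<Omega> p u y \<partial>lborel)"
      unfolding a_def
      by (rule mean_difference[OF int int _ _ _ _ m m p])
        (use S_sub R(1)[of j] dist in \<open>auto simp: annulus_def\<close>)
    also have "\<dots> \<le> ennreal (4 powr p * (2 * R j) ^ (2 * ?d) / (m j * m (Suc j)))
        * (\<integral>\<^sup>+y\<in>annulus \<Omega> x (R j). energy_density \<Omega> p u y \<partial>lborel)"
      using S_sub[of j] by (intro mult_left_mono nn_integral_mono) (auto simp: indicator_def)
    finally show "ennreal (\<bar>a j - a (Suc j)\<bar> powr p)
      \<le> ennreal (4 powr p * 16 ^ ?d / (?\<omega> * \<kappa> ^ ?d)\<^sup>2) * (\<integral>\<^sup>+y\<in>annulus \<Omega> x (r / 4 ^ j). energy_density \<Omega> p u y \<partial>lborel)"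
      unfolding const unfolding R_def .
  qed
qed

section \<open>A summation inequality\<close>

lemma Holder_sum:
  fixes a b :: "'i \<Rightarrow> real"
  assumes pq: "p > 1" "q > 1" "1/p + 1/q = 1" and fin: "finite I"
    and nn: "\<And>i. i \<in> I \<Longrightarrow> 0 \<le> a i" "\<And>i. i \<in> I \<Longrightarrow> 0 \<le> b i"
  shows "(\<Sum>i\<in>I. a i * b i) \<le> (\<Sum>i\<in>I. a i powr p) powr (1/p) * (\<Sum>i\<in>I. b i powr q) powr (1/q)"
proof -
  define P where "P = (\<Sum>i\<in>I. a i powr p)"
  define Q where "Q = (\<Sum>i\<in>I. b i powr q)"
  have PQ: "P \<ge> 0" "Q \<ge> 0" unfolding P_def Q_def by (auto intro: sum_nonneg)
  show ?thesis
  proof (cases "P = 0 \<or> Q = 0")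
    case True
    then have "\<forall>i\<in>I. a i * b i = 0"
      unfolding P_def Q_def using fin by (auto simp: sum_nonneg_eq_0_iff)
    then have "(\<Sum>i\<in>I. a i * b i) = 0" by (rule sum.neutral)
    then show ?thesis using PQ by simp
  next
    case False
    then have PQ: "P > 0" "Q > 0" using PQ by auto
    define A where "A = P powr (1/p)"
    define B where "B = Q powr (1/q)"
    have AB: "A > 0" "B > 0" "A powr p = P" "B powr q = Q"
      using PQ pq by (auto simp: A_def B_def powr_powr)
    have "a i * b i \<le> A * B * (a i powr p / (p * P) + b i powr q / (q * Q))" if "i \<in> I" for i
    proof -
      have "(a i / A) * (b i / B) \<le> (a i / A) powr p / p + (b i / B) powr q / q"
        using nn[OF that] AB pq by (intro Youngs_inequality) auto
      then have "A * B * ((a i / A) * (b i / B)) \<le> A * B * ((a i / A) powr p / p + (b i / B) powr q / q)"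
        using AB by (intro mult_left_mono) auto
      then show ?thesis using nn[OF that] AB by (simp add: powr_divide mult.commute)
    qed
    then have "(\<Sum>i\<in>I. a i * b i) \<le> (\<Sum>i\<in>I. A * B * (a i powr p / (p * P) + b i powr q / (q * Q)))"
      by (rule sum_mono)
    also have "\<dots> = A * B * (P / (p * P) + Q / (q * Q))"
      by (simp add: sum_distrib_left[symmetric] sum.distrib sum_divide_distrib[symmetric] P_def Q_def)
    also have "\<dots> = A * B" using PQ pq by simp
    finally show ?thesis by (simp add: A_def B_def P_def Q_def)
  qed
qed

text \<open>
  Put \<open>M = \<Sum> c\<^sub>i w\<^sub>i\<close> and \<open>A = M / B\<close>.  By Young's inequality \<open>w\<^sub>i\<^sup>\<theta> A\<^sup>1\<^sup>-\<^sup>\<theta> \<le> \<theta> w\<^sub>i + (1 - \<theta>) A\<close>, and the sum of the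
  right-hand sides with the weights \<open>c\<^sub>i\<close> is at most \<open>M\<close>.
\<close>

lemma sum_interpolation:
  fixes c w :: "'i \<Rightarrow> real"
  assumes \<theta>: "0 < \<theta>" "\<theta> \<le> 1" and fin: "finite I"
    and c: "\<And>i. i \<in> I \<Longrightarrow> 0 \<le> c i" and w: "\<And>i. i \<in> I \<Longrightarrow> 0 < w i"
    and B: "(\<Sum>i\<in>I. c i) \<le> B" "0 < B"
  shows "(\<Sum>i\<in>I. c i * w i powr \<theta>) \<le> (\<Sum>i\<in>I. c i * w i) powr \<theta> * B powr (1 - \<theta>)"
proof -
  define M where "M = (\<Sum>i\<in>I. c i * w i)"
  have M0: "M \<ge> 0" unfolding M_def using c w by (intro sum_nonneg) (auto simp: less_imp_le)
  show ?thesis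
  proof (cases "M = 0")
    case True
    have "\<forall>i\<in>I. c i * w i = 0"
      using True unfolding M_def by (subst (asm) sum_nonneg_eq_0_iff) (use fin c w in \<open>auto simp: less_imp_le\<close>)
    then have "\<forall>i\<in>I. c i * w i powr \<theta> = 0" using w by fastforce
    then have "(\<Sum>i\<in>I. c i * w i powr \<theta>) = 0" by (rule sum.neutral)
    then show ?thesis by simp
  next
    case False
    then have M: "M > 0" using M0 by simp
    \<comment> \<open>the value at which Young's inequality is sharp on average\<close>
    define A where "A = M / B"
    have A: "A > 0" using M B by (simp add: A_def)
    have "(\<Sum>i\<in>I. c i * w i powr \<theta>) * A powr (1 - \<theta>) = (\<Sum>i\<in>I. c i * (w i powr \<theta> * A powr (1 - \<theta>)))"
      by (simp add: sum_distrib_right mult.assoc)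
    also have "\<dots> \<le> (\<Sum>i\<in>I. c i * (\<theta> * w i + (1 - \<theta>) * A))"
      using c w A \<theta> by (intro sum_mono mult_left_mono Youngs_inequality_0) auto
    also have "\<dots> = \<theta> * M + (1 - \<theta>) * A * (\<Sum>i\<in>I. c i)"
      unfolding M_def sum_distrib_left sum.distrib[symmetric] by (intro sum.cong) (auto simp: algebra_simps)
    also have "\<dots> \<le> \<theta> * M + (1 - \<theta>) * A * B"
      using B A \<theta> by (intro add_left_mono mult_left_mono) auto
    also have "\<dots> = M"
    proof -
      have "A * B = M" using B by (simp add: A_def)
      then have "(1 - \<theta>) * A * B = (1 - \<theta>) * M" by (simp only: mult.assoc)
      then show ?thesis by (simp add: left_diff_distrib)
    qed
    finally have "(\<Sum>i\<in>I. c i * w i powr \<theta>) \<le> M / A powr (1 - \<theta>)" using A by (simp add: field_simps)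
    also have "\<dots> = M powr \<theta> * B powr (1 - \<theta>)"
      using M B by (simp add: A_def powr_divide powr_diff)
    finally show ?thesis by (simp add: M_def)
  qed
qed

text \<open>
  The ratio is at most \<open>2\<^sup>-\<^sup>1\<^sup>/\<^sup>\<tau> \<le> 1 - 1 / (2 \<tau>)\<close>, by convexity of the exponential function.
\<close>

lemma geometric_sum_le:
  fixes \<tau> q :: real
  assumes "1 \<le> \<tau>" "1 \<le> q"
  shows "(\<Sum>i<n. (2 ^ i) powr (- q / \<tau>)) \<le> 2 * \<tau>"
proof -
  define x where "x = (2::real) powr (- q / \<tau>)"
  define t where "t = 1 / \<tau>"
  have t: "0 < t" "t \<le> 1" using assms by (auto simp: t_def)
  have "- q / \<tau> \<le> - t" using assms divide_right_mono[of 1 q \<tau>] by (simp add: t_def)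
  then have "x \<le> 2 powr (- t)" unfolding x_def by (intro powr_mono) auto
  also have "\<dots> = (1/2) powr t * 1 powr (1 - t)" using powr_divide[of 1 2 t] by (simp add: powr_minus_divide)
  also have "\<dots> \<le> t * (1/2) + (1 - t) * 1" using t by (intro Youngs_inequality_0) auto
  finally have x: "x \<le> 1 - t / 2" by simp
  have x0: "0 \<le> x" "x < 1" using x t by (auto simp: x_def)
  have "(\<Sum>i<n. (2 ^ i) powr (- q / \<tau>)) = (\<Sum>i<n. x ^ i)"
    unfolding x_def by (intro sum.cong refl) (simp add: powr_realpow[symmetric] powr_powr mult.commute)
  also have "\<dots> \<le> (\<Sum>i. x ^ i)" using x0 by (intro sum_le_suminf summable_geometric) auto
  also have "\<dots> = 1 / (1 - x)" using x0 by (intro suminf_geometric) auto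
  also have "\<dots> \<le> 1 / (t / 2)" using x t by (intro divide_left_mono mult_pos_pos) auto
  finally show ?thesis by (simp add: t_def)
qed

text \<open>
  This is the origin of the power of \<open>\<tau>\<close>.  Write \<open>b\<^sub>i\<^sup>1\<^sup>/\<^sup>p = (b\<^sub>i 2\<^sup>i\<^sup>p\<^sup>/\<^sup>\<tau>)\<^sup>1\<^sup>/\<^sup>p \<cdot> 2\<^sup>-\<^sup>i\<^sup>/\<^sup>\<tau>\<close> and apply Hoelder's inequality with the
  exponents \<open>p\<close> and \<open>q = p / (p - 1)\<close>.  The second factor is a geometric sum of size \<open>2 \<tau>\<close>, raised to the power
  \<open>1/q = 1 - 1/p\<close>; the first one is interpolated between \<open>\<Sum> b\<^sub>i\<close> and \<open>\<Sum> 2\<^sup>i b\<^sub>i\<close>.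
\<close>

lemma sum_root_powr_le:
  fixes b :: "nat \<Rightarrow> real"
  assumes p: "1 < p" "p \<le> \<tau>" and b: "\<And>i. i < n \<Longrightarrow> 0 \<le> b i" and B: "(\<Sum>i<n. b i) \<le> B" "0 < B"
  shows "(\<Sum>i<n. b i powr (1/p)) powr \<tau>
    \<le> (2 * \<tau>) powr (\<tau> * (1 - 1/p)) * B powr (\<tau>/p - 1) * (\<Sum>i<n. 2 ^ i * b i)"
proof -
  define q where "q = p / (p - 1)"
  have q: "1 < q" "1/p + 1/q = 1" "1/q = 1 - 1/p" using p by (auto simp: q_def field_simps)
  define \<theta> where "\<theta> = p / \<tau>"
  have \<theta>: "0 < \<theta>" "\<theta> \<le> 1" using p by (auto simp: \<theta>_def)
  define M where "M = (\<Sum>i<n. 2 ^ i * b i)"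
  have M: "0 \<le> M" unfolding M_def using b by (intro sum_nonneg) auto
  define a where "a = (\<lambda>i. (b i * (2 ^ i) powr \<theta>) powr (1/p))"
  define v where "v = (\<lambda>i::nat. (2 ^ i) powr (- 1 / \<tau>) :: real)"
  have split: "b i powr (1/p) = a i * v i" if "i < n" for i
  proof -
    have "a i = b i powr (1/p) * (2 ^ i) powr (1 / \<tau>)"
      using b[OF that] p by (simp add: a_def powr_mult powr_powr \<theta>_def)
    then show ?thesis by (simp add: v_def mult.assoc flip: powr_add)
  qed
  have ap: "a i powr p = b i * (2 ^ i) powr \<theta>" if "i < n" for i
    using b[OF that] p by (simp add: a_def powr_powr)
  have vq: "v i powr q = (2 ^ i) powr (- q / \<tau>)" for i
    by (simp add: v_def powr_powr)
  have "(\<Sum>i<n. b i powr (1/p)) = (\<Sum>i<n. a i * v i)" using split by simp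
  also have "\<dots> \<le> (\<Sum>i<n. a i powr p) powr (1/p) * (\<Sum>i<n. v i powr q) powr (1/q)"
    using p q by (intro Holder_sum) (auto simp: a_def v_def)
  also have "\<dots> \<le> (M powr \<theta> * B powr (1 - \<theta>)) powr (1/p) * (2 * \<tau>) powr (1/q)"
  proof (intro mult_mono powr_mono2)
    have "(\<Sum>i<n. a i powr p) = (\<Sum>i<n. b i * (2 ^ i) powr \<theta>)" using ap by simp
    also have "\<dots> \<le> (\<Sum>i<n. b i * 2 ^ i) powr \<theta> * B powr (1 - \<theta>)"
      using \<theta> b B by (intro sum_interpolation) auto
    finally show "(\<Sum>i<n. a i powr p) \<le> M powr \<theta> * B powr (1 - \<theta>)" by (simp add: M_def mult.commute)
    show "(\<Sum>i<n. v i powr q) \<le> 2 * \<tau>" unfolding vq using p q by (intro geometric_sum_le) auto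
  qed (use p q in \<open>auto intro: sum_nonneg\<close>)
  finally have "(\<Sum>i<n. b i powr (1/p)) powr \<tau>
      \<le> ((M powr \<theta> * B powr (1 - \<theta>)) powr (1/p) * (2 * \<tau>) powr (1/q)) powr \<tau>"
    using p by (intro powr_mono2 sum_nonneg) auto
  also have "\<dots> = M * B powr (\<tau>/p - 1) * (2 * \<tau>) powr (\<tau> * (1 - 1/p))"
  proof -
    have 1: "(1 - \<theta>) * (1/p) * \<tau> = \<tau>/p - 1" "\<theta> * (1/p) * \<tau> = 1" using p by (auto simp: \<theta>_def field_simps)
    have "((M powr \<theta> * B powr (1 - \<theta>)) powr (1/p) * (2 * \<tau>) powr (1/q)) powr \<tau>
        = M powr (\<theta> * (1/p) * \<tau>) * B powr ((1 - \<theta>) * (1/p) * \<tau>) * (2 * \<tau>) powr (1/q * \<tau>)"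
      using M B p by (simp only: powr_mult powr_powr powr_ge_zero mult_nonneg_nonneg)
    then show ?thesis using M by (simp only: 1 q(3)) (simp add: mult.commute)
  qed
  finally show ?thesis by (simp add: M_def mult_ac)
qed

section \<open>The contributions of the scales\<close>

text \<open>
  Balls around \<open>x\<close> of radius at most half the distance to \<open>K\<close> do not see \<open>K\<close>: the distance to \<open>K\<close> is comparable
  at all their points.
\<close>

lemma infdist_comparable:
  assumes "h \<le> 1/2" "dist x y < h * infdist x K"
  shows "infdist x K \<le> 2 * infdist y K" "infdist y K \<le> 2 * infdist x K" "0 < infdist y K"
proof -
  have d: "dist x y < infdist x K / 2"
    using assms mult_right_mono[of h "1/2" "infdist x K"] infdist_nonneg[of x K] by simp
  have "infdist x K \<le> infdist y K + dist x y" "infdist y K \<le> infdist x K + dist x y"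
    using infdist_triangle[of x K y] infdist_triangle[of y K x] by (simp_all add: dist_commute)
  with d show "infdist x K \<le> 2 * infdist y K" "infdist y K \<le> 2 * infdist x K" "0 < infdist y K"
    using zero_le_dist[of x y] by linarith+
qed

text \<open>
  After a change of the order of integration, \<open>y\<close> is reached from the points \<open>x\<close> of a ball around \<open>y\<close> of radius
  \<open>2 h \<delta>(y)\<close>, on which \<open>\<delta>(x)\<close> is comparable with \<open>\<delta>(y)\<close>.
\<close>

lemma weighted_local_integral:
  fixes K :: "'a::euclidean_space set" and g :: "'a \<Rightarrow> ennreal"
  assumes [measurable]: "g \<in> borel_measurable borel" and h: "0 < h" "h \<le> 1/2"
  shows "(\<integral>\<^sup>+x. ennreal (1 / infdist x K ^ m) * (\<integral>\<^sup>+y\<in>{y. dist x y < h * infdist x K}. g y \<partial>lborel) \<partial>lborel)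
    \<le> ennreal (2 ^ m * unit_ball_vol DIM('a) * (2 * h) ^ DIM('a))
      * (\<integral>\<^sup>+y. ennreal (infdist y K ^ DIM('a) / infdist y K ^ m) * g y \<partial>lborel)"
proof -
  let ?d = "DIM('a)"
  let ?\<omega> = "unit_ball_vol (real DIM('a))"
  let ?C = "2 ^ m * ?\<omega> * (2 * h) ^ ?d"
  have inner: "(\<integral>\<^sup>+x\<in>{x. dist x y < h * infdist x K}. ennreal (1 / infdist x K ^ m) \<partial>lborel)
      \<le> ennreal ?C * ennreal (infdist y K ^ ?d / infdist y K ^ m)" for y :: 'a
  proof -
    have "(\<integral>\<^sup>+x\<in>{x. dist x y < h * infdist x K}. ennreal (1 / infdist x K ^ m) \<partial>lborel)
      \<le> (\<integral>\<^sup>+x\<in>ball y (2 * h * infdist y K). ennreal (2 ^ m / infdist y K ^ m) \<partial>lborel)"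
    proof (intro nn_integral_mono)
      fix x :: 'a
      show "ennreal (1 / infdist x K ^ m) * indicator {x. dist x y < h * infdist x K} x
        \<le> ennreal (2 ^ m / infdist y K ^ m) * indicator (ball y (2 * h * infdist y K)) x"
      proof (cases "dist x y < h * infdist x K")
        case True
        note c = infdist_comparable[OF h(2) True]
        have "h * infdist x K \<le> h * (2 * infdist y K)" using c h by (intro mult_left_mono) auto
        then have "x \<in> ball y (2 * h * infdist y K)" using True by (simp add: dist_commute)
        moreover have "1 / infdist x K ^ m \<le> 1 / (infdist y K / 2) ^ m"
          using c by (intro divide_left_mono power_mono mult_pos_pos zero_less_power) auto
        ultimately show ?thesis using True c by (simp add: power_divide ennreal_leI)
      qed simp
    qed
    also have "\<dots> = ennreal (2 ^ m / infdist y K ^ m) * ennreal (?\<omega> * (2 * h * infdist y K) ^ ?d)"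
      using h by (simp add: nn_integral_cmult_indicator emeasure_ball infdist_nonneg)
    also have "\<dots> = ennreal (?C * (infdist y K ^ ?d / infdist y K ^ m))"
      using h by (subst ennreal_mult[symmetric]) (auto simp: infdist_nonneg power_mult_distrib mult_ac)
    also have "\<dots> = ennreal ?C * ennreal (infdist y K ^ ?d / infdist y K ^ m)"
      using h by (intro ennreal_mult) (auto simp: infdist_nonneg)
    finally show ?thesis .
  qed
  have "(\<integral>\<^sup>+x. ennreal (1 / infdist x K ^ m) * (\<integral>\<^sup>+y\<in>{y. dist x y < h * infdist x K}. g y \<partial>lborel) \<partial>lborel)
      = (\<integral>\<^sup>+y. g y * (\<integral>\<^sup>+x\<in>{x. dist x y < h * infdist x K}. ennreal (1 / infdist x K ^ m) \<partial>lborel) \<partial>lborel)"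
    by (rule swap_set_nn_integral) measurable
  also have "\<dots> \<le> (\<integral>\<^sup>+y. ennreal ?C * (ennreal (infdist y K ^ ?d / infdist y K ^ m) * g y) \<partial>lborel)"
  proof (intro nn_integral_mono)
    fix y :: 'a
    have "g y * (\<integral>\<^sup>+x\<in>{x. dist x y < h * infdist x K}. ennreal (1 / infdist x K ^ m) \<partial>lborel)
      \<le> g y * (ennreal ?C * ennreal (infdist y K ^ ?d / infdist y K ^ m))"
      by (intro mult_left_mono inner) simp
    then show "g y * (\<integral>\<^sup>+x\<in>{x. dist x y < h * infdist x K}. ennreal (1 / infdist x K ^ m) \<partial>lborel)
      \<le> ennreal ?C * (ennreal (infdist y K ^ ?d / infdist y K ^ m) * g y)"
      by (simp only: mult.commute[of "g y"] mult.assoc)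
  qed
  also have "\<dots> = ennreal ?C * (\<integral>\<^sup>+y. ennreal (infdist y K ^ ?d / infdist y K ^ m) * g y \<partial>lborel)"
    by (rule nn_integral_cmult) measurable
  finally show ?thesis .
qed

text \<open>
  The bounds of \<open>mean_chain\<close> for the radius \<open>\<sigma> \<delta>(x)\<close>, without their constants: the index \<open>0\<close> belongs to the first
  mean, the index \<open>j + 1\<close> to the \<open>j\<close>-th difference.
\<close>

definition scale_term ::
    "'a::euclidean_space set \<Rightarrow> 'a set \<Rightarrow> real \<Rightarrow> real \<Rightarrow> ('a \<Rightarrow> real) \<Rightarrow> nat \<Rightarrow> 'a \<Rightarrow> ennreal" where
  "scale_term \<Omega> K \<sigma> p u i x = (case i of
      0 \<Rightarrow> ennreal (1 / infdist x K ^ DIM('a))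
            * (\<integral>\<^sup>+y\<in>{y\<in>\<Omega>. dist x y < \<sigma> * infdist x K}. ennreal (\<bar>u y\<bar> powr p) \<partial>lborel)
    | Suc j \<Rightarrow> \<integral>\<^sup>+y\<in>annulus \<Omega> x (\<sigma> * infdist x K / 4 ^ j). energy_density \<Omega> p u y \<partial>lborel)"

lemma borel_measurable_scale_term [measurable]:
  fixes u :: "'a::euclidean_space \<Rightarrow> real"
  assumes [measurable]: "u \<in> borel_measurable borel" "\<Omega> \<in> sets borel"
  shows "scale_term \<Omega> K \<sigma> p u i \<in> borel_measurable borel"
proof (cases i)
  case 0
  have "(\<lambda>x. ennreal (1 / infdist x K ^ DIM('a))
      * (\<integral>\<^sup>+y\<in>{y\<in>\<Omega>. dist x y < \<sigma> * infdist x K}. ennreal (\<bar>u y\<bar> powr p) \<partial>lborel)) \<in> borel_measurable borel"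
    by measurable
  then show ?thesis by (simp add: scale_term_def[abs_def] 0)
next
  case (Suc j)
  have "(\<lambda>x. \<integral>\<^sup>+y\<in>annulus \<Omega> x (\<sigma> * infdist x K / 4 ^ j). energy_density \<Omega> p u y \<partial>lborel) \<in> borel_measurable borel"
    unfolding annulus_def by measurable
  then show ?thesis by (simp add: scale_term_def[abs_def] Suc)
qed

lemma scale_term_0_le:
  fixes u :: "'a::euclidean_space \<Rightarrow> real"
  assumes [measurable]: "u \<in> borel_measurable borel" "\<Omega> \<in> sets borel" and \<sigma>: "\<sigma> \<le> 1/2"
  shows "scale_term \<Omega> K \<sigma> p u 0 x \<le> ennreal (2 ^ DIM('a)) * hardy_integral K p \<Omega> u"
proof -
  let ?d = "DIM('a)"
  have "scale_term \<Omega> K \<sigma> p u 0 x = (\<integral>\<^sup>+y. ennreal (1 / infdist x K ^ ?d) *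
      (ennreal (\<bar>u y\<bar> powr p) * indicator {y\<in>\<Omega>. dist x y < \<sigma> * infdist x K} y) \<partial>lborel)"
    unfolding scale_term_def by (simp, rule nn_integral_cmult[symmetric]) measurable
  also have "\<dots> \<le> (\<integral>\<^sup>+y. ennreal (2 ^ ?d) * (ennreal (\<bar>u y\<bar> powr p / infdist y K ^ ?d) * indicator \<Omega> y) \<partial>lborel)"
  proof (intro nn_integral_mono)
    fix y :: 'a
    show "ennreal (1 / infdist x K ^ ?d) *
        (ennreal (\<bar>u y\<bar> powr p) * indicator {y\<in>\<Omega>. dist x y < \<sigma> * infdist x K} y)
      \<le> ennreal (2 ^ ?d) * (ennreal (\<bar>u y\<bar> powr p / infdist y K ^ ?d) * indicator \<Omega> y)"
    proof (cases "y \<in> \<Omega> \<and> dist x y < \<sigma> * infdist x K")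
      case True
      note c = infdist_comparable[OF \<sigma> conjunct2[OF True]]
      have "1 / infdist x K ^ ?d \<le> 1 / (infdist y K / 2) ^ ?d"
        using c by (intro divide_left_mono power_mono mult_pos_pos zero_less_power) auto
      then have "1 / infdist x K ^ ?d * \<bar>u y\<bar> powr p \<le> 1 / (infdist y K / 2) ^ ?d * \<bar>u y\<bar> powr p"
        by (rule mult_right_mono) simp
      also have "\<dots> = 2 ^ ?d * (\<bar>u y\<bar> powr p / infdist y K ^ ?d)" by (simp add: power_divide)
      finally have "ennreal (1 / infdist x K ^ ?d * \<bar>u y\<bar> powr p)
          \<le> ennreal (2 ^ ?d * (\<bar>u y\<bar> powr p / infdist y K ^ ?d))" by (rule ennreal_leI)
      then have "ennreal (1 / infdist x K ^ ?d) * ennreal (\<bar>u y\<bar> powr p)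
          \<le> ennreal (2 ^ ?d) * ennreal (\<bar>u y\<bar> powr p / infdist y K ^ ?d)"
        by (subst (1 2) ennreal_mult[symmetric]) (auto simp: infdist_nonneg)
      then show ?thesis using True by simp
    qed (auto simp: indicator_def)
  qed
  also have "\<dots> = ennreal (2 ^ ?d) * hardy_integral K p \<Omega> u"
    unfolding hardy_integral_def by (rule nn_integral_cmult) measurable
  finally show ?thesis .
qed

lemma sum_annuli_le:
  fixes x :: "'a::euclidean_space" and g :: "'a \<Rightarrow> ennreal"
  assumes [measurable]: "g \<in> borel_measurable borel" "\<Omega> \<in> sets borel" and r: "0 < r"
  shows "(\<Sum>j<n. \<integral>\<^sup>+y\<in>annulus \<Omega> x (r / 4 ^ j). g y \<partial>lborel) \<le> (\<integral>\<^sup>+y\<in>\<Omega>. g y \<partial>lborel)"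
proof -
  let ?\<nu> = "density lborel g"
  let ?A = "\<lambda>j. annulus \<Omega> x (r / 4 ^ j)"
  have [measurable]: "?A j \<in> sets borel" for j unfolding annulus_def by measurable
  have em: "emeasure ?\<nu> A = (\<integral>\<^sup>+y\<in>A. g y \<partial>lborel)" if "A \<in> sets borel" for A
    using that by (subst emeasure_density) auto
  have disj_less: "?A i \<inter> ?A j = {}" if "i < j" for i j
  proof -
    have "(4::real) ^ Suc i \<le> 4 ^ j" using that by (intro power_increasing) auto
    then have "r / 4 ^ j \<le> r / 4 ^ i / 4"
      using r divide_left_mono[of "4 ^ Suc i" "4 ^ j" r] by simp
    then show ?thesis by (auto simp: annulus_def)
  qed
  have disj: "disjoint_family_on ?A {..<n}"
    unfolding disjoint_family_on_def
  proof (intro ballI impI)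
    fix i j :: nat assume "i \<noteq> j"
    then consider "i < j" | "j < i" by linarith
    then show "?A i \<inter> ?A j = {}" using disj_less[of i j] disj_less[of j i] by cases auto
  qed
  have "(\<Sum>j<n. \<integral>\<^sup>+y\<in>?A j. g y \<partial>lborel) = (\<Sum>j<n. emeasure ?\<nu> (?A j))" by (simp add: em)
  also have "\<dots> = emeasure ?\<nu> (\<Union>j<n. ?A j)"
    by (rule sum_emeasure[OF _ disj]) auto
  also have "\<dots> \<le> emeasure ?\<nu> \<Omega>" by (rule emeasure_mono) (auto simp: annulus_def)
  finally show ?thesis by (simp add: em)
qed

text \<open>
  At each point the contributions of all scales have a bounded sum, because the annuli are disjoint.
\<close>

lemma sum_scale_terms_le:
  fixes u :: "'a::euclidean_space \<Rightarrow> real"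
  assumes [measurable]: "u \<in> borel_measurable borel" "\<Omega> \<in> sets borel"
    and \<sigma>: "0 < \<sigma>" "\<sigma> \<le> 1/2" and x: "0 < infdist x K"
  shows "(\<Sum>i<Suc n. scale_term \<Omega> K \<sigma> p u i x)
    \<le> ennreal (2 ^ DIM('a)) * hardy_integral K p \<Omega> u + energy \<Omega> p u"
proof -
  have "(\<Sum>i<Suc n. scale_term \<Omega> K \<sigma> p u i x)
      = scale_term \<Omega> K \<sigma> p u 0 x
        + (\<Sum>j<n. \<integral>\<^sup>+y\<in>annulus \<Omega> x (\<sigma> * infdist x K / 4 ^ j). energy_density \<Omega> p u y \<partial>lborel)"
    by (subst sum.lessThan_Suc_shift) (simp add: scale_term_def)
  also have "\<dots> \<le> ennreal (2 ^ DIM('a)) * hardy_integral K p \<Omega> u + energy \<Omega> p u"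
    unfolding energy_def using \<sigma> x by (intro add_mono scale_term_0_le sum_annuli_le) auto
  finally show ?thesis .
qed

lemma scale_term_0_integral_le:
  fixes u :: "'a::euclidean_space \<Rightarrow> real"
  assumes [measurable]: "u \<in> borel_measurable borel" "\<Omega> \<in> sets borel" and \<sigma>: "0 < \<sigma>" "\<sigma> \<le> 1/2"
  shows "(\<integral>\<^sup>+x. ennreal (1 / infdist x K ^ DIM('a)) * scale_term \<Omega> K \<sigma> p u 0 x \<partial>lborel)
    \<le> ennreal (4 ^ DIM('a) * unit_ball_vol DIM('a)) * hardy_integral K p \<Omega> u"
proof -
  let ?d = "DIM('a)"
  let ?\<omega> = "unit_ball_vol (real DIM('a))"
  let ?g = "\<lambda>y. ennreal (\<bar>u y\<bar> powr p) * indicator \<Omega> y"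
  have "ennreal (1 / infdist x K ^ ?d) * scale_term \<Omega> K \<sigma> p u 0 x
      = ennreal (1 / infdist x K ^ (2 * ?d)) * (\<integral>\<^sup>+y\<in>{y. dist x y < \<sigma> * infdist x K}. ?g y \<partial>lborel)" for x
  proof -
    have "(\<integral>\<^sup>+y\<in>{y\<in>\<Omega>. dist x y < \<sigma> * infdist x K}. ennreal (\<bar>u y\<bar> powr p) \<partial>lborel)
      = (\<integral>\<^sup>+y\<in>{y. dist x y < \<sigma> * infdist x K}. ?g y \<partial>lborel)"
      by (intro nn_integral_cong) (auto simp: indicator_def)
    then show ?thesis
      unfolding scale_term_def mult_2 power_add
      by (simp add: ennreal_mult_assoc infdist_nonneg)
  qed
  then have "(\<integral>\<^sup>+x. ennreal (1 / infdist x K ^ ?d) * scale_term \<Omega> K \<sigma> p u 0 x \<partial>lborel)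
    \<le> ennreal (2 ^ (2 * ?d) * ?\<omega> * (2 * \<sigma>) ^ ?d)
      * (\<integral>\<^sup>+y. ennreal (infdist y K ^ ?d / infdist y K ^ (2 * ?d)) * ?g y \<partial>lborel)"
    using weighted_local_integral[of ?g \<sigma> K "2 * ?d"] \<sigma> by simp
  also have "(\<integral>\<^sup>+y. ennreal (infdist y K ^ ?d / infdist y K ^ (2 * ?d)) * ?g y \<partial>lborel) = hardy_integral K p \<Omega> u"
    unfolding hardy_integral_def
  proof (intro nn_integral_cong)
    fix y :: 'a
    have "infdist y K ^ ?d / infdist y K ^ (2 * ?d) = 1 / infdist y K ^ ?d"
      unfolding mult_2 power_add by simp
    then have "ennreal (infdist y K ^ ?d / infdist y K ^ (2 * ?d)) * ennreal (\<bar>u y\<bar> powr p)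
        = ennreal (\<bar>u y\<bar> powr p / infdist y K ^ ?d)"
      by (subst ennreal_mult[symmetric]) (auto simp: infdist_nonneg)
    then show "ennreal (infdist y K ^ ?d / infdist y K ^ (2 * ?d)) * ?g y
        = ennreal (\<bar>u y\<bar> powr p / infdist y K ^ ?d) * indicator \<Omega> y"
      by (simp add: mult.assoc[symmetric])
  qed
  also have "ennreal (2 ^ (2 * ?d) * ?\<omega> * (2 * \<sigma>) ^ ?d) * hardy_integral K p \<Omega> u
      \<le> ennreal (4 ^ ?d * ?\<omega>) * hardy_integral K p \<Omega> u"
  proof (intro mult_right_mono ennreal_leI)
    have "(2 * \<sigma>) ^ ?d \<le> 1" using \<sigma> by (intro power_le_one) auto
    then have "4 ^ ?d * ?\<omega> * (2 * \<sigma>) ^ ?d \<le> 4 ^ ?d * ?\<omega> * 1" by (intro mult_left_mono) auto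
    then show "2 ^ (2 * ?d) * ?\<omega> * (2 * \<sigma>) ^ ?d \<le> 4 ^ ?d * ?\<omega>" by (simp add: power_mult)
  qed simp
  finally show ?thesis .
qed

text \<open>
  Averaged over \<open>x\<close>, a single scale \<open>j\<close> contributes only \<open>4\<^sup>-\<^sup>j\<close> times the energy: a point \<open>y\<close> lies in the \<open>j\<close>-th
  annulus around \<open>x\<close> only for \<open>x\<close> in a ball of volume of order \<open>(4\<^sup>-\<^sup>j \<delta>(y))\<^sup>d\<close>.
\<close>

lemma scale_term_Suc_integral_le:
  fixes u :: "'a::euclidean_space \<Rightarrow> real"
  assumes [measurable]: "u \<in> borel_measurable borel" "\<Omega> \<in> sets borel" and \<sigma>: "0 < \<sigma>" "\<sigma> \<le> 1/2"
  shows "(\<integral>\<^sup>+x. ennreal (1 / infdist x K ^ DIM('a)) * scale_term \<Omega> K \<sigma> p u (Suc j) x \<partial>lborel)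
    \<le> ennreal (2 ^ DIM('a) * unit_ball_vol DIM('a) / 4 ^ j) * energy \<Omega> p u"
proof -
  let ?d = "DIM('a)"
  let ?\<omega> = "unit_ball_vol (real DIM('a))"
  let ?g = "\<lambda>y. energy_density \<Omega> p u y * indicator \<Omega> y"
  define h where "h = \<sigma> / 4 ^ j"
  have "\<sigma> / 4 ^ j \<le> \<sigma> / 1" using \<sigma> by (intro divide_left_mono) auto
  then have "h \<le> \<sigma>" by (simp add: h_def)
  then have h: "0 < h" "h \<le> 1/2" using \<sigma> by (simp add: h_def, linarith)
  have "(\<integral>\<^sup>+x. ennreal (1 / infdist x K ^ ?d) * scale_term \<Omega> K \<sigma> p u (Suc j) x \<partial>lborel)
    \<le> (\<integral>\<^sup>+x. ennreal (1 / infdist x K ^ ?d) * (\<integral>\<^sup>+y\<in>{y. dist x y < h * infdist x K}. ?g y \<partial>lborel) \<partial>lborel)"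
    by (intro nn_integral_mono mult_left_mono)
      (auto simp: scale_term_def annulus_def indicator_def h_def intro!: nn_integral_mono)
  also have "\<dots> \<le> ennreal (2 ^ ?d * ?\<omega> * (2 * h) ^ ?d)
      * (\<integral>\<^sup>+y. ennreal (infdist y K ^ ?d / infdist y K ^ ?d) * ?g y \<partial>lborel)"
    by (rule weighted_local_integral[OF _ h]) measurable
  also have "\<dots> \<le> ennreal (2 ^ ?d * ?\<omega> * (2 * h) ^ ?d) * (\<integral>\<^sup>+y. 1 * ?g y \<partial>lborel)"
    by (intro mult_left_mono nn_integral_mono mult_right_mono) (auto simp: divide_self_if)
  also have "\<dots> = ennreal (2 ^ ?d * ?\<omega> * (2 * h) ^ ?d) * energy \<Omega> p u"
    by (simp add: energy_def)
  also have "\<dots> \<le> ennreal (2 ^ ?d * ?\<omega> / 4 ^ j) * energy \<Omega> p u"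
  proof (intro mult_right_mono ennreal_leI)
    have "(2 * h) ^ ?d \<le> (2 * h) ^ 1" using h by (intro power_decreasing) auto
    also have "\<dots> \<le> 1 / 4 ^ j" using \<sigma> by (simp add: h_def divide_right_mono)
    finally have "2 ^ ?d * ?\<omega> * (2 * h) ^ ?d \<le> 2 ^ ?d * ?\<omega> * (1 / 4 ^ j)"
      by (intro mult_left_mono) auto
    then show "2 ^ ?d * ?\<omega> * (2 * h) ^ ?d \<le> 2 ^ ?d * ?\<omega> / 4 ^ j" by simp
  qed simp
  finally show ?thesis .
qed

section \<open>The inequality for functions that vanish on the surface\<close>

text \<open>
  The chain of means bounds \<open>|u x|\<close> by the sum of the \<open>p\<close>-th roots of the scale terms, and \<open>sum_root_powr_le\<close> turns
  the \<open>\<tau>\<close>-th power of that sum into a sum that is linear in the scale terms.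
\<close>

lemma pointwise_scale_bound:
  fixes u :: "'a::euclidean_space \<Rightarrow> real"
  assumes u: "continuous_on UNIV u" and [measurable]: "\<Omega> \<in> sets borel"
    and p: "1 < p" "p \<le> \<tau>" and \<kappa>: "0 < \<kappa>" and \<sigma>: "0 < \<sigma>" "\<sigma> \<le> 1/2"
    and x: "0 < infdist x K" and ck: "\<And>t. 0 < t \<Longrightarrow> t \<le> \<sigma> * infdist x K \<Longrightarrow> corkscrew \<Omega> \<kappa> x t"
    and A: "2 powr p / (unit_ball_vol DIM('a) * (\<kappa> * \<sigma>) ^ DIM('a)) \<le> A"
      "4 powr p * 16 ^ DIM('a) / (unit_ball_vol DIM('a) * \<kappa> ^ DIM('a))\<^sup>2 \<le> A"
    and B: "0 < B" "ennreal (2 ^ DIM('a)) * hardy_integral K p \<Omega> u + energy \<Omega> p u \<le> ennreal B"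
  shows "ennreal (\<bar>u x\<bar> powr \<tau>) \<le> ennreal (A powr (\<tau>/p) * ((2 * \<tau>) powr (\<tau> * (1 - 1/p)) * B powr (\<tau>/p - 1)))
      * (\<Sum>i. ennreal (2 ^ i) * scale_term \<Omega> K \<sigma> p u i x)"
proof -
  let ?d = "DIM('a)"
  let ?\<omega> = "unit_ball_vol (real DIM('a))"
  have [measurable]: "u \<in> borel_measurable borel" using u by (rule borel_measurable_continuous_onI)
  have "0 \<le> 2 powr p / (?\<omega> * (\<kappa> * \<sigma>) ^ ?d)" using \<kappa> \<sigma> by simp
  then have A0: "0 \<le> A" using A(1) by linarith
  have r: "0 < \<sigma> * infdist x K" using \<sigma> x by simp
  obtain a where lim: "a \<longlonglongrightarrow> u x"
    and a0: "ennreal (\<bar>a 0\<bar> powr p)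
      \<le> ennreal (2 powr p / (?\<omega> * (\<kappa> * (\<sigma> * infdist x K)) ^ ?d))
        * (\<integral>\<^sup>+y\<in>{y\<in>\<Omega>. dist x y < \<sigma> * infdist x K}. ennreal (\<bar>u y\<bar> powr p) \<partial>lborel)"
    and aS: "\<And>j. ennreal (\<bar>a j - a (Suc j)\<bar> powr p)
      \<le> ennreal (4 powr p * 16 ^ ?d / (?\<omega> * \<kappa> ^ ?d)\<^sup>2)
        * (\<integral>\<^sup>+y\<in>annulus \<Omega> x (\<sigma> * infdist x K / 4 ^ j). energy_density \<Omega> p u y \<partial>lborel)"
    using mean_chain[OF u \<open>\<Omega> \<in> sets borel\<close> less_imp_le[OF p(1)] \<kappa> r ck] by blast
  let ?\<beta> = "\<lambda>i. scale_term \<Omega> K \<sigma> p u i x"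
  define b where "b = (\<lambda>i. enn2real (?\<beta> i))"
  have sum_le: "(\<Sum>i<Suc n. ?\<beta> i) \<le> ennreal B" for n
    using order_trans[OF sum_scale_terms_le[OF _ _ \<sigma> x] B(2)] by simp
  have b: "?\<beta> i = ennreal (b i)" for i
  proof -
    have "?\<beta> i \<le> (\<Sum>i<Suc i. ?\<beta> i)" by simp
    also have "\<dots> \<le> ennreal B" by (rule sum_le)
    finally have "?\<beta> i < top" using order.strict_trans1 by fastforce
    then show ?thesis by (simp add: b_def)
  qed
  have b_nn: "0 \<le> b i" for i by (simp add: b_def)
  have b_sum: "(\<Sum>i<Suc n. b i) \<le> B" for n
  proof -
    have "ennreal (\<Sum>i<Suc n. b i) = (\<Sum>i<Suc n. ?\<beta> i)" unfolding b using b_nn by (intro sum_ennreal[symmetric])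
    then have "ennreal (\<Sum>i<Suc n. b i) \<le> ennreal B" using sum_le[of n] by (rule ord_eq_le_trans)
    then show ?thesis by (subst (asm) ennreal_le_iff) (use B(1) in auto)
  qed
  have a0': "\<bar>a 0\<bar> powr p \<le> A * b 0"
  proof -
    have "2 powr p / (?\<omega> * (\<kappa> * (\<sigma> * infdist x K)) ^ ?d)
        = 2 powr p / (?\<omega> * (\<kappa> * \<sigma>) ^ ?d) * (1 / infdist x K ^ ?d)"
      by (simp add: power_mult_distrib)
    also have "ennreal \<dots> = ennreal (2 powr p / (?\<omega> * (\<kappa> * \<sigma>) ^ ?d)) * ennreal (1 / infdist x K ^ ?d)"
      using \<kappa> \<sigma> x by (intro ennreal_mult) auto
    finally have "ennreal (\<bar>a 0\<bar> powr p) \<le> ennreal (2 powr p / (?\<omega> * (\<kappa> * \<sigma>) ^ ?d)) * ?\<beta> 0"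
      using a0 by (simp add: scale_term_def mult.assoc)
    also have "\<dots> \<le> ennreal A * ennreal (b 0)"
      unfolding b by (intro mult_right_mono ennreal_leI A(1)) simp
    also have "\<dots> = ennreal (A * b 0)" using A0 b_nn by (intro ennreal_mult[symmetric])
    finally show ?thesis using A0 b_nn[of 0] by (subst (asm) ennreal_le_iff) auto
  qed
  have aS': "\<bar>a j - a (Suc j)\<bar> powr p \<le> A * b (Suc j)" for j
  proof -
    have "ennreal (\<bar>a j - a (Suc j)\<bar> powr p) \<le> ennreal (4 powr p * 16 ^ ?d / (?\<omega> * \<kappa> ^ ?d)\<^sup>2) * ?\<beta> (Suc j)"
      using aS[of j] by (simp add: scale_term_def)
    also have "\<dots> \<le> ennreal A * ennreal (b (Suc j))"
      unfolding b by (intro mult_right_mono ennreal_leI A(2)) simp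
    also have "\<dots> = ennreal (A * b (Suc j))" using A0 b_nn by (intro ennreal_mult[symmetric])
    finally show ?thesis using A0 b_nn[of "Suc j"] by (subst (asm) ennreal_le_iff) auto
  qed
  have root: "t \<le> A powr (1/p) * c powr (1/p)" if "t powr p \<le> A * c" "0 \<le> t" "0 \<le> c" for t c :: real
  proof -
    have "(t powr p) powr (1/p) \<le> (A * c) powr (1/p)" using that p by (intro powr_mono2) auto
    then show ?thesis using that p A0 by (simp add: powr_powr powr_mult)
  qed
  have chain: "\<bar>a n\<bar> \<le> A powr (1/p) * (\<Sum>i<Suc n. b i powr (1/p))" for n
  proof (induction n)
    case 0
    then show ?case using root[OF a0'] b_nn by simp
  next
    case (Suc n)
    have "\<bar>a (Suc n)\<bar> \<le> \<bar>a n\<bar> + \<bar>a n - a (Suc n)\<bar>" by linarith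
    also have "\<dots> \<le> A powr (1/p) * (\<Sum>i<Suc n. b i powr (1/p)) + A powr (1/p) * b (Suc n) powr (1/p)"
      using Suc root[OF aS'] b_nn by (intro add_mono) auto
    finally show ?case by (simp add: distrib_left)
  qed
  let ?X = "A powr (\<tau>/p) * ((2 * \<tau>) powr (\<tau> * (1 - 1/p)) * B powr (\<tau>/p - 1))"
  have bound: "ennreal (\<bar>a n\<bar> powr \<tau>) \<le> ennreal ?X * (\<Sum>i. ennreal (2 ^ i) * ?\<beta> i)" for n
  proof -
    have "\<bar>a n\<bar> powr \<tau> \<le> (A powr (1/p) * (\<Sum>i<Suc n. b i powr (1/p))) powr \<tau>"
      using chain[of n] p by (intro powr_mono2) auto
    also have "\<dots> = A powr (\<tau>/p) * (\<Sum>i<Suc n. b i powr (1/p)) powr \<tau>"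
      by (simp only: powr_mult powr_powr sum_nonneg powr_ge_zero) simp
    also have "\<dots> \<le> A powr (\<tau>/p) * ((2 * \<tau>) powr (\<tau> * (1 - 1/p)) * B powr (\<tau>/p - 1) * (\<Sum>i<Suc n. 2 ^ i * b i))"
      using b_nn b_sum B(1) p by (intro mult_left_mono sum_root_powr_le) auto
    finally have le: "\<bar>a n\<bar> powr \<tau> \<le> ?X * (\<Sum>i<Suc n. 2 ^ i * b i)" by (simp only: mult.assoc)
    have "ennreal (?X * (\<Sum>i<Suc n. 2 ^ i * b i)) = ennreal ?X * ennreal (\<Sum>i<Suc n. 2 ^ i * b i)"
      using b_nn by (intro ennreal_mult sum_nonneg) auto
    also have "ennreal (\<Sum>i<Suc n. 2 ^ i * b i) = (\<Sum>i<Suc n. ennreal (2 ^ i * b i))"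
      using b_nn by (intro sum_ennreal[symmetric]) auto
    also have "\<dots> = (\<Sum>i<Suc n. ennreal (2 ^ i) * ?\<beta> i)"
      unfolding b using b_nn by (intro sum.cong refl ennreal_mult) auto
    also have "\<dots> \<le> (\<Sum>i. ennreal (2 ^ i) * ?\<beta> i)" by (intro sum_le_suminf summableI) auto
    finally have "ennreal (?X * (\<Sum>i<Suc n. 2 ^ i * b i)) \<le> ennreal ?X * (\<Sum>i. ennreal (2 ^ i) * ?\<beta> i)"
      by (simp add: mult_left_mono)
    with ennreal_leI[OF le] show ?thesis by (rule order_trans)
  qed
  have "(\<lambda>n. ennreal (\<bar>a n\<bar> powr \<tau>)) \<longlonglongrightarrow> ennreal (\<bar>u x\<bar> powr \<tau>)"
    using p by (intro tendsto_ennrealI tendsto_powr' tendsto_rabs lim tendsto_const) auto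
  then show ?thesis by (rule LIMSEQ_le_const2) (use bound in blast)
qed

text \<open>
  The linear bound of \<open>pointwise_scale_bound\<close> is integrated against \<open>\<delta>\<^sup>-\<^sup>d\<close>.  The weights \<open>2\<^sup>i\<close> that it contains are
  beaten by the decay \<open>4\<^sup>-\<^sup>i\<close> of the integrals of the scale terms, and Hardy's inequality takes care of the first term.
  The bound \<open>S\<close> of the energy is kept as a separate positive number so that powers of \<open>0\<close> do not occur.
\<close>

lemma weighted_trudinger_inequality:
  fixes K \<Omega> :: "'a::euclidean_space set"
  assumes dom: "bounded_lipschitz_domain \<Omega>"
    and K: "compact K" "K \<noteq> {}" "spheres_meet K \<rho>" "0 < \<rho>" "K \<subseteq> \<Omega>" and p: "1 < p"
  obtains C where "C > 0"
    "\<And>\<tau> u S. p \<le> \<tau> \<Longrightarrow> continuous_on UNIV u \<Longrightarrow> (\<And>x. x \<in> K \<Longrightarrow> u x = 0) \<Longrightarrow>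
      hardy_integral K p \<Omega> u < top \<Longrightarrow> 0 < S \<Longrightarrow> energy \<Omega> p u \<le> ennreal S \<Longrightarrow>
      hardy_integral K \<tau> \<Omega> u \<le> ennreal ((C * \<tau> powr (1 - 1/p)) powr \<tau> * S powr (\<tau>/p))"
proof -
  let ?d = "DIM('a)"
  let ?\<omega> = "unit_ball_vol (real DIM('a))"
  have \<Omega>: "open \<Omega>" "bounded \<Omega>" using dom by (auto simp: bounded_lipschitz_domain_def)
  have [measurable]: "\<Omega> \<in> sets borel" using \<Omega> by simp
  obtain H where H: "H > 0" "\<And>u. u \<in> borel_measurable borel \<Longrightarrow> (\<And>x. x \<in> K \<Longrightarrow> u x = 0) \<Longrightarrow>
    hardy_integral K p \<Omega> u < top \<Longrightarrow> hardy_integral K p \<Omega> u \<le> ennreal H * energy \<Omega> p u"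
    by (rule hardy_inequality[OF K \<Omega>, of p]) (use p in auto)
  obtain \<kappa> r0 where \<kappa>: "0 < \<kappa>" "0 < r0"
    and ck: "\<And>x r. x \<in> \<Omega> \<Longrightarrow> 0 < r \<Longrightarrow> r < r0 \<Longrightarrow> corkscrew \<Omega> \<kappa> x r"
    using lipschitz_domain_corkscrew[OF dom] by blast
  obtain z0 where z0: "z0 \<in> K" using K(2) by blast
  define D where "D = max 1 (diameter \<Omega>)"
  have D: "D > 0" "infdist x K \<le> D" if "x \<in> \<Omega>" for x
    using infdist_le[OF z0, of x] diameter_bounded_bound[OF \<Omega>(2) that, of z0] z0 K(5)
    by (auto simp: D_def)
  have D0: "D > 0" by (simp add: D_def)
  \<comment> \<open>small enough for the corkscrew condition at every point, whatever its distance to \<open>K\<close>\<close>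
  define \<sigma> where "\<sigma> = min (1/2) (r0 / (2 * D))"
  have \<sigma>: "0 < \<sigma>" "\<sigma> \<le> 1/2" using \<kappa> D0 by (auto simp: \<sigma>_def)
  have \<sigma>_small: "\<sigma> * infdist x K < r0" if "x \<in> \<Omega>" for x
  proof -
    have "\<sigma> * infdist x K \<le> r0 / (2 * D) * D"
      using D(2)[OF that] \<sigma> \<kappa> D0 by (intro mult_mono) (auto simp: \<sigma>_def infdist_nonneg)
    then show ?thesis using D0 \<kappa> by simp
  qed
  \<comment> \<open>one constant for the first mean and for all differences\<close>
  define A where "A = 2 powr p / (?\<omega> * (\<kappa> * \<sigma>) ^ ?d) + 4 powr p * 16 ^ ?d / (?\<omega> * \<kappa> ^ ?d)\<^sup>2"
  have A_pos: "0 < 2 powr p / (?\<omega> * (\<kappa> * \<sigma>) ^ ?d)" "0 < 4 powr p * 16 ^ ?d / (?\<omega> * \<kappa> ^ ?d)\<^sup>2"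
    using \<kappa> \<sigma> by (intro divide_pos_pos mult_pos_pos zero_less_power; simp)+
  then have A: "0 < A" "2 powr p / (?\<omega> * (\<kappa> * \<sigma>) ^ ?d) \<le> A" "4 powr p * 16 ^ ?d / (?\<omega> * \<kappa> ^ ?d)\<^sup>2 \<le> A"
    by (simp_all add: A_def)
  define G where "G = 4 ^ ?d * ?\<omega> * H + 4 * (2 ^ ?d * ?\<omega>)"
  have G: "G > 0" using H(1) by (simp add: G_def add_pos_pos)
  define L where "L = 2 ^ ?d * H + 1 + G"
  have L: "L > 0" "2 ^ ?d * H + 1 \<le> L" "G \<le> L" using H(1) G by (auto simp: L_def add_pos_pos)
  define C where "C = 2 * (A * L) powr (1/p)"
  have C: "C > 0" using A L by (simp add: C_def)
  show ?thesis
  proof (rule that[OF C])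
    fix \<tau> u S
    assume \<tau>: "p \<le> \<tau>" and u: "continuous_on UNIV u" and u0: "\<And>x. x \<in> K \<Longrightarrow> u x = (0::real)"
      and fin: "hardy_integral K p \<Omega> u < top" and S: "0 < S" and E: "energy \<Omega> p u \<le> ennreal S"
    have um [measurable]: "u \<in> borel_measurable borel" using u by (rule borel_measurable_continuous_onI)
    have HS: "hardy_integral K p \<Omega> u \<le> ennreal (H * S)"
    proof -
      have "hardy_integral K p \<Omega> u \<le> ennreal H * energy \<Omega> p u" by (intro H(2) um u0 fin)
      also have "\<dots> \<le> ennreal H * ennreal S" by (intro mult_left_mono E) simp
      finally show ?thesis using H(1) S by (simp add: ennreal_mult)
    qed
    define B where "B = L * S"
    have B0: "B > 0" using L S by (simp add: B_def)
    have B: "ennreal (2 ^ ?d) * hardy_integral K p \<Omega> u + energy \<Omega> p u \<le> ennreal B"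
    proof -
      have "ennreal (2 ^ ?d) * hardy_integral K p \<Omega> u + energy \<Omega> p u \<le> ennreal (2 ^ ?d) * ennreal (H * S) + ennreal S"
        by (intro add_mono mult_left_mono HS E) simp
      also have "\<dots> = ennreal ((2 ^ ?d * H + 1) * S)"
        using H(1) S by (simp add: distrib_right mult.assoc flip: ennreal_mult ennreal_plus)
      also have "\<dots> \<le> ennreal B"
        unfolding B_def using L S by (intro ennreal_leI mult_right_mono) auto
      finally show ?thesis .
    qed
    let ?X = "A powr (\<tau>/p) * ((2 * \<tau>) powr (\<tau> * (1 - 1/p)) * B powr (\<tau>/p - 1))"
    let ?w = "\<lambda>x. ennreal (1 / infdist x K ^ ?d)"
    let ?\<beta> = "scale_term \<Omega> K \<sigma> p u"
    have pw: "ennreal (\<bar>u x\<bar> powr \<tau> / infdist x K ^ ?d) * indicator \<Omega> x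
        \<le> ennreal ?X * (\<Sum>i. ennreal (2 ^ i) * (?w x * ?\<beta> i x))" for x
    proof (cases "x \<in> \<Omega> \<and> 0 < infdist x K")
      case True
      have "ennreal (\<bar>u x\<bar> powr \<tau>) \<le> ennreal ?X * (\<Sum>i. ennreal (2 ^ i) * ?\<beta> i x)"
        using True \<sigma>_small[of x]
        by (intro pointwise_scale_bound[where \<kappa> = \<kappa>] u p \<tau> \<kappa> \<sigma> A B0 B ck) auto
      then have "?w x * ennreal (\<bar>u x\<bar> powr \<tau>) \<le> ?w x * (ennreal ?X * (\<Sum>i. ennreal (2 ^ i) * ?\<beta> i x))"
        by (rule mult_left_mono) simp
      also have "\<dots> = ennreal ?X * (?w x * (\<Sum>i. ennreal (2 ^ i) * ?\<beta> i x))"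
        by (rule mult.left_commute)
      also have "?w x * (\<Sum>i. ennreal (2 ^ i) * ?\<beta> i x) = (\<Sum>i. ?w x * (ennreal (2 ^ i) * ?\<beta> i x))"
        by (rule ennreal_suminf_cmult[symmetric])
      also have "\<dots> = (\<Sum>i. ennreal (2 ^ i) * (?w x * ?\<beta> i x))"
        by (intro suminf_cong mult.left_commute)
      also have "?w x * ennreal (\<bar>u x\<bar> powr \<tau>) = ennreal (\<bar>u x\<bar> powr \<tau> / infdist x K ^ ?d)"
        using True by (subst ennreal_mult[symmetric]) auto
      finally show ?thesis using True by simp
    next
      case False
      then have "x \<notin> \<Omega> \<or> infdist x K = 0" using infdist_nonneg[of x K] by linarith
      then show ?thesis by (auto simp: zero_power)
    qed
    have bi: "(\<integral>\<^sup>+x. ?w x * ?\<beta> i x \<partial>lborel) \<le> ennreal (if i = 0 then 4 ^ ?d * ?\<omega> * H * S else 2 ^ ?d * ?\<omega> / 4 ^ (i - 1) * S)" for i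
    proof (cases i)
      case 0
      have "(\<integral>\<^sup>+x. ?w x * ?\<beta> 0 x \<partial>lborel) \<le> ennreal (4 ^ ?d * ?\<omega>) * hardy_integral K p \<Omega> u"
        by (rule scale_term_0_integral_le[OF _ _ \<sigma>]) measurable
      also have "\<dots> \<le> ennreal (4 ^ ?d * ?\<omega>) * ennreal (H * S)" by (intro mult_left_mono HS) simp
      also have "\<dots> = ennreal (4 ^ ?d * ?\<omega> * (H * S))" using H S by (intro ennreal_mult[symmetric]) auto
      finally show ?thesis using 0 by (simp add: mult.assoc)
    next
      case (Suc j)
      have "(\<integral>\<^sup>+x. ?w x * ?\<beta> (Suc j) x \<partial>lborel) \<le> ennreal (2 ^ ?d * ?\<omega> / 4 ^ j) * energy \<Omega> p u"
        by (rule scale_term_Suc_integral_le[OF _ _ \<sigma>]) measurable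
      also have "\<dots> \<le> ennreal (2 ^ ?d * ?\<omega> / 4 ^ j) * ennreal S" by (intro mult_left_mono E) simp
      also have "\<dots> = ennreal (2 ^ ?d * ?\<omega> / 4 ^ j * S)" using S by (intro ennreal_mult[symmetric]) auto
      finally show ?thesis using Suc by simp
    qed
    \<comment> \<open>the weight \<open>2\<^sup>i\<close> times the bound on the integral of the \<open>i\<close>-th scale term\<close>
  define c where "c = (\<lambda>i. 2 ^ i * (if i = 0 then 4 ^ ?d * ?\<omega> * H * S else 2 ^ ?d * ?\<omega> / 4 ^ (i - 1) * S))"
    have c_nn: "0 \<le> c i" for i using H S by (simp add: c_def)
    have cS: "(\<lambda>i. c (Suc i)) sums (4 * (2 ^ ?d * ?\<omega>) * S)"
    proof -
      have "c (Suc i) = 2 * (2 ^ ?d * ?\<omega>) * S * (1/2) ^ i" for i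
        by (simp add: c_def power_one_over field_simps flip: power_mult_distrib)
      moreover have "(\<lambda>i. 2 * (2 ^ ?d * ?\<omega>) * S * (1/2) ^ i) sums (2 * (2 ^ ?d * ?\<omega>) * S * 2)"
        by (intro sums_mult) (use geometric_sums[of "1/2 :: real"] in simp)
      ultimately show ?thesis by (simp add: mult_ac)
    qed
    have "c sums (4 * (2 ^ ?d * ?\<omega>) * S + c 0)" by (rule sums_Suc[OF cS])
    then have c_sums: "c sums (G * S)" by (simp add: c_def G_def distrib_right add.commute)
    have "hardy_integral K \<tau> \<Omega> u \<le> (\<integral>\<^sup>+x. ennreal ?X * (\<Sum>i. ennreal (2 ^ i) * (?w x * ?\<beta> i x)) \<partial>lborel)"
      unfolding hardy_integral_def by (intro nn_integral_mono pw)
    also have "\<dots> = ennreal ?X * (\<Sum>i. ennreal (2 ^ i) * (\<integral>\<^sup>+x. ?w x * ?\<beta> i x \<partial>lborel))"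
      by (subst nn_integral_cmult, measurable) (subst nn_integral_suminf, measurable, subst nn_integral_cmult, measurable)
    also have "\<dots> \<le> ennreal ?X * (\<Sum>i. ennreal (c i))"
    proof (intro mult_left_mono suminf_le summableI)
      fix i
      have "ennreal (2 ^ i) * (\<integral>\<^sup>+x. ?w x * ?\<beta> i x \<partial>lborel)
        \<le> ennreal (2 ^ i) * ennreal (if i = 0 then 4 ^ ?d * ?\<omega> * H * S else 2 ^ ?d * ?\<omega> / 4 ^ (i - 1) * S)"
        by (intro mult_left_mono bi) simp
      also have "\<dots> = ennreal (c i)"
        unfolding c_def using H S by (intro ennreal_mult[symmetric]) auto
      finally show "ennreal (2 ^ i) * (\<integral>\<^sup>+x. ?w x * ?\<beta> i x \<partial>lborel) \<le> ennreal (c i)" .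
    qed simp
    also have "(\<Sum>i. ennreal (c i)) = ennreal (G * S)"
      using suminf_ennreal2[OF c_nn sums_summable[OF c_sums]] sums_unique[OF c_sums] by simp
    also have "ennreal ?X * ennreal (G * S) = ennreal (?X * (G * S))"
      using G S by (intro ennreal_mult[symmetric]) auto
    also have "\<dots> \<le> ennreal ((C * \<tau> powr (1 - 1/p)) powr \<tau> * S powr (\<tau>/p))"
    proof (rule ennreal_leI)
      have t0: "0 < \<tau>" using p \<tau> by simp
      have "?X * (G * S) \<le> ?X * B"
        unfolding B_def using L S by (intro mult_left_mono mult_right_mono) auto
      also have "\<dots> = A powr (\<tau>/p) * (2 * \<tau>) powr (\<tau> * (1 - 1/p)) * B powr (\<tau>/p)"
        using B0 by (simp add: powr_diff)
      also have "\<dots> = 2 powr (\<tau> * (1 - 1/p)) * ((A * L) powr (\<tau>/p) * \<tau> powr (\<tau> * (1 - 1/p)) * S powr (\<tau>/p))"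
        using A L S t0 by (simp add: B_def powr_mult)
      also have "\<dots> \<le> 2 powr \<tau> * ((A * L) powr (\<tau>/p) * \<tau> powr (\<tau> * (1 - 1/p)) * S powr (\<tau>/p))"
        using p t0 by (intro mult_right_mono powr_mono) (auto simp: mult_le_cancel_left1)
      also have "\<dots> = (C * \<tau> powr (1 - 1/p)) powr \<tau> * S powr (\<tau>/p)"
        using A L t0 by (simp add: C_def powr_mult powr_powr mult.commute[of \<tau>])
      finally show "?X * (G * S) \<le> (C * \<tau> powr (1 - 1/p)) powr \<tau> * S powr (\<tau>/p)" .
    qed
    finally show "hardy_integral K \<tau> \<Omega> u \<le> ennreal ((C * \<tau> powr (1 - 1/p)) powr \<tau> * S powr (\<tau>/p))" .
  qed
qed

section \<open>Passage to the closure of the test functions\<close>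

lemma ennreal_powr_ennreal: "0 \<le> a \<Longrightarrow> ennreal_powr (ennreal a) b = ennreal (a powr b)"
  by (simp add: ennreal_powr_def)

lemma ennreal_powr_inverse:
  assumes "0 < p"
  shows "ennreal_powr (ennreal_powr X (1/p)) p = X"
  using assms by (cases X) (auto simp: ennreal_powr_def powr_powr)

lemma ennreal_powr_less_imp:
  assumes "ennreal_powr X (1/p) < ennreal (c powr (1/p))" "0 < p" "0 < c"
  shows "X < ennreal c"
proof (cases X)
  case (real a)
  then have "a powr (1/p) < c powr (1/p)"
    using assms by (simp add: ennreal_powr_ennreal ennreal_less_iff)
  then have "a < c" using assms powr_mono2[of "1/p" c a] by (meson divide_nonneg_pos less_imp_le linorder_not_less zero_le_one)
  then show ?thesis using real by (simp add: ennreal_less_iff)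
qed (use assms in \<open>simp add: ennreal_powr_def\<close>)

lemma Wsp_seminorm_eq_energy:
  fixes u :: "'a::euclidean_space \<Rightarrow> real"
  assumes "s * p = real DIM('a)"
  shows "Wsp_seminorm s p \<Omega> u = ennreal_powr (energy \<Omega> p u) (1/p)"
proof -
  have kernel: "\<bar>u x - u y\<bar> powr p / norm (x - y) powr (real DIM('a) + s * p) = gagliardo p u x y" for x y
  proof (cases "x = y")
    case False
    then have "norm (x - y) powr (real DIM('a) + s * p) = norm (x - y) powr (real (2 * DIM('a)))"
      using assms by simp
    also have "\<dots> = norm (x - y) ^ (2 * DIM('a))" using False by (intro powr_realpow) auto
    finally show ?thesis by (simp add: gagliardo_def dist_norm)
  qed (simp add: gagliardo_def)
  show ?thesis
    unfolding Wsp_seminorm_def kernel energy_def energy_density_def nn_integral_completion ..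
qed

lemma Wsp_norm_eq:
  fixes u :: "'a::euclidean_space \<Rightarrow> real"
  assumes "s * p = real DIM('a)" "0 < p"
  shows "Wsp_norm s p \<Omega> u
    = ennreal_powr (energy \<Omega> p u + (\<integral>\<^sup>+x\<in>\<Omega>. ennreal (\<bar>u x\<bar> powr p) \<partial>lborel)) (1/p)"
  unfolding Wsp_norm_def Lp_norm_on_def Wsp_seminorm_eq_energy[OF assms(1)]
    ennreal_powr_inverse[OF assms(2)] nn_integral_completion ..

lemma energy_cong_AE:
  assumes ae: "AE x in lborel. x \<in> \<Omega> \<longrightarrow> u x = v x"
  shows "energy \<Omega> p u = energy \<Omega> p v"
proof -
  have "energy_density \<Omega> p u x = energy_density \<Omega> p v x" if "u x = v x" for x
    unfolding energy_density_def
    by (rule nn_integral_cong_AE) (use ae that in \<open>auto simp: gagliardo_def indicator_def elim!: eventually_mono\<close>)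
  then show ?thesis
    unfolding energy_def
    by (intro nn_integral_cong_AE) (use ae in \<open>auto simp: indicator_def elim!: eventually_mono\<close>)
qed

text \<open>
  A triangle inequality with a constant; the constant only affects the constant of the theorem.
\<close>

lemma energy_triangle:
  fixes v w :: "'a::euclidean_space \<Rightarrow> real"
  assumes [measurable]: "v \<in> borel_measurable borel" "w \<in> borel_measurable borel" "\<Omega> \<in> sets borel" and p: "0 \<le> p"
  shows "energy \<Omega> p w \<le> ennreal (2 powr p) * (energy \<Omega> p v + energy \<Omega> p (\<lambda>x. v x - w x))"
proof -
  let ?z = "\<lambda>x. v x - w x"
  have g: "gagliardo p w x y \<le> 2 powr p * gagliardo p ?z x y + 2 powr p * gagliardo p v x y" for x y
  proof -
    have "\<bar>w x - w y\<bar> powr p \<le> 2 powr p * \<bar>(w x - w y) - (v x - v y)\<bar> powr p + 2 powr p * \<bar>v x - v y\<bar> powr p"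
      by (rule abs_powr_triangle[OF p])
    also have "\<bar>(w x - w y) - (v x - v y)\<bar> = \<bar>?z x - ?z y\<bar>" by linarith
    finally have "\<bar>w x - w y\<bar> powr p / dist x y ^ (2 * DIM('a))
      \<le> (2 powr p * \<bar>?z x - ?z y\<bar> powr p + 2 powr p * \<bar>v x - v y\<bar> powr p) / dist x y ^ (2 * DIM('a))"
      by (rule divide_right_mono) simp
    then show ?thesis by (simp add: gagliardo_def add_divide_distrib)
  qed
  have dens: "energy_density \<Omega> p w x
      \<le> ennreal (2 powr p) * energy_density \<Omega> p ?z x + ennreal (2 powr p) * energy_density \<Omega> p v x" for x
  proof -
    have "energy_density \<Omega> p w x \<le> (\<integral>\<^sup>+y. ennreal (2 powr p) * (ennreal (gagliardo p ?z x y) * indicator \<Omega> y)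
        + ennreal (2 powr p) * (ennreal (gagliardo p v x y) * indicator \<Omega> y) \<partial>lborel)"
      unfolding energy_density_def
    proof (intro nn_integral_mono)
      fix y
      have "ennreal (gagliardo p w x y) \<le> ennreal (2 powr p * gagliardo p ?z x y + 2 powr p * gagliardo p v x y)"
        by (rule ennreal_leI[OF g])
      also have "\<dots> = ennreal (2 powr p) * ennreal (gagliardo p ?z x y) + ennreal (2 powr p) * ennreal (gagliardo p v x y)"
        by (subst ennreal_plus) (auto simp: gagliardo_nonneg ennreal_mult)
      finally show "ennreal (gagliardo p w x y) * indicator \<Omega> y
        \<le> ennreal (2 powr p) * (ennreal (gagliardo p ?z x y) * indicator \<Omega> y)
        + ennreal (2 powr p) * (ennreal (gagliardo p v x y) * indicator \<Omega> y)"
        by (auto simp: indicator_def)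
    qed
    also have "\<dots> = ennreal (2 powr p) * energy_density \<Omega> p ?z x + ennreal (2 powr p) * energy_density \<Omega> p v x"
      unfolding energy_density_def
      by (subst nn_integral_add, measurable) (subst nn_integral_cmult, measurable)+
    finally show ?thesis .
  qed
  have "energy \<Omega> p w \<le> (\<integral>\<^sup>+x. ennreal (2 powr p) * (energy_density \<Omega> p ?z x * indicator \<Omega> x)
        + ennreal (2 powr p) * (energy_density \<Omega> p v x * indicator \<Omega> x) \<partial>lborel)"
    unfolding energy_def by (intro nn_integral_mono) (use dens in \<open>auto simp: indicator_def\<close>)
  also have "\<dots> = ennreal (2 powr p) * energy \<Omega> p ?z + ennreal (2 powr p) * energy \<Omega> p v"
    unfolding energy_def
    by (subst nn_integral_add, measurable) (subst nn_integral_cmult, measurable)+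
  finally show ?thesis by (simp add: distrib_left add.commute)
qed

text \<open>
  The Hardy integral is finite because its integrand is continuous on the compact support, which is disjoint from \<open>K\<close>.
\<close>

lemma test_function_properties:
  fixes \<phi> :: "'a::euclidean_space \<Rightarrow> real"
  assumes \<phi>: "\<phi> \<in> Cc_infinity (\<Omega> - K)" and K: "closed K" "K \<noteq> {}" and p: "0 < p"
  shows "continuous_on UNIV \<phi>" "\<And>x. x \<in> K \<Longrightarrow> \<phi> x = 0" "hardy_integral K p \<Omega> \<phi> < top"
proof -
  define Z where "Z = closure {x. \<phi> x \<noteq> 0}"
  have Z: "compact Z" "Z \<subseteq> \<Omega> - K" and "Ck 0 \<phi>"
    using \<phi> by (auto simp: Cc_infinity_def Z_def simp del: Ck.simps)
  then show cont: "continuous_on UNIV \<phi>" by simp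
  have out: "\<phi> x = 0" if "x \<notin> Z" for x
    using that closure_subset[of "{x. \<phi> x \<noteq> 0}"] by (auto simp: Z_def)
  then show "\<And>x. x \<in> K \<Longrightarrow> \<phi> x = 0" using Z by blast
  let ?h = "\<lambda>x. \<bar>\<phi> x\<bar> powr p / infdist x K ^ DIM('a)"
  have "continuous_on Z ?h"
    using p Z(2) in_closed_iff_infdist_zero[OF K]
    by (intro continuous_on_divide continuous_on_powr' continuous_on_power continuous_on_infdist
        continuous_on_rabs continuous_on_const continuous_on_id continuous_on_subset[OF cont]) auto
  then have "bounded (?h ` Z)" using Z(1) by (intro compact_imp_bounded compact_continuous_image)
  then obtain M where "\<forall>y\<in>?h ` Z. norm y \<le> M" unfolding bounded_iff by blast
  then have M: "?h x \<le> M" if "x \<in> Z" for x using that by (auto simp: infdist_nonneg)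
  have [measurable]: "Z \<in> sets borel" using Z(1) by (simp add: compact_imp_closed)
  have "hardy_integral K p \<Omega> \<phi> \<le> (\<integral>\<^sup>+x\<in>Z. ennreal M \<partial>lborel)"
    unfolding hardy_integral_def
    by (intro nn_integral_mono) (use out M in \<open>auto simp: indicator_def intro: ennreal_leI\<close>)
  also have "\<dots> = ennreal M * emeasure lborel Z" by (simp add: nn_integral_cmult_indicator)
  also have "\<dots> < top"
    using emeasure_bounded_finite[OF compact_imp_bounded[OF Z(1)]] by (simp add: ennreal_mult_less_top)
  finally show "hardy_integral K p \<Omega> \<phi> < top" .
qed

lemma AE_tendsto_of_summable_Lp:
  fixes v :: "'a::euclidean_space \<Rightarrow> real"
  assumes [measurable]: "v \<in> borel_measurable borel" "\<And>n. \<phi> n \<in> borel_measurable borel" "\<Omega> \<in> sets borel"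
    and p: "0 < p"
    and fin: "(\<Sum>n. \<integral>\<^sup>+x\<in>\<Omega>. ennreal (\<bar>v x - \<phi> n x\<bar> powr p) \<partial>lborel) < top"
  shows "AE x in lborel. x \<in> \<Omega> \<longrightarrow> (\<lambda>n. \<phi> n x) \<longlonglongrightarrow> v x"
proof -
  have "(\<integral>\<^sup>+x. (\<Sum>n. ennreal (\<bar>v x - \<phi> n x\<bar> powr p) * indicator \<Omega> x) \<partial>lborel)
      = (\<Sum>n. \<integral>\<^sup>+x\<in>\<Omega>. ennreal (\<bar>v x - \<phi> n x\<bar> powr p) \<partial>lborel)"
    by (rule nn_integral_suminf) measurable
  then have "(\<integral>\<^sup>+x. (\<Sum>n. ennreal (\<bar>v x - \<phi> n x\<bar> powr p) * indicator \<Omega> x) \<partial>lborel) \<noteq> \<infinity>"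
    using fin by simp
  then have "AE x in lborel. (\<Sum>n. ennreal (\<bar>v x - \<phi> n x\<bar> powr p) * indicator \<Omega> x) \<noteq> \<infinity>"
    by (intro nn_integral_noteq_infinite) measurable
  then show ?thesis
  proof eventually_elim
    case (elim x)
    show ?case
    proof
      assume "x \<in> \<Omega>"
      then have "summable (\<lambda>n. \<bar>v x - \<phi> n x\<bar> powr p)"
        using elim by (intro summable_suminf_not_top) auto
      then have "(\<lambda>n. \<bar>v x - \<phi> n x\<bar> powr p) \<longlonglongrightarrow> 0" by (rule summable_LIMSEQ_zero)
      then have "(\<lambda>n. (\<bar>v x - \<phi> n x\<bar> powr p) powr (1/p)) \<longlonglongrightarrow> 0 powr (1/p)"
        using p by (intro tendsto_powr' tendsto_const) auto
      then have "(\<lambda>n. \<bar>v x - \<phi> n x\<bar>) \<longlonglongrightarrow> 0" using p by (simp add: powr_powr)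
      then have "(\<lambda>n. v x - \<phi> n x) \<longlonglongrightarrow> 0" by (rule tendsto_rabs_zero_cancel)
      then have "(\<lambda>n. v x - (v x - \<phi> n x)) \<longlonglongrightarrow> v x - 0" by (intro tendsto_diff tendsto_const)
      then show "(\<lambda>n. \<phi> n x) \<longlonglongrightarrow> v x" by simp
    qed
  qed
qed

lemma hardy_integral_liminf:
  fixes v :: "'a::euclidean_space \<Rightarrow> real"
  assumes [measurable]: "\<And>n. \<phi> n \<in> borel_measurable borel" "\<Omega> \<in> sets borel"
    and \<tau>: "0 < \<tau>" and ae: "AE x in lborel. x \<in> \<Omega> \<longrightarrow> (\<lambda>n. \<phi> n x) \<longlonglongrightarrow> v x"
  shows "hardy_integral K \<tau> \<Omega> v \<le> liminf (\<lambda>n. hardy_integral K \<tau> \<Omega> (\<phi> n))"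
proof -
  let ?f = "\<lambda>w x. ennreal (\<bar>w x\<bar> powr \<tau> / infdist x K ^ DIM('a)) * indicator \<Omega> x"
  have "AE x in lborel. ?f v x \<le> liminf (\<lambda>n. ?f (\<phi> n) x)"
    using ae
  proof eventually_elim
    case (elim x)
    have "(\<lambda>n. ?f (\<phi> n) x) \<longlonglongrightarrow> ?f v x"
    proof (cases "x \<in> \<Omega>")
      case True
      then have "(\<lambda>n. \<bar>\<phi> n x\<bar> powr \<tau> * inverse (infdist x K ^ DIM('a))) \<longlonglongrightarrow> \<bar>v x\<bar> powr \<tau> * inverse (infdist x K ^ DIM('a))"
        using elim \<tau> by (intro tendsto_mult tendsto_powr' tendsto_rabs tendsto_const) auto
      then show ?thesis using True by (simp add: divide_inverse tendsto_ennrealI)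
    qed simp
    then have "liminf (\<lambda>n. ?f (\<phi> n) x) = ?f v x" by (intro lim_imp_Liminf) auto
    then show ?case by simp
  qed
  then have "hardy_integral K \<tau> \<Omega> v \<le> (\<integral>\<^sup>+x. liminf (\<lambda>n. ?f (\<phi> n) x) \<partial>lborel)"
    unfolding hardy_integral_def by (rule nn_integral_mono_AE)
  also have "\<dots> \<le> liminf (\<lambda>n. hardy_integral K \<tau> \<Omega> (\<phi> n))"
    unfolding hardy_integral_def by (rule nn_integral_liminf) measurable
  finally show ?thesis .
qed

text \<open>
  The test functions approximate \<open>u\<close> at a summable rate, which gives convergence almost everywhere.  The function \<open>u\<close>
  is only measurable with respect to the completed measure on \<open>\<Omega>\<close>; a Borel function \<open>v\<close> that agrees with it almost
  everywhere has the same integrals and admits Tonelli's theorem.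
\<close>

lemma Wsp_zero_approximation:
  fixes u :: "'a::euclidean_space \<Rightarrow> real"
  assumes u: "u \<in> Wsp_zero s p \<Omega> K" and sp: "s * p = real DIM('a)" and p: "0 < p"
    and \<Omega>: "\<Omega> \<in> sets borel" and K: "closed K" "K \<noteq> {}"
  obtains e \<phi> where "0 \<le> e" "energy \<Omega> p u = ennreal e" "\<And>n. \<phi> n \<in> Cc_infinity (\<Omega> - K)"
    "\<And>n. energy \<Omega> p (\<phi> n) \<le> ennreal (2 powr p * (e + (1/2) ^ n))"
    "AE x in lborel. x \<in> \<Omega> \<longrightarrow> (\<lambda>n. \<phi> n x) \<longlonglongrightarrow> u x"
proof -
  note [measurable] = \<Omega>
  have uW: "u \<in> borel_measurable (lebesgue_on \<Omega>)" "Wsp_norm s p \<Omega> u < top"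
    using u by (auto simp: Wsp_zero_def Wsp_def)
  have "(\<lambda>x. if x \<in> \<Omega> then u x else 0) \<in> borel_measurable lebesgue"
    using uW(1) \<Omega> by (subst borel_measurable_if) auto
  from completion_ex_borel_measurable_real[OF this] obtain v
    where "v \<in> borel_measurable lborel" and v_eq: "AE x in lborel. (if x \<in> \<Omega> then u x else 0) = v x"
    by blast
  then have v [measurable]: "v \<in> borel_measurable borel" by simp
  from v_eq have ae: "AE x in lborel. x \<in> \<Omega> \<longrightarrow> u x = v x" by (auto elim!: eventually_mono split: if_splits)
  have "energy \<Omega> p u \<noteq> top"
    using uW(2) unfolding Wsp_norm_eq[OF sp p] by (auto simp: ennreal_powr_def split: if_splits)
  then obtain e where e: "0 \<le> e" "energy \<Omega> p u = ennreal e" by (cases "energy \<Omega> p u") auto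
  have "\<exists>\<phi>\<in>Cc_infinity (\<Omega> - K). Wsp_norm s p \<Omega> (\<lambda>x. u x - \<phi> x) < ennreal (((1/2) ^ n) powr (1/p))" for n :: nat
    using u by (auto simp: Wsp_zero_def)
  then obtain \<phi> where \<phi>: "\<And>n. \<phi> n \<in> Cc_infinity (\<Omega> - K)"
    and close: "\<And>n. Wsp_norm s p \<Omega> (\<lambda>x. u x - \<phi> n x) < ennreal (((1/2) ^ n) powr (1/p))"
    by metis
  have m [measurable]: "\<phi> n \<in> borel_measurable borel" for n
    by (rule borel_measurable_continuous_onI[OF test_function_properties(1)[OF \<phi> K p]])
  have small: "energy \<Omega> p (\<lambda>x. u x - \<phi> n x) + (\<integral>\<^sup>+x\<in>\<Omega>. ennreal (\<bar>u x - \<phi> n x\<bar> powr p) \<partial>lborel) < ennreal ((1/2) ^ n)" for n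
    by (rule ennreal_powr_less_imp[OF close[of n, unfolded Wsp_norm_eq[OF sp p]] p]) simp
  have En: "energy \<Omega> p (\<lambda>x. v x - \<phi> n x) \<le> ennreal ((1/2) ^ n)" for n
  proof -
    have "energy \<Omega> p (\<lambda>x. v x - \<phi> n x) = energy \<Omega> p (\<lambda>x. u x - \<phi> n x)"
      by (rule energy_cong_AE) (use ae in \<open>auto elim!: eventually_mono\<close>)
    also have "\<dots> \<le> energy \<Omega> p (\<lambda>x. u x - \<phi> n x) + (\<integral>\<^sup>+x\<in>\<Omega>. ennreal (\<bar>u x - \<phi> n x\<bar> powr p) \<partial>lborel)" by simp
    also have "\<dots> \<le> ennreal ((1/2) ^ n)" using small[of n] by (rule less_imp_le)
    finally show ?thesis .
  qed
  have Ln: "(\<integral>\<^sup>+x\<in>\<Omega>. ennreal (\<bar>v x - \<phi> n x\<bar> powr p) \<partial>lborel) \<le> ennreal ((1/2) ^ n)" for n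
  proof -
    have "(\<integral>\<^sup>+x\<in>\<Omega>. ennreal (\<bar>v x - \<phi> n x\<bar> powr p) \<partial>lborel) = (\<integral>\<^sup>+x\<in>\<Omega>. ennreal (\<bar>u x - \<phi> n x\<bar> powr p) \<partial>lborel)"
      by (rule nn_integral_cong_AE) (use ae in \<open>auto simp: indicator_def elim!: eventually_mono\<close>)
    also have "\<dots> \<le> energy \<Omega> p (\<lambda>x. u x - \<phi> n x) + (\<integral>\<^sup>+x\<in>\<Omega>. ennreal (\<bar>u x - \<phi> n x\<bar> powr p) \<partial>lborel)" by simp
    also have "\<dots> \<le> ennreal ((1/2) ^ n)" using small[of n] by (rule less_imp_le)
    finally show ?thesis .
  qed
  show ?thesis
  proof (rule that[OF e \<phi>])
    fix n
    have "energy \<Omega> p (\<phi> n) \<le> ennreal (2 powr p) * (energy \<Omega> p v + energy \<Omega> p (\<lambda>x. v x - \<phi> n x))"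
      using p by (intro energy_triangle) auto
    also have "energy \<Omega> p v = ennreal e" using energy_cong_AE[OF ae] e(2) by metis
    also have "ennreal (2 powr p) * (ennreal e + energy \<Omega> p (\<lambda>x. v x - \<phi> n x)) \<le> ennreal (2 powr p) * (ennreal e + ennreal ((1/2) ^ n))"
      by (intro mult_left_mono add_left_mono En) simp
    also have "\<dots> = ennreal (2 powr p * (e + (1/2) ^ n))"
      using e(1) by (simp add: ennreal_mult)
    finally show "energy \<Omega> p (\<phi> n) \<le> ennreal (2 powr p * (e + (1/2) ^ n))" .
  next
    have "(\<Sum>n. \<integral>\<^sup>+x\<in>\<Omega>. ennreal (\<bar>v x - \<phi> n x\<bar> powr p) \<partial>lborel) \<le> (\<Sum>n. ennreal ((1/2) ^ n))"
      by (intro suminf_le Ln summableI)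
    also have "\<dots> = ennreal (\<Sum>n. (1/2) ^ n)"
      by (intro suminf_ennreal2 summable_geometric) auto
    also have "\<dots> < top" by simp
    finally have "AE x in lborel. x \<in> \<Omega> \<longrightarrow> (\<lambda>n. \<phi> n x) \<longlonglongrightarrow> v x"
      by (rule AE_tendsto_of_summable_Lp[OF v m \<Omega> p])
    with ae show "AE x in lborel. x \<in> \<Omega> \<longrightarrow> (\<lambda>n. \<phi> n x) \<longlonglongrightarrow> u x"
      by eventually_elim auto
  qed
qed

text \<open>
  The estimate for test functions passes to the limit by Fatou's lemma.  As \<open>s p = d\<close>, the exponent \<open>(d - s) / d\<close> is
  \<open>1 - 1/p\<close>, the one produced by \<open>sum_root_powr_le\<close>.
\<close>

theorem theorem2:
  fixes \<Omega> K :: "(real^'d::finite) set" and k :: nat and s p :: real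
  assumes "1 < k" and "k < CARD('d)"
    and "bounded_lipschitz_domain \<Omega>"
    and "C01_compact_surface k \<Omega> K"
    and "1 < p" and "0 < s" and "s < 1"
    and "s * p = real CARD('d)"
  shows "\<exists>C::real. C > 0 \<and> (\<forall>\<tau>\<ge>p. \<forall>u\<in>Wsp_zero s p \<Omega> K.
    ennreal_powr
      (\<integral>\<^sup>+x\<in>\<Omega>. ennreal (\<bar>u x\<bar> powr \<tau> / infdist x K ^ CARD('d)) \<partial>lebesgue)
      (1 / \<tau>)
    \<le> ennreal (C * \<tau> powr ((real CARD('d) - s) / real CARD('d))) * Wsp_seminorm s p \<Omega> u)"
proof -
  have p: "0 < p" "1 < p" using \<open>1 < p\<close> by auto
  have sp: "s * p = real DIM(real^'d)" using \<open>s * p = real CARD('d)\<close> by simp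
  have exponent: "(real CARD('d) - s) / real CARD('d) = 1 - 1/p"
    unfolding \<open>s * p = real CARD('d)\<close>[symmetric] using \<open>0 < s\<close> p by (simp add: field_simps)
  have \<Omega>: "\<Omega> \<in> sets borel"
    using \<open>bounded_lipschitz_domain \<Omega>\<close> by (simp add: bounded_lipschitz_domain_def)
  have K: "compact K" "K \<noteq> {}" "K \<subseteq> \<Omega>"
    using \<open>C01_compact_surface k \<Omega> K\<close> by (auto simp: C01_compact_surface_def)
  obtain \<rho> where \<rho>: "0 < \<rho>" "spheres_meet K \<rho>"
    using C01_surface_spheres_meet[OF \<open>C01_compact_surface k \<Omega> K\<close> \<open>k < CARD('d)\<close>] by blast
  obtain C where C: "C > 0" and core:
    "\<And>\<tau> u S. p \<le> \<tau> \<Longrightarrow> continuous_on UNIV u \<Longrightarrow> (\<And>x. x \<in> K \<Longrightarrow> u x = 0) \<Longrightarrow>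
      hardy_integral K p \<Omega> u < top \<Longrightarrow> 0 < S \<Longrightarrow> energy \<Omega> p u \<le> ennreal S \<Longrightarrow>
      hardy_integral K \<tau> \<Omega> u \<le> ennreal ((C * \<tau> powr (1 - 1/p)) powr \<tau> * S powr (\<tau>/p))"
    using weighted_trudinger_inequality[OF \<open>bounded_lipschitz_domain \<Omega>\<close> K(1,2) \<rho>(2,1) K(3) p(2)] by blast
  show ?thesis
  proof (intro exI[of _ "2 * C"] conjI allI impI ballI)
    show "2 * C > 0" using C by simp
    fix \<tau> u assume \<tau>: "p \<le> \<tau>" and u: "u \<in> Wsp_zero s p \<Omega> K"
    have \<tau>0: "0 < \<tau>" using p \<tau> by simp
    obtain e \<phi> where e: "0 \<le> e" "energy \<Omega> p u = ennreal e"
      and \<phi>: "\<And>n. \<phi> n \<in> Cc_infinity (\<Omega> - K)"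
      and E: "\<And>n. energy \<Omega> p (\<phi> n) \<le> ennreal (2 powr p * (e + (1/2) ^ n))"
      and lim: "AE x in lborel. x \<in> \<Omega> \<longrightarrow> (\<lambda>n. \<phi> n x) \<longlonglongrightarrow> u x"
      using Wsp_zero_approximation[OF u sp p(1) \<Omega> compact_imp_closed[OF K(1)] K(2)] by blast
    note test = test_function_properties[OF \<phi> compact_imp_closed[OF K(1)] K(2) p(1)]
    define M where "M = (C * \<tau> powr (1 - 1/p)) powr \<tau>"
    have M: "0 \<le> M" by (simp add: M_def)
    have bound: "hardy_integral K \<tau> \<Omega> (\<phi> n) \<le> ennreal (M * (2 powr p * (e + (1/2) ^ n)) powr (\<tau>/p))" for n
      unfolding M_def
    proof (rule core[OF \<tau> test(1) test(2) test(3) _ E])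
      show "0 < 2 powr p * (e + (1/2) ^ n)" using e(1) by (simp add: add_nonneg_pos)
    qed
    have "(\<lambda>n. M * (2 powr p * (e + (1/2) ^ n)) powr (\<tau>/p)) \<longlonglongrightarrow> M * (2 powr p * (e + 0)) powr (\<tau>/p)"
      using e(1) p \<tau>0
      by (intro tendsto_mult tendsto_powr' tendsto_add tendsto_const LIMSEQ_power_zero)
        (auto intro!: eventually_sequentiallyI)
    then have "liminf (\<lambda>n. ennreal (M * (2 powr p * (e + (1/2) ^ n)) powr (\<tau>/p))) = ennreal (M * (2 powr p * (e + 0)) powr (\<tau>/p))"
      by (intro lim_imp_Liminf tendsto_ennrealI) auto
    moreover have "hardy_integral K \<tau> \<Omega> u \<le> liminf (\<lambda>n. hardy_integral K \<tau> \<Omega> (\<phi> n))"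
      by (rule hardy_integral_liminf[OF borel_measurable_continuous_onI[OF test(1)] \<Omega> \<tau>0 lim])
    moreover have "\<dots> \<le> liminf (\<lambda>n. ennreal (M * (2 powr p * (e + (1/2) ^ n)) powr (\<tau>/p)))"
      by (intro Liminf_mono always_eventually allI bound)
    ultimately have hardy: "hardy_integral K \<tau> \<Omega> u \<le> ennreal (M * (2 powr p * e) powr (\<tau>/p))"
      by simp
    obtain h where h: "0 \<le> h" "hardy_integral K \<tau> \<Omega> u = ennreal h"
      using hardy by (cases "hardy_integral K \<tau> \<Omega> u") (auto simp: top_unique)
    have "h \<le> M * (2 powr p * e) powr (\<tau>/p)" using hardy h M by (simp add: ennreal_le_iff)
    then have "h powr (1/\<tau>) \<le> (M * (2 powr p * e) powr (\<tau>/p)) powr (1/\<tau>)"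
      using h \<tau>0 by (intro powr_mono2) auto
    also have "\<dots> = 2 * C * \<tau> powr (1 - 1/p) * e powr (1/p)"
      using C p \<tau>0 e(1) by (simp add: M_def powr_mult powr_powr)
    finally have "ennreal (h powr (1/\<tau>)) \<le> ennreal (2 * C * \<tau> powr (1 - 1/p)) * ennreal (e powr (1/p))"
      using C by (subst ennreal_mult[symmetric]) (auto intro: ennreal_leI)
    moreover have "(\<integral>\<^sup>+x\<in>\<Omega>. ennreal (\<bar>u x\<bar> powr \<tau> / infdist x K ^ CARD('d)) \<partial>lebesgue) = ennreal h"
      using h(2) by (simp add: hardy_integral_def nn_integral_completion)
    ultimately show "ennreal_powr
        (\<integral>\<^sup>+x\<in>\<Omega>. ennreal (\<bar>u x\<bar> powr \<tau> / infdist x K ^ CARD('d)) \<partial>lebesgue)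
        (1 / \<tau>)
      \<le> ennreal (2 * C * \<tau> powr ((real CARD('d) - s) / real CARD('d))) * Wsp_seminorm s p \<Omega> u"
      using e h unfolding exponent Wsp_seminorm_eq_energy[OF sp] by (simp add: ennreal_powr_ennreal)
  qed
qed

end
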